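(* Consider the stochastic $K$-armed bandit problem with arm means $\mu_1,\dots,\mu_K\in[0,1]$, where the time horizon $T$ is unknown to the algorithm. Let $\mu_*=\max_{i\in[K]}\mu_i$, $\Delta_i=\mu_*-\mu_i$, and $\Delta=\min_{i:\Delta_i>0}\Delta_i$. Then there exists an algorithm that uses $O(1)$ words of space and, for any $T>0$, achieves pseudo-regret \[ \overline{\Psi}_T = O\left(\sum_{i:\Delta_i>0}\frac{1}{\Delta_i}\log\frac{\Delta_i}{\Delta}\,\log T\right). \]
   Context: Stochastic bandit model: there are $K$ arms; arm $i\in[K]$ has a distribution $\mathcal{D}_i$ supported on $[0,1]$ with mean $\mu_i$. At each time step $t=1,2,\dots,T$ the player chooses an arm $I_t\in[K]$ (depending only on past observations and internal randomness) and receives reward $X_{I_t,t}$, where the rewards $X_{i,t}$ are drawn from $\mathcal{D}_i$ independently across $i$ and $t$. The pseudo-regret is $\overline{\Psi}_T=\max_{i\in[K]}\left(\mathbb{E}\left[\sum_{t=1}^T X_{i,t}\right]-\mathbb{E}\left[\sum_{t=1}^T X_{I_t,t}\right]\right)$. Space is measured in words in the word-RAM model: each input value (such as $K$, $T$, a reward) and each variable occupies $O(1)$ words of $O(\log(KT))$ bits. The $O(\cdot)$ hides an absolute constant independent of $K$, $T$ and the arm distributions.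
   Formalization: Both logarithms, log(Δ_i/Δ) and log T, are replaced by max(1, ln ·), because the bound as written is 0 when T = 1 or when all positive gaps equal Δ (e.g. K = 2), where no algorithm can have zero regret on all instances. *)

theory Defs
  imports "HOL-Probability.Probability"
begin

text \<open>
  The player is a program for a word RAM: one fixed program, whose only input is the number
  \<open>K\<close> of arms (in particular it does not know the horizon). Arms are numbered \<open>0, \<dots>, K - 1\<close>.
  The memory is an array of natural numbers; the limit on the number and on the size of the
  words in use is imposed by \<open>uses_space\<close> below.
\<close>

datatype instr =
    Const nat nat
  | Add nat nat nat
  | Sub nat nat nat
  | Mult nat nat nat
  | Div nat nat nat
  | Mod nat nat nat
  | Load nat nat
  | Store nat nat
  | Jump nat
  | Jump_Less nat nat nat
  | Rand nat nat
  | Pull nat nat nat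

type_synonym program = "instr list"

text \<open>
  Only \<open>pc\<close> and \<open>mem\<close> belong to the machine. The other fields are bookkeeping that no instruction
  can read: \<open>time\<close> counts the arms pulled so far, \<open>last_arm\<close> is the arm pulled most recently and
  \<open>draws\<close> counts the random words drawn so far.
\<close>

record config =
  pc :: nat
  mem :: "nat \<Rightarrow> nat"
  time :: nat
  last_arm :: nat
  draws :: nat

definition assign :: "nat \<Rightarrow> nat \<Rightarrow> config \<Rightarrow> config" where
  "assign a v s = s\<lparr>pc := Suc (pc s), mem := (mem s)(a := v)\<rparr>"

text \<open>
  \<open>x (i, t)\<close> is the reward of arm \<open>i\<close> at time \<open>t = 1, 2, \<dots>\<close>, and \<open>u n\<close> is the \<open>n\<close>-th random seed,
  uniform on \<open>[0, 1)\<close>; thus \<open>Rand a b\<close> puts a uniform number below \<open>mem s b\<close> into word \<open>a\<close>.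
  A reward is a real number and does not fit into a word. \<open>Pull a b d\<close> pulls arm \<open>mem s a\<close> and
  reads the reward rounded down to a multiple of \<open>1 / q\<close>, for a precision \<open>q = mem s b\<close> of the
  program's choice; the numerator is stored in word \<open>d\<close>.
  Outside the program the machine has halted.
\<close>

fun exec :: "(nat \<times> nat \<Rightarrow> real) \<Rightarrow> (nat \<Rightarrow> real) \<Rightarrow> instr \<Rightarrow> config \<Rightarrow> config" where
  "exec x u (Const a k) s = assign a k s"
| "exec x u (Add a b c) s = assign a (mem s b + mem s c) s"
| "exec x u (Sub a b c) s = assign a (mem s b - mem s c) s"
| "exec x u (Mult a b c) s = assign a (mem s b * mem s c) s"
| "exec x u (Div a b c) s = assign a (mem s b div mem s c) s"
| "exec x u (Mod a b c) s = assign a (mem s b mod mem s c) s"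
| "exec x u (Load a b) s = assign a (mem s (mem s b)) s"
| "exec x u (Store a b) s = assign (mem s a) (mem s b) s"
| "exec x u (Jump l) s = s\<lparr>pc := l\<rparr>"
| "exec x u (Jump_Less a b l) s = s\<lparr>pc := (if mem s a < mem s b then l else Suc (pc s))\<rparr>"
| "exec x u (Rand a b) s =
     (assign a (nat \<lfloor>u (draws s) * real (mem s b)\<rfloor>) s)\<lparr>draws := Suc (draws s)\<rparr>"
| "exec x u (Pull a b d) s =
     (assign d (nat \<lfloor>x (mem s a, Suc (time s)) * real (mem s b)\<rfloor>) s)
       \<lparr>time := Suc (time s), last_arm := mem s a\<rparr>"

definition step ::
  "program \<Rightarrow> (nat \<times> nat \<Rightarrow> real) \<Rightarrow> (nat \<Rightarrow> real) \<Rightarrow> config \<Rightarrow> config" where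
  "step P x u s = (if pc s < length P then exec x u (P ! pc s) s else s)"

definition init :: "nat \<Rightarrow> config" where
  "init K = \<lparr>pc = 0, mem = (\<lambda>_. 0)(0 := K), time = 0, last_arm = 0, draws = 0\<rparr>"

definition run ::
  "program \<Rightarrow> nat \<Rightarrow> (nat \<times> nat \<Rightarrow> real) \<Rightarrow> (nat \<Rightarrow> real) \<Rightarrow> nat \<Rightarrow> config" where
  "run P K x u n = (step P x u ^^ n) (init K)"

definition chosen_arm ::
  "program \<Rightarrow> nat \<Rightarrow> (nat \<times> nat \<Rightarrow> real) \<Rightarrow> (nat \<Rightarrow> real) \<Rightarrow> nat \<Rightarrow> nat" where
  "chosen_arm P K x u t = last_arm (run P K x u (LEAST n. time (run P K x u n) = t))"

definition reward_tables :: "nat \<Rightarrow> (nat \<times> nat \<Rightarrow> real) set" where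
  "reward_tables K = ({..<K} \<times> {1..}) \<rightarrow> {0..1}"

definition seeds :: "(nat \<Rightarrow> real) set" where
  "seeds = UNIV \<rightarrow> {0..<1}"

text \<open>The program never gets stuck and only pulls arms that exist.\<close>

definition plays_forever :: "program \<Rightarrow> nat \<Rightarrow> bool" where
  "plays_forever P K \<longleftrightarrow> (\<forall>x \<in> reward_tables K. \<forall>u \<in> seeds. \<forall>t \<ge> 1.
     (\<exists>n. time (run P K x u n) = t) \<and> chosen_arm P K x u t < K)"

text \<open>
  For every horizon \<open>T\<close>, whatever the rewards and the random seeds, the computation up to time \<open>T\<close>
  only uses the words at the addresses below \<open>c\<close>, and each of them holds at most
  \<open>d * log 2 (K * T + 1)\<close> bits. This is the size \<open>O(log (K T))\<close>; the summand 1 leaves room for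
  a constant number of bits in the case \<open>K = T = 1\<close>.
\<close>

definition uses_space :: "program \<Rightarrow> nat \<Rightarrow> nat \<Rightarrow> nat \<Rightarrow> bool" where
  "uses_space P K c d \<longleftrightarrow> (\<forall>x \<in> reward_tables K. \<forall>u \<in> seeds. \<forall>T > 0. \<forall>n.
     time (run P K x u n) \<le> T \<longrightarrow>
       (\<forall>a. mem (run P K x u n) a \<noteq> 0 \<longrightarrow> a < c \<and> mem (run P K x u n) a < (K * T + 1) ^ d))"

text \<open>\<open>D i\<close> is the reward distribution of arm \<open>i\<close>.\<close>

definition bandit_instance :: "nat \<Rightarrow> (nat \<Rightarrow> real measure) \<Rightarrow> bool" where
  "bandit_instance K D \<longleftrightarrow>
     (\<forall>i<K. prob_space (D i) \<and> sets (D i) = sets borel \<and> emeasure (D i) {0..1} = 1)"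

text \<open>
  The sample space consists of pairs \<open>(x, u)\<close> of a reward table and a sequence of seeds, all entries
  being independent.
\<close>

definition bandit_space ::
  "nat \<Rightarrow> (nat \<Rightarrow> real measure) \<Rightarrow> ((nat \<times> nat \<Rightarrow> real) \<times> (nat \<Rightarrow> real)) measure" where
  "bandit_space K D =
     (\<Pi>\<^sub>M p \<in> {..<K} \<times> {1..}. D (fst p)) \<Otimes>\<^sub>M
     (\<Pi>\<^sub>M n \<in> UNIV. uniform_measure lborel {0..<1})"

definition pseudo_regret :: "program \<Rightarrow> nat \<Rightarrow> (nat \<Rightarrow> real measure) \<Rightarrow> nat \<Rightarrow> real" where
  "pseudo_regret P K D T =
     Max ((\<lambda>i. (\<integral>\<omega>. (\<Sum>t=1..T. fst \<omega> (i, t)) \<partial>bandit_space K D)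
             - (\<integral>\<omega>. (\<Sum>t=1..T. fst \<omega> (chosen_arm P K (fst \<omega>) (snd \<omega>) t, t)) \<partial>bandit_space K D))
          ` {..<K})"

definition mean :: "(nat \<Rightarrow> real measure) \<Rightarrow> nat \<Rightarrow> real" where
  "mean D i = (\<integral>r. r \<partial>D i)"

definition gap :: "nat \<Rightarrow> (nat \<Rightarrow> real measure) \<Rightarrow> nat \<Rightarrow> real" where
  "gap K D i = Max (mean D ` {..<K}) - mean D i"

definition min_gap :: "nat \<Rightarrow> (nat \<Rightarrow> real measure) \<Rightarrow> real" where
  "min_gap K D = Min (gap K D ` {i. i < K \<and> gap K D i > 0})"

text \<open>
  The logarithms in the regret bound are understood to be at least 1. With the plain logarithm the
  bound would vanish for \<open>T = 1\<close>, and also whenever all the nonzero gaps coincide (for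
  example for two arms), although no player has regret 0 on all such instances.
\<close>

definition log1 :: "real \<Rightarrow> real" where
  "log1 y = max 1 (ln y)"

end

theory Submission
  imports Defs
begin

text \<open>
  The player keeps a leader and one candidate for its succession. Pass \<open>r\<close> estimates the mean of the
  leader up to \<open>2\<^sup>-\<^sup>r / 16\<close> and then compares every arm with it on the scales
  \<open>2\<^sup>-\<^sup>j\<close>, \<open>j = 0, \<dots>, r\<close>, until the arm is rejected. A cheap test on scale \<open>j\<close> takes
  \<open>4096 * 4\<^sup>j * (1 + \<bar>g - j\<bar>)\<close> pulls, so it is unreliable only near the level \<open>g\<close>, a running
  guess of the scale of the smallest gap. An arm that survives a cheap test is verified with probability
  \<open>(j + 1 - g) / \<lambda>\<close>, and always if \<open>j = r\<close>: the tests are repeated with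
  \<open>4096 * 4\<^sup>j * \<lambda>\<close> pulls, which are never wrong up to a negligible probability. A rejection by a
  verified test on scale \<open>j\<close> raises \<open>g\<close> to \<open>j\<close>, and the verified survivor with the best
  estimate becomes the next leader. Tests far above the level are expensive, but they are
  also likely to trigger a verification that raises the level, so their cost is paid by a potential that
  decreases with \<open>g\<close>; and as the best arm fails to become visible in a pass with a small constant
  probability only, an imprecise leader costs a convergent geometric series.

  For a horizon of \<open>16\<^sup>\<lambda>\<close> at most \<open>2 \<lambda>\<close> passes are completed, and an arm with a gap of about
  \<open>2\<^sup>-\<^sup>m\<close> is pulled \<open>O(\<lambda> 4\<^sup>m (1 + m0 - m))\<close> times if the smallest gap is about
  \<open>2\<^sup>-\<^sup>m\<^sup>0\<close>. As the horizon is unknown, \<open>\<lambda>\<close> is doubled after \<open>16\<^sup>\<lambda>\<close> pulls, and the costs of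
  these epochs form a geometric series.
\<close>

subsection \<open>The potential argument\<close>

text \<open>The pulls of one fixed suboptimal arm \<open>q\<close> are bounded by backward induction
  over the states. No event that all estimates are accurate is formed: an inaccurate test is charged
  its probability times the worst cost to come. For \<open>lam\<close> repetitions this charge is
  \<open>rho ^ lam * 16 ^ lam\<close>, that is \<open>2 ^ (- 16 * lam)\<close>, which stays
  negligible when multiplied by the number of tests, as \<open>K\<close> is at most
  \<open>16 ^ lam\<close>. Cheap tests err with constant probability near the level, and yet a whole
  run over the scales must rarely fail. The repetition number \<open>1 + |g - j|\<close> makes the
  error probabilities summable on both sides of \<open>g\<close>; a constant number would not, and
  \<open>lam\<close> repetitions in each of \<open>2 * lam\<close> passes would square the logarithm
  of the horizon. The chance \<open>(j + 1 - g) / lam\<close> turns the price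
  \<open>4 ^ j * lam\<close> of a verification into the order of the cheap test itself. Accurate
  verifications against an optimal leader never raise the level above \<open>m0\<close>, and
  \<open>m0 - m\<close> is the logarithm of the ratio of the gaps.\<close>

definition rho :: real where "rho = 1 / 2 ^ 20"

lemma rho_pos: "0 < rho" and rho_le: "rho \<le> 1 / 1000000"
  by (auto simp: rho_def)

definition wt :: "nat \<Rightarrow> nat \<Rightarrow> nat" where
  "wt g j = Suc ((g - j) + (j - g))"

definition c0 :: real where "c0 = 4096"

text \<open>In pass \<open>r\<close> rewards are read with precision \<open>256 * 2\<^sup>r\<close>, so estimates are natural numbers in that
  unit.\<close>

definition hat :: "nat \<Rightarrow> nat \<Rightarrow> real" where
  "hat r e = real e / (256 * 2 ^ r)"

definition dl :: "nat \<Rightarrow> real" where "dl j = 1 / 2 ^ j"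

lemma dl_Suc: "dl (Suc j) = dl j / 2" and dl_pos: "0 < dl j"
  by (simp_all add: dl_def)

lemma dl_mono: "j \<le> r \<Longrightarrow> dl r \<le> dl j"
  by (simp add: dl_def frac_le)

definition killed :: "nat \<Rightarrow> nat \<Rightarrow> nat \<Rightarrow> nat \<Rightarrow> bool" where
  "killed r j b e \<longleftrightarrow> e + 128 * 2 ^ (r - j) < b"

lemma killed_hat:
  assumes "j \<le> r"
  shows "killed r j b e \<longleftrightarrow> hat r e + dl j / 2 < hat r b"
proof -
  have "killed r j b e \<longleftrightarrow> real (e + 128 * 2 ^ (r - j)) < real b"
    unfolding killed_def by (rule of_nat_less_iff[symmetric])
  also have "\<dots> \<longleftrightarrow> real e + 128 * 2 ^ (r - j) < real b"
    by simp
  also have "\<dots> \<longleftrightarrow> (real e + 128 * 2 ^ (r - j)) / (256 * 2 ^ r) < hat r b"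
    unfolding hat_def by (subst divide_less_cancel) auto
  also have "(real e + 128 * 2 ^ (r - j)) / (256 * 2 ^ r) = hat r e + dl j / 2"
    using assms by (simp add: hat_def dl_def add_divide_distrib power_diff)
  finally show ?thesis .
qed

text \<open>\<open>E a r j w\<close> is the expectation over the estimate of arm \<open>a\<close> after \<open>4096 * 4\<^sup>j * w\<close> pulls in pass
  \<open>r\<close>. The other functions stand for the expected number of pulls of arm \<open>q\<close> still to come within
  the horizon: \<open>fL r l g\<close> at the start of pass \<open>r\<close> with leader \<open>l\<close> and level \<open>g\<close>, \<open>fC\<close> before the
  cheap test of arm \<open>i\<close> on scale \<open>j\<close>, \<open>fV\<close> before the verification on that scale, and \<open>fX\<close> when
  the slot of arm \<open>i\<close> is over; \<open>b\<close> and \<open>cb\<close> are the estimates of the leader and of the candidate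
  \<open>cand\<close>. They are mutually recursive in the states of the automaton below, of which only these
  inequalities are needed.\<close>

locale analysis =
  fixes K lam :: nat and eps :: real and mu :: "nat \<Rightarrow> real"
    and E :: "nat \<Rightarrow> nat \<Rightarrow> nat \<Rightarrow> nat \<Rightarrow> (nat \<Rightarrow> real) \<Rightarrow> real"
    and q istar m m0 :: nat
    and fL :: "nat \<Rightarrow> nat \<Rightarrow> nat \<Rightarrow> real"
    and fC fV :: "nat \<Rightarrow> nat \<Rightarrow> nat \<Rightarrow> nat \<Rightarrow> nat \<Rightarrow> nat \<Rightarrow> nat \<Rightarrow> nat \<Rightarrow> real"
    and fX :: "nat \<Rightarrow> nat \<Rightarrow> nat \<Rightarrow> nat \<Rightarrow> nat \<Rightarrow> nat \<Rightarrow> nat \<Rightarrow> real"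
  assumes lam: "1 \<le> lam" and eps: "0 \<le> eps"
    and E_rule: "\<And>a r j w f c d. a < K \<Longrightarrow> j \<le> r \<Longrightarrow> 1 \<le> w \<Longrightarrow> 0 \<le> d \<Longrightarrow>
        (\<And>e. \<bar>hat r e - mu a\<bar> \<le> dl j / 16 \<Longrightarrow> f e \<le> c) \<Longrightarrow> (\<And>e. f e \<le> c + d) \<Longrightarrow>
        E a r j w f \<le> c + rho ^ w * d"
    and E_lam: "\<And>a r j f c. a < K \<Longrightarrow> j \<le> r \<Longrightarrow> 0 \<le> c \<Longrightarrow>
        (\<And>e. \<bar>hat r e - mu a\<bar> \<le> dl j / 16 \<Longrightarrow> f e \<le> c) \<Longrightarrow> (\<And>e. f e \<le> 16 ^ lam) \<Longrightarrow>
        E a r j lam f \<le> c + eps"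
    and fL_le: "\<And>r l g. fL r l g \<le> 16 ^ lam"
    and fC_le: "\<And>r i j g l b cand cb. fC r i j g l b cand cb \<le> 16 ^ lam"
    and fV_le: "\<And>r i j g l b cand cb. fV r i j g l b cand cb \<le> 16 ^ lam"
    and fX_eq: "\<And>r i g l b cand cb. fX r i g l b cand cb =
        (if Suc i < K then fC r (Suc i) 0 g l b cand cb else fL (Suc r) cand g)"
    and fL_end: "\<And>l g. l < K \<Longrightarrow> fL (2 * lam) l g \<le> (if l = q then 16 ^ lam else 0)"
    and fL_step: "\<And>r l g. l < K \<Longrightarrow> fL r l g \<le>
        (if l = q then c0 * 4 ^ r * lam else 0) + E l r r lam (\<lambda>e. fC r 0 0 g l e l e)"
    and fC_step: "\<And>r i j g l b cand cb. i < K \<Longrightarrow> j \<le> r \<Longrightarrow> fC r i j g l b cand cb \<le>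
        (if i = q then c0 * 4 ^ j * wt g j else 0) +
        E i r j (wt g j) (\<lambda>e. if killed r j b e then fX r i g l b cand cb
          else if j < r then min 1 (real (Suc j - g) / lam) * fV r i 0 g l b cand cb
                           + (1 - min 1 (real (Suc j - g) / lam)) * fC r i (Suc j) g l b cand cb
          else fV r i 0 g l b cand cb)"
    and fV_step: "\<And>r i j g l b cand cb. i < K \<Longrightarrow> j \<le> r \<Longrightarrow> fV r i j g l b cand cb \<le>
        (if i = q then c0 * 4 ^ j * lam else 0) +
        E i r j lam (\<lambda>e. if killed r j b e then fX r i (max g j) l b cand cb
          else if j < r then fV r i (Suc j) g l b cand cb
          else if cb < e then fX r i g l b i e else fX r i g l b cand cb)"
    and q: "q < K" and istar: "istar < K" and mu_star: "\<And>i. i < K \<Longrightarrow> mu i \<le> mu istar"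
    and m: "dl m \<le> mu istar - mu q" "mu istar - mu q < 2 * dl m"
    and m0: "\<And>i. i < K \<Longrightarrow> mu i < mu istar \<Longrightarrow> dl m0 \<le> mu istar - mu i"
    and mm0: "m \<le> m0"
begin

section \<open>Accurate tests and verifications\<close>

definition inv :: "nat \<Rightarrow> nat \<Rightarrow> nat \<Rightarrow> bool" where
  "inv r a e \<longleftrightarrow> a < K \<and> \<bar>hat r e - mu a\<bar> \<le> dl r / 16"

lemma fX_le: "fX r i g l b cand cb \<le> 16 ^ lam"
  by (subst fX_eq) (use fC_le fL_le in \<open>auto split: if_split\<close>)

text \<open>The threshold is half of \<open>dl j\<close> and each of the two estimates errs by at
  most \<open>dl j / 16\<close>, so the outcome is certain outside the window from 3/8 to 5/8 of
  \<open>dl j\<close>.\<close>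

lemma kill_test:
  assumes "inv r l b" "j \<le> r" "\<bar>hat r e - mu i\<bar> \<le> dl j / 16"
  shows "mu l - mu i > 5 / 8 * dl j \<Longrightarrow> killed r j b e"
    and "killed r j b e \<Longrightarrow> 3 / 8 * dl j \<le> mu l - mu i"
    and "\<not> killed r j b e \<Longrightarrow> mu l - mu i \<le> 5 / 8 * dl j"
proof -
  have e: "\<bar>hat r b - mu l\<bar> \<le> dl j / 16"
    using assms(1) dl_mono[OF assms(2)] unfolding inv_def by linarith
  show "killed r j b e" if "mu l - mu i > 5 / 8 * dl j"
    using that e assms(3) unfolding killed_hat[OF assms(2)] by linarith
  show "3 / 8 * dl j \<le> mu l - mu i" if "killed r j b e"
    using that e assms(3) unfolding killed_hat[OF assms(2)] by linarith
  show "mu l - mu i \<le> 5 / 8 * dl j" if "\<not> killed r j b e"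
    using that e assms(3) unfolding killed_hat[OF assms(2)] by linarith
qed

text \<open>The outcomes of a verification in which every estimate is accurate.\<close>

definition vout where
  "vout r i g l cand cb g' cand' cb' \<longleftrightarrow>
     (g' = g \<and> inv r cand' cb' \<and> cb \<le> cb' \<and> mu i - dl r / 16 \<le> hat r cb' \<and>
        mu l - mu i \<le> 5 / 8 * dl r) \<or>
     (\<exists>j \<le> r. g' = max g j \<and> cand' = cand \<and> cb' = cb \<and> 3 / 8 * dl j \<le> mu l - mu i \<and>
        (0 < j \<longrightarrow> mu l - mu i \<le> 5 / 4 * dl j))"

lemma hat_mono: "e \<le> e' \<Longrightarrow> hat r e \<le> hat r e'"
  by (simp add: hat_def divide_right_mono)

text \<open>A verification climbs from scale \<open>j\<close> until the first rejection, at the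
  latest on a scale \<open>s\<close> where the gap forces one. The hypothesis on
  \<open>0 < j\<close> records survival on the previous scale, since
  \<open>5 / 8 * dl (j - 1) = 5 / 4 * dl j\<close>; through it the true gap limits the scale of a
  rejection and hence the raise of the level. Each scale adds one charge \<open>eps\<close>.\<close>

lemma verify_slot:
  assumes "i < K" "inv r l b" "inv r cand cb" "0 \<le> c"
    and out: "\<And>g' cand' cb'. vout r i g l cand cb g' cand' cb' \<Longrightarrow> fX r i g' l b cand' cb' \<le> c"
    and s: "s \<le> r" "s = r \<or> mu l - mu i > 5 / 8 * dl s"
    and "j \<le> s" "0 < j \<longrightarrow> mu l - mu i \<le> 5 / 4 * dl j"
  shows "fV r i j g l b cand cb \<le>
    (if i = q then \<Sum>k=j..s. c0 * 4 ^ k * lam else 0) + c + real (Suc s - j) * eps"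
  using assms(8,9)
proof (induction "s - j" arbitrary: j)
  case (0 j)
  then have js: "j = s" by simp
  let ?f = "\<lambda>e. if killed r j b e then fX r i (max g j) l b cand cb
          else if j < r then fV r i (Suc j) g l b cand cb
          else if cb < e then fX r i g l b i e else fX r i g l b cand cb"
  have "E i r j lam ?f \<le> c + eps"
  proof (rule E_lam)
    fix e assume e: "\<bar>hat r e - mu i\<bar> \<le> dl j / 16"
    show "?f e \<le> c"
    proof (cases "killed r j b e")
      case True
      have "vout r i g l cand cb (max g j) cand cb"
        unfolding vout_def using True kill_test(2)[OF assms(2) _ e] 0 s by auto
      with True show ?thesis using out by simp
    next
      case False
      then have "\<not> mu l - mu i > 5 / 8 * dl s"
        using kill_test(1)[OF assms(2) _ e] s(1) js by blast
      with s(2) have r: "s = r" by blast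
      have gap: "mu l - mu i \<le> 5 / 8 * dl r" using kill_test(3)[OF assms(2) _ e False] r js by simp
      have "inv r i e" using e r js assms(1) by (simp add: inv_def)
      then have "cb < e \<Longrightarrow> vout r i g l cand cb g i e"
        using gap unfolding vout_def inv_def abs_le_iff by auto
      moreover have "vout r i g l cand cb g cand cb" if "\<not> cb < e"
        unfolding vout_def using that assms(3) hat_mono[of e cb r] \<open>inv r i e\<close> gap
        unfolding inv_def by linarith
      ultimately show ?thesis using False r js out by auto
    qed
  qed (use 0 s assms in \<open>auto simp: fX_le fV_le\<close>)
  then have "fV r i j g l b cand cb \<le> (if i = q then c0 * 4 ^ j * lam else 0) + (c + eps)"
    using fV_step[OF assms(1), of j r g l b cand cb] s(1) js by linarith
  then show ?case by (auto simp: js)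
next
  case (Suc x j)
  then have js: "j < s" "j < r" using s by auto
  let ?f = "\<lambda>e. if killed r j b e then fX r i (max g j) l b cand cb
          else if j < r then fV r i (Suc j) g l b cand cb
          else if cb < e then fX r i g l b i e else fX r i g l b cand cb"
  let ?S = "if i = q then \<Sum>k=Suc j..s. c0 * 4 ^ k * lam else 0"
  have S: "0 \<le> ?S" by (auto simp: c0_def intro!: sum_nonneg)
  have cS: "c \<le> ?S + c + real (Suc s - Suc j) * eps"
    using S eps by simp
  have "E i r j lam ?f \<le> (?S + c + real (Suc s - Suc j) * eps) + eps"
  proof (rule E_lam)
    fix e assume e: "\<bar>hat r e - mu i\<bar> \<le> dl j / 16"
    show "?f e \<le> ?S + c + real (Suc s - Suc j) * eps"
    proof (cases "killed r j b e")
      case True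
      have "vout r i g l cand cb (max g j) cand cb"
        unfolding vout_def using True kill_test(2)[OF assms(2) _ e] Suc js by auto
      then have "fX r i (max g j) l b cand cb \<le> c" using out by simp
      with cS True show ?thesis by simp
    next
      case False
      have "mu l - mu i \<le> 5 / 4 * dl (Suc j)" using kill_test(3)[OF assms(2) _ e False] js by (simp add: dl_Suc)
      then have "fV r i (Suc j) g l b cand cb \<le> ?S + c + real (Suc s - Suc j) * eps"
        using Suc.hyps(1)[of "Suc j"] Suc.hyps(2) js by simp
      with False js show ?thesis by simp
    qed
  next
    show "0 \<le> ?S + c + real (Suc s - Suc j) * eps" using S eps assms(4) by simp
  qed (use js assms in \<open>auto simp: fX_le fV_le\<close>)
  moreover have "(if i = q then \<Sum>k=j..s. c0 * 4 ^ k * lam else 0)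
      = (if i = q then c0 * 4 ^ j * lam else 0) + ?S"
    using js by (simp add: sum.atLeast_Suc_atMost)
  moreover have "real (Suc s - j) * eps = real (Suc s - Suc j) * eps + eps"
    using js by (simp add: Suc_diff_le algebra_simps)
  ultimately show ?case using fV_step[OF assms(1), of j r g l b cand cb] js
    by linarith
qed

section \<open>The cost of the cheap tests of one arm\<close>

lemma convex2: "0 \<le> h \<Longrightarrow> h \<le> 1 \<Longrightarrow> x \<le> c \<Longrightarrow> y \<le> c \<Longrightarrow> h * x + (1 - h) * y \<le> (c::real)"
  using convex_bound_le[of x c y h "1 - h"] by simp

text \<open>Zero for \<open>j < g\<close> by truncated subtraction: below the level a survivor moves
  on to the next scale unverified, except on the last scale of the pass.\<close>

definition hz :: "nat \<Rightarrow> nat \<Rightarrow> real" where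
  "hz g j = min 1 (real (Suc j - g) / lam)"

lemma hz: "0 \<le> hz g j" "hz g j \<le> 1"
  using lam by (auto simp: hz_def)

lemma cheap_rule:
  assumes "i < K" "j \<le> r" "0 \<le> d"
    and killed: "\<And>e. \<bar>hat r e - mu i\<bar> \<le> dl j / 16 \<Longrightarrow> killed r j b e \<Longrightarrow> fX r i g l b cand cb \<le> c"
    and alive: "\<And>e. \<bar>hat r e - mu i\<bar> \<le> dl j / 16 \<Longrightarrow> \<not> killed r j b e \<Longrightarrow>
      (if j < r then hz g j * fV r i 0 g l b cand cb + (1 - hz g j) * fC r i (Suc j) g l b cand cb
       else fV r i 0 g l b cand cb) \<le> c"
    and "fX r i g l b cand cb \<le> c + d"
    and "(if j < r then hz g j * fV r i 0 g l b cand cb + (1 - hz g j) * fC r i (Suc j) g l b cand cb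
       else fV r i 0 g l b cand cb) \<le> c + d"
  shows "fC r i j g l b cand cb \<le> (if i = q then c0 * 4 ^ j * wt g j else 0) + c + rho ^ wt g j * d"
proof -
  have "E i r j (wt g j) (\<lambda>e. if killed r j b e then fX r i g l b cand cb
          else if j < r then hz g j * fV r i 0 g l b cand cb
                           + (1 - hz g j) * fC r i (Suc j) g l b cand cb
          else fV r i 0 g l b cand cb) \<le> c + rho ^ wt g j * d"
  proof (rule E_rule)
    show "1 \<le> wt g j" by (simp add: wt_def)
    show "(if killed r j b e then fX r i g l b cand cb
          else if j < r then hz g j * fV r i 0 g l b cand cb
                           + (1 - hz g j) * fC r i (Suc j) g l b cand cb
          else fV r i 0 g l b cand cb) \<le> c" if "\<bar>hat r e - mu i\<bar> \<le> dl j / 16" for e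
      using killed[OF that] alive[OF that] by (cases "killed r j b e") simp_all
    show "(if killed r j b e then fX r i g l b cand cb
          else if j < r then hz g j * fV r i 0 g l b cand cb
                           + (1 - hz g j) * fC r i (Suc j) g l b cand cb
          else fV r i 0 g l b cand cb) \<le> c + d" for e
      using assms(6,7) by (cases "killed r j b e") simp_all
  qed fact+
  then show ?thesis
    using fC_step[OF assms(1,2), of g l b cand cb] unfolding hz_def by linarith
qed

lemma cheap_all:
  assumes "i < K" "j \<le> r" "fX r i g l b cand cb \<le> c" "fV r i 0 g l b cand cb \<le> c"
    and "j < r \<Longrightarrow> fC r i (Suc j) g l b cand cb \<le> c"
  shows "fC r i j g l b cand cb \<le> (if i = q then c0 * 4 ^ j * wt g j else 0) + c"
proof -
  have "(if j < r then hz g j * fV r i 0 g l b cand cb + (1 - hz g j) * fC r i (Suc j) g l b cand cb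
       else fV r i 0 g l b cand cb) \<le> c"
    using convex2[OF hz[of g j] assms(4), of "fC r i (Suc j) g l b cand cb"] assms(4,5) by simp
  then show ?thesis
    using cheap_rule[OF assms(1,2), of 0 b g l cand cb c] assms(3) by simp
qed

text \<open>For the passes with \<open>r \<le> m\<close>, those with a leader that is too bad to reject arm \<open>q\<close>, and for arms
  other than \<open>q\<close> it is enough to assume the worst outcome of every test.\<close>

lemma crude_slot:
  assumes "i < K" "inv r l b" "inv r cand cb" "0 \<le> c"
    and out: "\<And>g' cand' cb'. vout r i g l cand cb g' cand' cb' \<Longrightarrow> fX r i g' l b cand' cb' \<le> c"
    and skip: "fX r i g l b cand cb \<le> c"
    and "j \<le> r"
  shows "fC r i j g l b cand cb \<le>
    (if i = q then (\<Sum>k=j..r. c0 * 4 ^ k * wt g k) + (\<Sum>k=0..r. c0 * 4 ^ k * lam) else 0)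
    + c + real (Suc r) * eps"
  using assms(7)
proof (induction "r - j" arbitrary: j)
  case (0 j)
  then have [simp]: "j = r" by simp
  let ?b = "(if i = q then \<Sum>k=0..r. c0 * 4 ^ k * lam else 0) + c + real (Suc r) * eps"
  have v: "fV r i 0 g l b cand cb \<le> ?b"
    using verify_slot[OF assms(1-4) out, where s = r and j = 0 and g = g] by simp
  have "0 \<le> (\<Sum>k=0..r. c0 * 4 ^ k * lam)" by (auto simp: c0_def intro!: sum_nonneg)
  with eps have "c \<le> ?b" by simp
  with skip have x: "fX r i g l b cand cb \<le> ?b" by linarith
  have "fC r i j g l b cand cb \<le> (if i = q then c0 * 4 ^ j * wt g j else 0) + ?b"
    by (rule cheap_all[OF assms(1) _ x v]) simp_all
  then show ?case by (simp split: if_splits)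
next
  case (Suc x j)
  then have js: "j < r" by auto
  let ?b = "(if i = q then (\<Sum>k=Suc j..r. c0 * 4 ^ k * wt g k) + (\<Sum>k=0..r. c0 * 4 ^ k * lam) else 0) + c + real (Suc r) * eps"
  have s: "0 \<le> (\<Sum>k=Suc j..r. c0 * 4 ^ k * wt g k)" by (auto simp: c0_def intro!: sum_nonneg)
  have v: "fV r i 0 g l b cand cb \<le> ?b"
    using verify_slot[OF assms(1-4) out, where s = r and j = 0 and g = g] s by (simp split: if_splits)
  have c: "fC r i (Suc j) g l b cand cb \<le> ?b"
    using Suc.hyps(1)[of "Suc j"] Suc.hyps(2) js by simp
  have "0 \<le> (\<Sum>k=0..r. c0 * 4 ^ k * lam)" by (auto simp: c0_def intro!: sum_nonneg)
  with eps s have "c \<le> ?b" by simp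
  with skip have x: "fX r i g l b cand cb \<le> ?b" by linarith
  have "fC r i j g l b cand cb \<le> (if i = q then c0 * 4 ^ j * wt g j else 0) + ?b"
    by (rule cheap_all[OF assms(1) _ x v c]) (use js in simp)
  moreover have "(\<Sum>k=j..r. c0 * 4 ^ k * wt g k)
      = c0 * 4 ^ j * wt g j + (\<Sum>k=Suc j..r. c0 * 4 ^ k * wt g k)"
    using js by (simp add: sum.atLeast_Suc_atMost)
  ultimately show ?case by (simp split: if_splits)
qed

text \<open>A two-sided geometric series with its peak \<open>rho\<close> at
  \<open>k = g\<close>.\<close>

lemma wt_sum: "(\<Sum>k=0..r. rho ^ wt g k) \<le> 4 * rho"
proof -
  \<comment> \<open>Below \<open>g\<close> the last term dominates; from \<open>g\<close> on the
    subtracted term is the slack that pays for the rest of the series.\<close>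
  have "if r < g then (\<Sum>k=0..r. rho ^ wt g k) \<le> 2 * rho ^ Suc (g - r)
    else (\<Sum>k=0..r. rho ^ wt g k) \<le> 4 * rho - rho ^ Suc (r - g)"
  proof (induction r)
    case 0
    show ?case using rho_pos by (cases g) (simp_all add: wt_def)
  next
    case (Suc r)
    consider "Suc r < g" | "Suc r = g" | "g \<le> r" by linarith
    then show ?case
    proof cases
      case 1
      then have "g - r = Suc (g - Suc r)" by simp
      then have "2 * rho ^ Suc (g - r) \<le> rho ^ Suc (g - Suc r)"
        using rho_le mult_right_mono[of "2 * rho" 1 "rho ^ Suc (g - Suc r)"] rho_pos
        by (simp add: mult_ac)
      then show ?thesis using Suc 1 by (simp add: wt_def)
    next
      case 2
      then have "g - r = 1" by simp
      then have "2 * rho ^ Suc (g - r) = 2 * rho * rho" by simp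
      also have "\<dots> \<le> rho" using rho_le rho_pos by simp
      finally have "2 * rho ^ Suc (g - r) \<le> 2 * rho" using rho_pos by linarith
      then show ?thesis using Suc 2[symmetric] by (auto simp: wt_def)
    next
      case 3
      then have "Suc r - g = Suc (r - g)" by simp
      moreover have "2 * (rho * rho ^ Suc (r - g)) \<le> rho ^ Suc (r - g)"
        using rho_le rho_pos mult_right_mono[of "2 * rho" 1 "rho ^ Suc (r - g)"] by simp
      ultimately show ?thesis using Suc 3 by (simp add: wt_def)
    qed
  qed
  moreover have "2 * rho ^ Suc (g - r) \<le> 4 * rho" if "r < g"
    using power_le_one[of rho "g - r"] rho_pos rho_le mult_left_mono[of "rho ^ (g - r)" 1 rho] by simp
  moreover have "0 < rho ^ Suc (r - g)" using rho_pos by simp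
  ultimately show ?thesis by (smt (verit, best))
qed

text \<open>No mean exceeds that of \<open>istar\<close>, so an accurate test never rejects it, and
  a verification then leaves a candidate with an estimate close to its mean or above. It is missed
  only through an inaccurate cheap test, hence the sum of \<open>rho ^ wt g k\<close> in front of
  the extra cost \<open>d\<close> of missing it.\<close>

lemma star_slot:
  assumes "istar \<noteq> q" "inv r l b" "inv r cand cb" "0 \<le> c" "0 \<le> d"
    and good: "\<And>cand' cb'. inv r cand' cb' \<Longrightarrow> cb \<le> cb' \<Longrightarrow> mu istar - dl r / 16 \<le> hat r cb' \<Longrightarrow>
      fX r istar g l b cand' cb' \<le> c"
    and bad: "fX r istar g l b cand cb \<le> c + d"
    and "j \<le> r"
  shows "fC r istar j g l b cand cb \<le> c + real (Suc r) * eps + (\<Sum>k=j..r. rho ^ wt g k) * d"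
proof -
  have gap: "mu l - mu istar \<le> 0" using mu_star assms(2) by (simp add: inv_def)
  have v: "fV r istar 0 g l b cand cb \<le> c + real (Suc r) * eps"
  proof -
    have "fX r istar g' l b cand' cb' \<le> c" if "vout r istar g l cand cb g' cand' cb'" for g' cand' cb'
    proof -
      have "\<not> 3 / 8 * dl j \<le> mu l - mu istar" for j using gap dl_pos[of j] by linarith
      with that show ?thesis unfolding vout_def using good by blast
    qed
    then show ?thesis
      using verify_slot[OF istar assms(2-4), where s = r and j = 0 and g = g] assms(1) by simp
  qed
  show ?thesis using assms(8)
  proof (induction "r - j" arbitrary: j)
    case (0 j)
    then have j: "j = r" by simp
    have "fC r istar j g l b cand cb \<le> (if istar = q then c0 * 4 ^ j * wt g j else 0) +
      (c + real (Suc r) * eps) + rho ^ wt g j * d"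
    proof (rule cheap_rule[OF istar])
      show "fX r istar g l b cand cb \<le> c + real (Suc r) * eps"
        if "\<bar>hat r e - mu istar\<bar> \<le> dl j / 16" "killed r j b e" for e
        using kill_test(2)[OF assms(2) _ that] j gap dl_pos[of j] by simp
      show "fX r istar g l b cand cb \<le> c + real (Suc r) * eps + d"
        using bad eps by (smt (verit, best) mult_nonneg_nonneg of_nat_0_le_iff)
    qed (use v j assms(5) in auto)
    then show ?case using assms(1) j by simp
  next
    case (Suc x j)
    then have j: "j < r" by simp
    let ?c = "c + real (Suc r) * eps + (\<Sum>k=Suc j..r. rho ^ wt g k) * d"
    have s: "0 \<le> (\<Sum>k=Suc j..r. rho ^ wt g k) * d"
      using rho_pos assms(5) by (intro mult_nonneg_nonneg sum_nonneg) auto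
    have e: "0 \<le> real (Suc r) * eps" using eps by simp
    have IH: "fC r istar (Suc j) g l b cand cb \<le> ?c" using Suc.hyps(1)[of "Suc j"] Suc.hyps(2) j by simp
    have v': "fV r istar 0 g l b cand cb \<le> ?c" using v s by linarith
    have *: "(if j < r then hz g j * fV r istar 0 g l b cand cb + (1 - hz g j) * fC r istar (Suc j) g l b cand cb
       else fV r istar 0 g l b cand cb) \<le> ?c"
      using convex2[OF hz v' IH] j by simp
    have "fC r istar j g l b cand cb \<le> (if istar = q then c0 * 4 ^ j * wt g j else 0) +
      ?c + rho ^ wt g j * d"
    proof (rule cheap_rule[OF istar])
      show "fX r istar g l b cand cb \<le> ?c"
        if "\<bar>hat r e - mu istar\<bar> \<le> dl j / 16" "killed r j b e" for e
        using kill_test(2)[OF assms(2) _ that] j gap dl_pos[of j] by simp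
      show "fX r istar g l b cand cb \<le> ?c + d"
        using bad s e by linarith
      show "(if j < r then hz g j * fV r istar 0 g l b cand cb + (1 - hz g j) * fC r istar (Suc j) g l b cand cb
       else fV r istar 0 g l b cand cb) \<le> ?c + d" using * assms(5) by linarith
    qed (use j assms(5) * in auto)
    moreover have "(\<Sum>k=j..r. rho ^ wt g k) = rho ^ wt g j + (\<Sum>k=Suc j..r. rho ^ wt g k)"
      using j by (simp add: sum.atLeast_Suc_atMost)
    ultimately show ?case using assms(1) by (simp add: algebra_simps)
  qed
qed

text \<open>From scale \<open>m\<close> on an accurate test rejects arm \<open>q\<close>, so each
  further scale requires another failure of probability at most \<open>rho\<close>, which outweighs
  the growth of the tests. The last term is the compulsory verification on scale \<open>r\<close>,
  reached only after \<open>Suc r - j\<close> failures.\<close>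

lemma q_tail:
  assumes "mu l - mu q \<ge> 3 / 4 * dl m" "inv r l b" "0 \<le> c"
    and "fX r q g l b cand cb \<le> c" "fV r q 0 g l b cand cb \<le> c + 2 * c0 * 4 ^ m * lam"
    and "m \<le> j" "j \<le> r"
  shows "fC r q j g l b cand cb \<le>
    c + 2 * c0 * 4 ^ j * wt g j + rho ^ (Suc r - j) * (2 * c0 * 4 ^ m * lam)"
  using assms(6,7)
proof (induction "r - j" arbitrary: j)
  case (0 j)
  then have j: "j = r" by simp
  let ?VC = "2 * c0 * 4 ^ m * lam"
  have VC: "0 \<le> ?VC" by (simp add: c0_def)
  have kill: "killed r j b e" if "\<bar>hat r e - mu q\<bar> \<le> dl j / 16" for e
    by (rule kill_test(1)[OF assms(2) _ that])
      (use j assms(1) dl_mono[OF \<open>m \<le> j\<close>] dl_pos[of m] in auto)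
  have "fC r q j g l b cand cb \<le> (if q = q then c0 * 4 ^ j * wt g j else 0) + c + rho ^ wt g j * ?VC"
  proof (rule cheap_rule[OF q])
    show "fX r q g l b cand cb \<le> c + ?VC" using assms(4) VC by linarith
  qed (use j VC kill assms in auto)
  moreover have "rho ^ wt g j * ?VC \<le> rho * ?VC"
    using VC rho_pos rho_le power_le_one[of rho "g - j + (j - g)"]
    by (intro mult_right_mono) (auto simp: wt_def intro: mult_left_le)
  moreover have "0 \<le> c0 * 4 ^ j * wt g j" by (simp add: c0_def)
  ultimately show ?case using j by simp
next
  case (Suc x j)
  then have j: "j < r" by simp
  let ?VC = "2 * c0 * 4 ^ m * lam"
  let ?G = "2 * c0 * 4 ^ Suc j * wt g (Suc j) + rho ^ (r - j) * ?VC"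
  have VC: "0 \<le> ?VC" by (simp add: c0_def)
  have G: "0 \<le> ?G" using VC rho_pos by (simp add: c0_def)
  have IH: "fC r q (Suc j) g l b cand cb \<le> c + ?G"
    using Suc.hyps(1)[of "Suc j"] Suc.hyps(2) Suc.prems j by (simp add: add.assoc)
  have kill: "killed r j b e" if "\<bar>hat r e - mu q\<bar> \<le> dl j / 16" for e
    by (rule kill_test(1)[OF assms(2) _ that])
      (use j assms(1) dl_mono[OF \<open>m \<le> j\<close>] dl_pos[of m] in auto)
  let ?d = "hz g j * ?VC + ?G"
  have d: "0 \<le> ?d" using hz[of g j] VC G by simp
  have "hz g j * fV r q 0 g l b cand cb + (1 - hz g j) * fC r q (Suc j) g l b cand cb
    \<le> hz g j * (c + ?VC) + (1 - hz g j) * (c + ?G)"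
    using hz[of g j] IH assms(5) by (intro add_mono mult_left_mono) auto
  also have "\<dots> = c + ?d - hz g j * ?G" by (simp add: algebra_simps)
  also have "\<dots> \<le> c + ?d" using hz[of g j] mult_nonneg_nonneg[OF hz(1) G, of g j] by linarith
  finally have *: "hz g j * fV r q 0 g l b cand cb + (1 - hz g j) * fC r q (Suc j) g l b cand cb
    \<le> c + ?d" .
  have "fC r q j g l b cand cb \<le> (if q = q then c0 * 4 ^ j * wt g j else 0) + c + rho ^ wt g j * ?d"
    by (rule cheap_rule[OF q]) (use j d kill assms * in auto)
  moreover have "rho ^ wt g j * ?d \<le> rho * ?d"
    using d rho_pos rho_le power_le_one[of rho "g - j + (j - g)"]
    by (intro mult_right_mono) (auto simp: wt_def intro: mult_left_le)
  moreover have "rho * ?d \<le> c0 * 4 ^ j * wt g j + rho ^ (Suc r - j) * ?VC"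
  proof -
    let ?w = "c0 * 4 ^ j * wt g j"
    have w: "0 \<le> ?w" by (simp add: c0_def)
    have "hz g j * ?VC \<le> real (Suc j - g) / lam * ?VC"
      using VC by (intro mult_right_mono) (auto simp: hz_def)
    also have "\<dots> = 2 * c0 * 4 ^ m * real (Suc j - g)" using lam by simp
    also have "\<dots> \<le> 2 * c0 * 4 ^ j * real (wt g j)"
      using Suc.prems by (intro mult_mono) (auto simp: c0_def wt_def)
    finally have 1: "hz g j * ?VC \<le> 2 * ?w" by simp
    have "2 * c0 * 4 ^ Suc j * real (wt g (Suc j)) \<le> 2 * c0 * 4 ^ Suc j * real (2 * wt g j)"
      by (intro mult_left_mono) (auto simp: c0_def wt_def)
    then have "?d \<le> 18 * ?w + rho ^ (r - j) * ?VC" using 1 by (simp add: mult_ac)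
    then have "rho * ?d \<le> rho * (18 * ?w + rho ^ (r - j) * ?VC)"
      using rho_pos by (intro mult_left_mono) auto
    also have "\<dots> = (18 * rho) * ?w + rho ^ (Suc r - j) * ?VC"
      using j by (simp add: Suc_diff_le algebra_simps)
    also have "(18 * rho) * ?w \<le> 1 * ?w" using w rho_le by (intro mult_right_mono) auto
    finally show ?thesis by simp
  qed
  ultimately show ?case by simp
qed

text \<open>Weights of neighbouring scales differ by a factor of at most 2, less than the factor 4
  between their pulls.\<close>

lemma wt_sum4: "(\<Sum>k<m. c0 * 4 ^ k * real (wt g k)) \<le> c0 * 4 ^ m * wt g m"
proof (induction m)
  case (Suc m)
  have "c0 * 4 ^ m * real (wt g m) + c0 * 4 ^ m * real (wt g m) = c0 * 4 ^ m * real (2 * wt g m)"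
    by simp
  also have "\<dots> \<le> c0 * 4 ^ m * real (4 * wt g (Suc m))"
    by (intro mult_left_mono) (auto simp: c0_def wt_def)
  finally show ?case using Suc by (simp add: mult_ac)
qed (simp add: c0_def)

lemma pow4_sum: "(\<Sum>k=0..n. c0 * 4 ^ k * real lam) \<le> 2 * c0 * 4 ^ n * lam"
proof (induction n)
  case (Suc n)
  have "0 \<le> c0 * 4 ^ n * real lam" by (simp add: c0_def)
  then show ?case using Suc by (simp add: mult_ac)
qed (simp add: c0_def)

lemma hz_sum: "(\<Sum>k<n. Suc k - g) \<le> (n - g) * (n - g)"
proof (induction n)
  case (Suc n)
  then show ?case by (cases "g \<le> n") (auto simp: Suc_diff_le)
qed simp

text \<open>If the level is within 5 of \<open>m\<close> or above, tests and verifications cost a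
  constant multiple of the weight. If it is far below \<open>m\<close>, the tests near scale
  \<open>m\<close> cost too much, but arm \<open>q\<close> survives the lower scales and is then
  likely to be verified. This raises the level and releases the credit
  \<open>38 * c0 * lam * 4 ^ m\<close>; the expected release pays for the tests.\<close>

lemma q_slot:
  assumes gap: "mu l - mu q \<ge> 3 / 4 * dl m" and inv: "inv r l b" "inv r cand cb" and c: "0 \<le> c"
    and r: "m \<le> r" "r \<le> 2 * lam"
    and out: "\<And>g' cand' cb'. vout r q g l cand cb g' cand' cb' \<Longrightarrow>
      fX r q g' l b cand' cb' \<le> c + (if g' + 5 < m then 38 * c0 * lam * 4 ^ m else 0)"
    and skip: "fX r q g l b cand cb \<le> c + (if g + 5 < m then 38 * c0 * lam * 4 ^ m else 0)"
  shows "fC r q 0 g l b cand cb \<le> c + real (Suc r) * eps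
    + (if g + 5 < m then 38 * c0 * lam * 4 ^ m else 318 * c0 * 4 ^ m * (1 + (max g m0 - m)))
    + rho ^ (Suc r - m) * (2 * c0 * 4 ^ m * lam)"
proof -
  let ?VC = "2 * c0 * 4 ^ m * lam" and ?D = "38 * c0 * lam * 4 ^ m"
  have VC: "0 \<le> ?VC" by (simp add: c0_def)
  have gap2: "mu l - mu q < 2 * dl m" using m mu_star[of l] inv by (simp add: inv_def)
  have far: "m \<le> j + 2" if "3 / 8 * dl j \<le> mu l - mu q" for j
  proof (rule ccontr)
    assume "\<not> m \<le> j + 2"
    then have "dl m \<le> dl (Suc (Suc (Suc j)))" by (intro dl_mono) simp
    then show False using that gap2 dl_pos[of j] unfolding dl_Suc by linarith
  qed
  define R1 where "R1 = c + real (Suc r) * eps"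
  have v: "fV r q 0 g l b cand cb \<le> R1 + ?VC"
  proof -
    \<comment> \<open>As \<open>m \<le> r\<close>, a verified arm \<open>q\<close> is rejected, and
      on a scale of at least \<open>m - 2\<close>; afterwards the level is no longer far below
      \<open>m\<close>.\<close>
    have out': "fX r q g' l b cand' cb' \<le> c" if "vout r q g l cand cb g' cand' cb'" for g' cand' cb'
    proof -
      have "\<not> mu l - mu q \<le> 5 / 8 * dl r"
        using gap dl_mono[OF r(1)] dl_pos[of m] by linarith
      with that obtain j where j: "g' = max g j" "3 / 8 * dl j \<le> mu l - mu q"
        unfolding vout_def by blast
      then have "\<not> g' + 5 < m" using far[OF j(2)] by simp
      then show ?thesis using out[OF that] by simp
    qed
    have "fV r q 0 g l b cand cb \<le> (\<Sum>k=0..m. c0 * 4 ^ k * lam) + c + real (Suc m) * eps"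
      using verify_slot[OF q inv c out', where s = m and j = 0 and g = g] r gap dl_pos[of m] by simp
    also have "\<dots> \<le> ?VC + c + real (Suc r) * eps"
      using eps r by (intro add_mono pow4_sum mult_right_mono) auto
    finally show ?thesis by (simp add: R1_def)
  qed
  have cR: "c \<le> R1" "0 \<le> R1" using c eps by (auto simp: R1_def)
  let ?T = "rho ^ (Suc r - m) * ?VC"
  show ?thesis
  proof (cases "g + 5 < m")
    case False
    have x: "fX r q g l b cand cb \<le> R1" using skip False cR by simp
    have tail: "fC r q m g l b cand cb \<le> R1 + 2 * c0 * 4 ^ m * wt g m + ?T"
      by (rule q_tail[OF gap inv(1) cR(2) x v order.refl r(1)])
    \<comment> \<open>Each scale below \<open>m\<close> costs its cheap test and the expected price
      of a verification; as \<open>m - g\<close> is at most 5, the latter add up to a constant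
      multiple of \<open>c0 * 4 ^ m\<close>.\<close>
    let ?s = "\<lambda>j. \<Sum>k=j..<m. c0 * 4 ^ k * wt g k + 2 * c0 * 4 ^ m * real (Suc k - g)"
    have "fC r q j g l b cand cb \<le> R1 + 2 * c0 * 4 ^ m * wt g m + ?T + ?s j" if "j \<le> m" for j
      using that
    proof (induction "m - j" arbitrary: j)
      case 0
      then show ?case using tail by simp
    next
      case (Suc y j)
      then have j: "j < m" "j < r" using r by auto
      let ?B = "R1 + 2 * c0 * 4 ^ m * wt g m + ?T + ?s (Suc j)"
      let ?h = "2 * c0 * 4 ^ m * real (Suc j - g)"
      have h: "0 \<le> ?h" by (simp add: c0_def)
      have B: "R1 \<le> ?B" using rho_pos by (simp add: c0_def sum_nonneg)
      have IH: "fC r q (Suc j) g l b cand cb \<le> ?B"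
        using Suc.hyps(1)[of "Suc j"] Suc.hyps(2) j by simp
      have "hz g j * ?VC \<le> real (Suc j - g) / lam * ?VC"
        using VC by (intro mult_right_mono) (auto simp: hz_def)
      also have "\<dots> = ?h" using lam by simp
      finally have hzVC: "hz g j * ?VC \<le> ?h" .
      have "hz g j * fV r q 0 g l b cand cb + (1 - hz g j) * fC r q (Suc j) g l b cand cb
        \<le> hz g j * (?B + ?VC) + (1 - hz g j) * ?B"
        using hz[of g j] IH v B by (intro add_mono mult_left_mono) auto
      also have "\<dots> = ?B + hz g j * ?VC" by (simp add: algebra_simps)
      finally have a: "hz g j * fV r q 0 g l b cand cb + (1 - hz g j) * fC r q (Suc j) g l b cand cb
        \<le> ?B + ?h" using hzVC by linarith
      have x': "fX r q g l b cand cb \<le> ?B + ?h" using x B h by linarith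
      have "fC r q j g l b cand cb \<le> (if q = q then c0 * 4 ^ j * wt g j else 0) + (?B + ?h) + rho ^ wt g j * 0"
        by (rule cheap_rule[OF q]) (use j a x' in auto)
      moreover have "?s j = c0 * 4 ^ j * wt g j + ?h + ?s (Suc j)"
        using j by (simp add: sum.atLeast_Suc_lessThan)
      ultimately show ?case by simp
    qed
    from this[of 0] have "fC r q 0 g l b cand cb \<le> R1 + 2 * c0 * 4 ^ m * wt g m + ?T + ?s 0" by simp
    also have "?s 0 = (\<Sum>k<m. c0 * 4 ^ k * wt g k) + 2 * c0 * 4 ^ m * real (\<Sum>k<m. Suc k - g)"
      by (simp add: sum.distrib sum_distrib_left lessThan_atLeast0)
    also have "\<dots> \<le> c0 * 4 ^ m * wt g m + 2 * c0 * 4 ^ m * real 25"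
    proof (intro add_mono wt_sum4 mult_left_mono)
      have "(\<Sum>k<m. Suc k - g) \<le> (m - g) * (m - g)" by (rule hz_sum)
      also have "\<dots> \<le> 5 * 5" using False by (intro mult_mono) auto
      finally show "real (\<Sum>k<m. Suc k - g) \<le> real 25" by (simp only: of_nat_le_iff)
    qed (simp add: c0_def)
    finally have "fC r q 0 g l b cand cb \<le> R1 + c0 * 4 ^ m * real (3 * wt g m + 50) + ?T"
      by (simp add: algebra_simps)
    moreover have "c0 * 4 ^ m * real (3 * wt g m + 50) \<le> c0 * 4 ^ m * real (318 * (1 + (max g m0 - m)))"
      using False mm0 by (intro mult_left_mono) (auto simp: wt_def c0_def)
    moreover have "\<dots> = 318 * c0 * 4 ^ m * (1 + (max g m0 - m))" by simp
    ultimately have "fC r q 0 g l b cand cb \<le> R1 + 318 * c0 * 4 ^ m * (1 + (max g m0 - m)) + ?T"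
      by linarith
    then show ?thesis using False by (simp add: R1_def)
  next
    case True
    \<comment> \<open>Accurate tests up to this scale keep arm \<open>q\<close>, and it is far
      enough above \<open>g\<close> for a verification on it to be likely.\<close>
    define js where "js = m - 4"
    have js: "js < m" "Suc js = m - 3" "js < r" using True r by (auto simp: js_def)
    have VD: "?VC \<le> ?D" by (simp add: c0_def)
    have x: "fX r q g l b cand cb \<le> R1 + ?D" using skip True cR by simp
    have v': "fV r q 0 g l b cand cb \<le> R1 + ?D" using v VD by linarith
    have RD: "0 \<le> R1 + ?D" using cR by (simp add: c0_def)
    have tail: "fC r q m g l b cand cb \<le> R1 + ?D + 2 * c0 * 4 ^ m * wt g m + ?T"
      by (rule q_tail[OF gap inv(1) RD x _ order.refl r(1)]) (use v' VC in linarith)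
    define G where "G j = 2 * c0 * 4 ^ m * wt g m + ?T + (\<Sum>k=j..<m. c0 * 4 ^ k * wt g k)" for j
    have G0: "0 \<le> G j" for j
      unfolding G_def using rho_pos by (simp add: c0_def sum_nonneg)
    have GS: "G j = c0 * 4 ^ j * wt g j + G (Suc j)" if "j < m" for j
      unfolding G_def using that by (simp add: sum.atLeast_Suc_lessThan)
    have C: "fC r q j g l b cand cb \<le> R1 + ?D + G j" if "j \<le> m" for j
      using that
    proof (induction "m - j" arbitrary: j)
      case 0
      then show ?case using tail by (simp add: G_def)
    next
      case (Suc y j)
      then have j: "j < m" "j < r" using r by auto
      have IH: "fC r q (Suc j) g l b cand cb \<le> R1 + ?D + G (Suc j)"
        using Suc.hyps(1)[of "Suc j"] Suc.hyps(2) j by simp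
      have x': "fX r q g l b cand cb \<le> R1 + ?D + G (Suc j)" using x G0[of "Suc j"] by linarith
      have v'': "fV r q 0 g l b cand cb \<le> R1 + ?D + G (Suc j)" using v' G0[of "Suc j"] by linarith
      have "fC r q j g l b cand cb \<le> (if q = q then c0 * 4 ^ j * wt g j else 0) + (R1 + ?D + G (Suc j))"
        by (rule cheap_all[OF q _ x' v'' IH]) (use j in simp)
      then show ?case using GS[OF j(1)] by simp
    qed
    \<comment> \<open>A lower bound for the expected release of credit. Half of it must cover three
      times the test on scale \<open>m\<close>, and \<open>wt g m\<close> is at most
      \<open>3 * (m - 3 - g)\<close>, which gives \<open>18 = 2 * 3 * 3\<close>. The credit has
      \<open>38 = 36 + 2\<close>, where 2 pays for the verification and 36 suffices even if that is
      certain, because \<open>m\<close> is at most \<open>2 * lam\<close>.\<close>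
    define X where "X = 18 * c0 * 4 ^ m * real (m - 3 - g)"
    have X0: "0 \<le> X" by (simp add: X_def c0_def)
    have XD: "X \<le> ?D - ?VC"
    proof -
      have "X \<le> 18 * c0 * 4 ^ m * real (2 * lam)"
        unfolding X_def using r by (intro mult_left_mono) (auto simp: c0_def)
      then show ?thesis by (simp add: c0_def mult_ac)
    qed
    have Xhz: "X \<le> hz g js * (?D - ?VC)"
    proof (cases "real (Suc js - g) / lam \<le> 1")
      case True
      then have "hz g js * (?D - ?VC) = real (m - 3 - g) / lam * (?D - ?VC)" using js by (simp add: hz_def)
      also have "\<dots> = 36 * c0 * 4 ^ m * real (m - 3 - g)" using lam by (simp add: field_simps)
      finally have "hz g js * (?D - ?VC) = 36 * c0 * 4 ^ m * real (m - 3 - g)" .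
      moreover have "X \<le> 36 * c0 * 4 ^ m * real (m - 3 - g)" by (simp add: X_def c0_def)
      ultimately show ?thesis by linarith
    next
      case False
      then have "hz g js = 1" unfolding hz_def by (intro min_absorb1) linarith
      then show ?thesis using XD by simp
    qed
    have nokill: "\<not> killed r j b e" if "j \<le> js" "\<bar>hat r e - mu q\<bar> \<le> dl j / 16" for j e
    proof
      assume "killed r j b e"
      then have "m \<le> j + 2" using far kill_test(2)[OF inv(1) _ that(2)] that(1) js by simp
      then show False using that js by simp
    qed
    let ?P = "\<lambda>j. \<Sum>k=j..js. rho ^ wt g k"
    have P0: "0 \<le> ?P j" for j using rho_pos by (simp add: sum_nonneg)
    \<comment> \<open>The release is lost only if some test up to scale \<open>js\<close> is
      inaccurate, and the chance \<open>?P 0\<close> of this is at most 1/2.\<close>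
    have "fC r q j g l b cand cb \<le> R1 + ?D + G j - X + X * ?P j" if "j \<le> js" for j
      using that
    proof (induction "js - j" arbitrary: j)
      case (0 j)
      then have j: "j = js" by simp
      let ?c = "R1 + ?D + G (Suc j) - X"
      have IH: "fC r q (Suc j) g l b cand cb \<le> R1 + ?D + G (Suc j)" using C[of "Suc j"] j js by simp
      have "hz g j * fV r q 0 g l b cand cb + (1 - hz g j) * fC r q (Suc j) g l b cand cb
        \<le> hz g j * (R1 + ?VC + G (Suc j)) + (1 - hz g j) * (R1 + ?D + G (Suc j))"
        using hz[of g j] IH v G0[of "Suc j"] by (intro add_mono mult_left_mono) auto
      also have "\<dots> = R1 + ?D + G (Suc j) - hz g j * (?D - ?VC)" by (simp add: algebra_simps)
      finally have a: "hz g j * fV r q 0 g l b cand cb + (1 - hz g j) * fC r q (Suc j) g l b cand cb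
        \<le> ?c" using Xhz j by simp
      have "fC r q j g l b cand cb \<le> (if q = q then c0 * 4 ^ j * wt g j else 0) + ?c + rho ^ wt g j * X"
        by (rule cheap_rule[OF q]) (use j js a X0 nokill x G0[of "Suc j"] in auto)
      then show ?case using j js GS[of j] by (simp add: mult.commute)
    next
      case (Suc y j)
      then have j: "j < js" "j < r" using js by auto
      let ?c = "R1 + ?D + G (Suc j) - X + X * ?P (Suc j)"
      have IH: "fC r q (Suc j) g l b cand cb \<le> ?c"
        using Suc.hyps(1)[of "Suc j"] Suc.hyps(2) j by simp
      have XP: "0 \<le> X * ?P (Suc j)" using X0 P0 by simp
      then have v'': "fV r q 0 g l b cand cb \<le> ?c" using v XD G0[of "Suc j"] by linarith
      have a: "hz g j * fV r q 0 g l b cand cb + (1 - hz g j) * fC r q (Suc j) g l b cand cb \<le> ?c"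
        by (rule convex2[OF hz v'' IH])
      have x': "fX r q g l b cand cb \<le> ?c + X" using XP x G0[of "Suc j"] by linarith
      have "fC r q j g l b cand cb \<le> (if q = q then c0 * 4 ^ j * wt g j else 0) + ?c + rho ^ wt g j * X"
        by (rule cheap_rule[OF q]) (use j js a X0 nokill x' in auto)
      moreover have "?P j = rho ^ wt g j + ?P (Suc j)"
        using j by (simp add: sum.atLeast_Suc_atMost)
      ultimately show ?case using j js GS[of j] by (simp add: algebra_simps)
    qed
    from this[of 0] have "fC r q 0 g l b cand cb \<le> R1 + ?D + G 0 - X + X * ?P 0" by simp
    moreover have "X * ?P 0 \<le> X * (1 / 2)"
      using wt_sum[of g js] rho_le X0 by (intro mult_left_mono) auto
    moreover have "G 0 \<le> 3 * (c0 * 4 ^ m * wt g m) + ?T"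
      unfolding G_def using wt_sum4[of g] by (simp add: lessThan_atLeast0 mult_ac)
    moreover have "3 * (c0 * 4 ^ m * wt g m) \<le> X * (1 / 2)"
    proof -
      have "c0 * 4 ^ m * real (wt g m) \<le> c0 * 4 ^ m * real (3 * (m - 3 - g))"
        using True by (intro mult_left_mono) (auto simp: wt_def c0_def)
      then show ?thesis by (simp add: X_def mult_ac)
    qed
    ultimately show ?thesis using True by (simp add: R1_def)
  qed
qed

text \<open>The leader is good enough for an arm with gap \<open>dl k\<close> to be rejected on scale \<open>k\<close>.\<close>

definition gd :: "nat \<Rightarrow> nat \<Rightarrow> nat \<Rightarrow> bool" where
  "gd r l k \<longleftrightarrow> mu istar - mu l + dl r / 4 \<le> dl k / 4"

text \<open>A candidate whose estimate is at least that of the leader can be worse by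
  \<open>dl r / 8\<close>. This is the amount by which the slack \<open>dl r / 4\<close> in
  \<open>gd\<close> shrinks from one pass to the next.\<close>

lemma gd_persist:
  assumes "gd r l k" "inv r l b" "inv r cand cb" "b \<le> cb"
  shows "gd (Suc r) cand k"
  using assms hat_mono[OF assms(4), of r] unfolding gd_def inv_def dl_Suc by linarith

text \<open>Once the best arm has been noticed, the next leader is within \<open>dl r / 8\<close> of
  the optimum.\<close>

lemma gd_new:
  assumes "inv r cand cb" "mu istar - dl r / 16 \<le> hat r cb" "k \<le> r"
  shows "gd (Suc r) cand k"
  using assms(1,2) dl_mono[OF assms(3)] unfolding gd_def inv_def dl_Suc by linarith

lemma gd_opt:
  assumes "gd r l m0" "l < K"
  shows "mu l = mu istar"
proof (rule ccontr)
  assume "mu l \<noteq> mu istar"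
  then have "dl m0 \<le> mu istar - mu l" using m0[OF assms(2)] mu_star[OF assms(2)] by simp
  then show False using assms(1) dl_pos[of m0] dl_pos[of r] unfolding gd_def by linarith
qed

section \<open>The potential of an epoch and its decrease over a pass\<close>

definition xi :: real where "xi = (real K + 1) * (2 * real lam + 1) * eps"

text \<open>\<open>At\<close> pays for the tests of arm \<open>q\<close> while the level is far below \<open>m\<close>, \<open>Bt\<close> for the passes with a leader that is too
  bad to reject arm \<open>q\<close>, \<open>Tl\<close> for the rare failures of cheap tests in later passes, and \<open>Ov\<close> for a
  level above \<open>m0\<close>, which is possible only if the best arm has stayed unnoticed for long.\<close>

definition At :: "nat \<Rightarrow> real" where "At g = (if g + 5 < m then 38 * c0 * lam * 4 ^ m else 0)"

definition Bt :: "nat \<Rightarrow> nat \<Rightarrow> real" where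
  "Bt r l = (if r \<le> m then 21 * c0 * lam * (4 ^ Suc m - 4 ^ r)
     else if gd r l m then 0 else 14 * c0 * lam * 4 ^ r)"

definition Ov :: "nat \<Rightarrow> nat \<Rightarrow> real" where
  "Ov r l = (if r \<le> m0 then 4 else if gd r l m0 then 0 else 2 * (1 + (real r - real m0)))"

definition Tl :: "nat \<Rightarrow> real" where "Tl r = 2 * c0 * lam * 4 ^ m * dl (r - m)"

definition Cm :: real where "Cm = 318 * c0 * 4 ^ m"

text \<open>The potential that bounds \<open>fL r l g\<close>.\<close>

definition V :: "nat \<Rightarrow> nat \<Rightarrow> nat \<Rightarrow> real" where
  "V r l g = (2 * real lam - r) * xi + At g + Bt r l + Tl r
     + Cm * (2 * real lam - r) * (1 + real (max g m0 - m)) + Cm * (2 * real lam) * Ov r l"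

text \<open>A bound for the level and for \<open>m0\<close> that stays fixed during a pass: an
  optimal leader leads to no accurately verified rejection beyond scale \<open>m0\<close>, any other
  leader to none beyond scale \<open>r\<close>.\<close>

definition gm :: "nat \<Rightarrow> nat \<Rightarrow> nat \<Rightarrow> nat" where
  "gm r l g = max g (if gd r l m0 \<or> r \<le> m0 then m0 else max r m0)"

definition tail :: "nat \<Rightarrow> real" where "tail r = rho ^ (Suc r - m) * (2 * c0 * 4 ^ m * lam)"

text \<open>Bounds the expected value of \<open>Bt (Suc r)\<close> for the next leader. After pass
  \<open>m\<close> a bad leader has a bad successor only if the best arm stays unnoticed, whence the
  factor \<open>f\<close>; \<open>On\<close> plays the same part for \<open>Ov\<close>.\<close>

definition Bn :: "nat \<Rightarrow> nat \<Rightarrow> real \<Rightarrow> real" where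
  "Bn r l f = (if r < m then 21 * c0 * lam * (4 ^ Suc m - 4 ^ Suc r)
     else if r = m then 14 * c0 * lam * 4 ^ Suc r
     else if gd r l m then 0 else 14 * c0 * lam * 4 ^ Suc r * f)"

definition On :: "nat \<Rightarrow> nat \<Rightarrow> real \<Rightarrow> real" where
  "On r l f = (if r \<le> m0 then 4 else if gd r l m0 then 0 else 2 * (2 + (real r - real m0)) * f)"

text \<open>The price of the slot of arm \<open>q\<close>. In the worst case of the second
  alternative, weights of at most \<open>2 * lam\<close> and one verification give 3 per scale,
  which the sum over the scales doubles.\<close>

definition Sb :: "nat \<Rightarrow> nat \<Rightarrow> nat \<Rightarrow> real" where
  "Sb r l g = (if m < r \<and> gd r l m then Cm * (1 + real (gm r l g - m)) + tail r else 6 * c0 * lam * 4 ^ r)"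

text \<open>The potential before the slot of arm \<open>i\<close>, without the term \<open>At\<close>; \<open>f\<close> bounds the probability
  that the best arm will not have been noticed by the end of the pass.\<close>

definition U :: "nat \<Rightarrow> nat \<Rightarrow> nat \<Rightarrow> nat \<Rightarrow> real \<Rightarrow> real" where
  "U r l i g f = (real K - real i) * (2 * real lam + 1) * eps + (2 * real lam - Suc r) * xi + Bn r l f
     + Tl (Suc r) + Cm * (2 * real lam - Suc r) * (1 + real (gm r l g - m))
     + Cm * (2 * real lam) * On r l f + (if i \<le> q then Sb r l g else 0)"

text \<open>The value 1/16 exceeds the chance \<open>4 * rho\<close> of missing \<open>istar\<close>
  and is small against the factor 4 by which bad passes become more expensive. After the slot of
  \<open>istar\<close> the matter is decided.\<close>

definition ph :: "nat \<Rightarrow> nat \<Rightarrow> nat \<Rightarrow> real" where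
  "ph r i cb = (if i \<le> istar then 1 / 16 else if mu istar - dl r / 16 \<le> hat r cb then 0 else 1)"

lemma ph: "0 \<le> ph r i cb" by (simp add: ph_def)

lemma ph_mono: "cb \<le> cb' \<Longrightarrow> ph r i cb' \<le> ph r i cb"
  using hat_mono[of cb cb' r] by (auto simp: ph_def)

lemma nonneg: "0 \<le> xi" "0 \<le> At g" "0 \<le> Bt r l" "0 \<le> Tl r" "0 \<le> Cm" "0 \<le> Ov r l" "0 \<le> tail r" "0 \<le> Sb r l g"
proof -
  show 1: "0 \<le> xi" "0 \<le> At g" "0 \<le> Tl r" "0 \<le> Cm" "0 \<le> tail r" "0 \<le> Ov r l"
    using eps rho_pos dl_pos by (auto simp: xi_def At_def Bt_def Tl_def Cm_def Ov_def tail_def c0_def less_imp_le)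
  show "0 \<le> Bt r l"
    using power_increasing[of r "Suc m" "4::real"] by (auto simp: Bt_def c0_def)
  show "0 \<le> Sb r l g" using 1 by (auto simp: Sb_def c0_def)
qed

lemma Bn_nonneg: "0 \<le> f \<Longrightarrow> 0 \<le> Bn r l f"
  using power_increasing[of "Suc r" "Suc m" "4::real"] by (auto simp: Bn_def c0_def)

lemma On_nonneg: "0 \<le> f \<Longrightarrow> 0 \<le> On r l f"
  by (auto simp: On_def)

lemma Bn_mono: "f \<le> f' \<Longrightarrow> Bn r l f \<le> Bn r l f'"
  by (auto simp: Bn_def c0_def intro!: mult_left_mono)

lemma On_mono: "f \<le> f' \<Longrightarrow> On r l f \<le> On r l f'"
  by (auto simp: On_def intro!: mult_left_mono)

lemma U_nonneg:
  assumes "Suc r \<le> 2 * lam" "i \<le> K" "0 \<le> f"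
  shows "0 \<le> U r l i g f"
  unfolding U_def using assms eps
  by (intro add_nonneg_nonneg mult_nonneg_nonneg) (auto simp: nonneg Bn_nonneg On_nonneg)

lemma U_mono:
  assumes "gm r l g' = gm r l g" "f' \<le> f"
  shows "U r l i g' f' \<le> U r l i g f"
proof -
  have "Sb r l g' = Sb r l g" by (simp add: Sb_def assms(1))
  moreover have "Cm * (2 * real lam) * On r l f' \<le> Cm * (2 * real lam) * On r l f"
    using On_mono[OF assms(2)] nonneg(5) by (intro mult_left_mono) auto
  ultimately show ?thesis
    unfolding U_def assms(1) \<open>Sb r l g' = Sb r l g\<close> using Bn_mono[OF assms(2), of r l] by linarith
qed

text \<open>Being affine in \<open>f\<close>, the potential at a probability \<open>f\<close> is the
  average of its values for the best arm noticed and missed.\<close>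

lemma U_affine: "U r l i g f = U r l i g 0 + f * (U r l i g 1 - U r l i g 0)"
  by (auto simp: U_def Bn_def On_def algebra_simps)

text \<open>With an optimal leader, an accurate rejection on a scale \<open>j > m0\<close> would
  mean a positive gap of at most \<open>5 / 4 * dl j\<close>, below the smallest gap
  \<open>dl m0\<close>. Otherwise \<open>gm\<close> already allows for every scale of the
  pass.\<close>

lemma vout_props:
  assumes "vout r i g l cand cb g' cand' cb'" "g \<le> r" "inv r cand cb" "l < K" "i < K"
  shows "g \<le> g'" "g' \<le> r" "inv r cand' cb'" "cb \<le> cb'" "gm r l g' = gm r l g"
proof -
  have "gm r l (max g j) = gm r l g" if j: "j \<le> r" "3 / 8 * dl j \<le> mu l - mu i"
    "0 < j \<longrightarrow> mu l - mu i \<le> 5 / 4 * dl j" for j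
  proof (cases "gd r l m0")
    case True
    have "j \<le> m0"
    proof (rule ccontr)
      assume "\<not> j \<le> m0"
      then have "dl j \<le> dl (Suc m0)" "mu l - mu i \<le> 5 / 4 * dl j" using j by (auto intro: dl_mono)
      moreover have "dl m0 \<le> mu l - mu i"
        using m0[OF assms(5)] gd_opt[OF True assms(4)] j(2) dl_pos[of j] by simp
      ultimately show False using dl_pos[of m0] unfolding dl_Suc by linarith
    qed
    then show ?thesis using True by (simp add: gm_def)
  next
    case False
    then show ?thesis using j by (auto simp: gm_def max_def)
  qed
  then show "g \<le> g'" "g' \<le> r" "inv r cand' cb'" "cb \<le> cb'" "gm r l g' = gm r l g"
    using assms unfolding vout_def by auto
qed

lemma istar_neq: "istar \<noteq> q" using m dl_pos[of m] by auto

text \<open>Induction from the last slot back to the first. Only the slot of \<open>istar\<close>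
  changes \<open>f\<close>, only that of \<open>q\<close> costs pulls of \<open>q\<close>, and all
  others cost just charges \<open>eps\<close>, whatever their outcome.\<close>

lemma pass:
  assumes r: "r < 2 * lam" and l: "inv r l b"
    and IH: "\<And>cand g. cand < K \<Longrightarrow> g \<le> Suc r \<Longrightarrow> fL (Suc r) cand g \<le> V (Suc r) cand g"
    and "i \<le> K" "g \<le> r" "inv r cand cb" "b \<le> cb"
  shows "(if i < K then fC r i 0 g l b cand cb else fL (Suc r) cand g) \<le> U r l i g (ph r i cb) + At g"
  using assms(4-7)
proof (induction "K - i" arbitrary: i g cand cb)
  case 0
  then have i: "i = K" by simp
  \<comment> \<open>Good leaders have good successors, and so does every leader if the best arm was
    noticed, in which case \<open>ph\<close> is 0.\<close>
  have "Bt (Suc r) cand \<le> Bn r l (ph r i cb)"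
    using gd_persist[OF _ l 0(4,5)] gd_new[OF 0(4)] istar i
    by (auto simp: Bt_def Bn_def ph_def c0_def)
  moreover have "Ov (Suc r) cand \<le> On r l (ph r i cb)"
    using gd_persist[OF _ l 0(4,5)] gd_new[OF 0(4)] istar i
    by (auto simp: Ov_def On_def ph_def)
  then have "Cm * (2 * real lam) * Ov (Suc r) cand \<le> Cm * (2 * real lam) * On r l (ph r i cb)"
    using nonneg(5) by (intro mult_left_mono) auto
  moreover have "Cm * (2 * real lam - Suc r) * (1 + real (max g m0 - m))
     \<le> Cm * (2 * real lam - Suc r) * (1 + real (gm r l g - m))"
    using nonneg(5) r by (intro mult_left_mono) (auto simp: gm_def)
  moreover have "U r l i g (ph r i cb) = (2 * real lam - Suc r) * xi + Bn r l (ph r i cb) + Tl (Suc r)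
      + Cm * (2 * real lam - Suc r) * (1 + real (gm r l g - m)) + Cm * (2 * real lam) * On r l (ph r i cb)"
    using q i by (simp add: U_def)
  ultimately have "V (Suc r) cand g \<le> U r l i g (ph r i cb) + At g"
    unfolding V_def by linarith
  moreover have "fL (Suc r) cand g \<le> V (Suc r) cand g"
    using IH[of cand g] 0(3,4) unfolding inv_def by simp
  ultimately show ?case using i by simp
next
  case (Suc x)
  then have i: "i < K" by simp
  have X: "fX r i g' l b cand' cb' \<le> U r l (Suc i) g' (ph r (Suc i) cb') + At g'"
    if "g' \<le> r" "inv r cand' cb'" "b \<le> cb'" for g' cand' cb'
    using Suc.hyps(1)[of "Suc i" g' cand' cb'] Suc.hyps(2) that i unfolding fX_eq by simp
  have lK: "l < K" using l by (simp add: inv_def)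
  have out0: "fX r i g' l b cand' cb' \<le> U r l (Suc i) g (ph r (Suc i) cb) + At g'"
    and At: "At g' \<le> At g"
    if "vout r i g l cand cb g' cand' cb'" for g' cand' cb'
  proof -
    note vp = vout_props[OF that Suc.prems(2,3) lK i]
    have "b \<le> cb'" using vp Suc.prems by linarith
    then show "fX r i g' l b cand' cb' \<le> U r l (Suc i) g (ph r (Suc i) cb) + At g'"
      using X[OF vp(2,3)] U_mono[OF vp(5) ph_mono[OF vp(4)], of "Suc i" r "Suc i"] by linarith
    show "At g' \<le> At g" using vp(1) by (auto simp: At_def c0_def)
  qed
  then have out: "fX r i g' l b cand' cb' \<le> U r l (Suc i) g (ph r (Suc i) cb) + At g"
    if "vout r i g l cand cb g' cand' cb'" for g' cand' cb'
    using that by (meson add_left_mono order_trans)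
  have skip: "fX r i g l b cand cb \<le> U r l (Suc i) g (ph r (Suc i) cb) + At g"
    using X Suc.prems by blast
  have U0: "0 \<le> U r l (Suc i) g f" if "0 \<le> f" for f using U_nonneg[OF _ _ that] r i by simp
  have U1: "0 \<le> U r l (Suc i) g f + At g" if "0 \<le> f" for f using U0[OF that] nonneg(2) by simp
  have e: "real (Suc r) * eps \<le> (2 * real lam + 1) * eps"
    using r eps by (intro mult_right_mono) auto
  have Ui: "U r l (Suc i) g f + (2 * real lam + 1) * eps + (if i = q then Sb r l g else 0) = U r l i g f" for f
    by (auto simp: U_def algebra_simps)
  consider "i = istar" | "i \<noteq> istar" "i \<noteq> q" | "i = q" "m < r \<and> gd r l m" | "i = q" "\<not> (m < r \<and> gd r l m)"
    by blast
  then have "fC r i 0 g l b cand cb \<le> U r l i g (ph r i cb) + At g"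
  proof cases
    case 1
    let ?c = "U r l (Suc i) g 0 + At g" and ?d = "U r l (Suc i) g 1 - U r l (Suc i) g 0"
    have d: "0 \<le> ?d" using U_mono[of r l g g 0 1 "Suc i"] by simp
    have "fC r istar 0 g l b cand cb \<le> ?c + real (Suc r) * eps + (\<Sum>k=0..r. rho ^ wt g k) * ?d"
    proof (rule star_slot[OF istar_neq l Suc.prems(3) U1[OF order.refl] d])
      show "fX r istar g l b cand' cb' \<le> ?c" if "inv r cand' cb'" "cb \<le> cb'" "mu istar - dl r / 16 \<le> hat r cb'"
        for cand' cb'
      proof -
        have "ph r (Suc i) cb' = 0" using 1 that by (simp add: ph_def)
        then show ?thesis using X[of g cand' cb'] that Suc.prems 1 by simp
      qed
      show "fX r istar g l b cand cb \<le> ?c + ?d"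
        using skip U_mono[of r l g g "ph r (Suc i) cb" 1 "Suc i"] 1 by (simp add: ph_def split: if_splits)
    qed simp
    also have "\<dots> \<le> ?c + (2 * real lam + 1) * eps + 1 / 16 * ?d"
      using e wt_sum[of g r] rho_le d by (intro add_mono order.refl e mult_right_mono[OF _ d]) linarith
    also have "\<dots> = U r l (Suc i) g (1 / 16) + At g + (2 * real lam + 1) * eps"
      by (subst (3) U_affine) simp
    also have "\<dots> = U r l i g (ph r i cb) + At g"
      using Ui[of "1/16"] 1 istar_neq by (simp add: ph_def)
    finally show ?thesis using 1 by simp
  next
    case 2
    have "fC r i 0 g l b cand cb \<le> U r l (Suc i) g (ph r (Suc i) cb) + At g + real (Suc r) * eps"
      using crude_slot[OF i l Suc.prems(3) U1[OF ph] out skip, of 0] 2 by simp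
    moreover have "ph r (Suc i) cb = ph r i cb" using 2 by (auto simp: ph_def)
    ultimately show ?thesis using Ui[of "ph r i cb"] e 2 by simp
  next
    case 3
    have gap: "3 / 4 * dl m \<le> mu l - mu q"
      using 3(2) m(1) dl_pos[of r] unfolding gd_def by linarith
    have "fC r q 0 g l b cand cb \<le> U r l (Suc i) g (ph r (Suc i) cb) + real (Suc r) * eps
      + (if g + 5 < m then 38 * c0 * lam * 4 ^ m else 318 * c0 * 4 ^ m * (1 + (max g m0 - m)))
      + rho ^ (Suc r - m) * (2 * c0 * 4 ^ m * lam)"
      by (rule q_slot[OF gap l Suc.prems(3) U0[OF ph]])
        (use 3 r out0 skip in \<open>auto simp: At_def\<close>)
    moreover have "(if g + 5 < m then 38 * c0 * lam * 4 ^ m else 318 * c0 * 4 ^ m * (1 + (max g m0 - m)))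
      \<le> At g + Cm * (1 + real (gm r l g - m))"
    proof (cases "g + 5 < m")
      case True
      then show ?thesis using nonneg(5) by (simp add: At_def)
    next
      case False
      have "Cm * (1 + real (max g m0 - m)) \<le> Cm * (1 + real (gm r l g - m))"
        using nonneg(5) by (intro mult_left_mono) (auto simp: gm_def)
      then show ?thesis using False by (simp add: At_def Cm_def)
    qed
    moreover have "ph r (Suc i) cb = ph r i cb" using 3 istar_neq by (auto simp: ph_def)
    moreover have "Sb r l g = Cm * (1 + real (gm r l g - m)) + rho ^ (Suc r - m) * (2 * c0 * 4 ^ m * lam)"
      using 3 by (simp add: Sb_def tail_def)
    ultimately show ?thesis using Ui[of "ph r i cb"] e 3(1) by simp
  next
    case 4
    have "fC r i 0 g l b cand cb \<le> (\<Sum>k=0..r. c0 * 4 ^ k * wt g k) + (\<Sum>k=0..r. c0 * 4 ^ k * lam)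
      + (U r l (Suc i) g (ph r (Suc i) cb) + At g) + real (Suc r) * eps"
      using crude_slot[OF i l Suc.prems(3) U1[OF ph] out skip, of 0] 4 by simp
    moreover have "(\<Sum>k=0..r. c0 * 4 ^ k * wt g k) \<le> (\<Sum>k=0..r. 2 * (c0 * 4 ^ k * lam))"
    proof (rule sum_mono)
      fix k assume "k \<in> {0..r}"
      then have "wt g k \<le> 2 * lam" using Suc.prems(2) r by (auto simp: wt_def)
      then have "real (wt g k) \<le> 2 * real lam" by linarith
      then have "c0 * 4 ^ k * real (wt g k) \<le> c0 * 4 ^ k * (2 * real lam)"
        by (intro mult_left_mono) (auto simp: c0_def)
      then show "c0 * 4 ^ k * real (wt g k) \<le> 2 * (c0 * 4 ^ k * lam)" by simp
    qed
    moreover have "(\<Sum>k=0..r. 2 * (c0 * 4 ^ k * lam)) = 2 * (\<Sum>k=0..r. c0 * 4 ^ k * lam)"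
      by (simp add: sum_distrib_left)
    moreover have "Sb r l g = 6 * c0 * lam * 4 ^ r" using 4 by (auto simp: Sb_def)
    moreover have "ph r (Suc i) cb = ph r i cb" using 4 istar_neq by (auto simp: ph_def)
    moreover have "(\<Sum>k=0..r. c0 * 4 ^ k * lam) \<le> 2 * c0 * lam * 4 ^ r"
      using pow4_sum[of r] by (simp add: mult_ac)
    ultimately show ?thesis using Ui[of "ph r i cb"] e 4(1) by simp
  qed
  then show ?case using i by simp
qed

text \<open>The decrements of \<open>Tl\<close> are powers of 1/2, which dominate those of
  \<open>rho\<close>; so the failures in all later passes telescope.\<close>

lemma tail_le: "m < r \<Longrightarrow> tail r \<le> Tl r - Tl (Suc r)"
proof -
  assume "m < r"
  then have e: "Suc r - m = Suc (r - m)" by simp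
  have "rho ^ (Suc r - m) \<le> (1 / 2) ^ (Suc r - m)"
    using rho_pos rho_le by (intro power_mono) auto
  also have "\<dots> = dl (r - m) - dl (Suc r - m)"
    unfolding e dl_Suc by (simp add: dl_def power_one_over)
  finally have "rho ^ (Suc r - m) * (2 * c0 * 4 ^ m * lam) \<le> (dl (r - m) - dl (Suc r - m)) * (2 * c0 * 4 ^ m * lam)"
    by (intro mult_right_mono) (auto simp: c0_def)
  then show ?thesis by (simp add: tail_def Tl_def algebra_simps)
qed

lemma Tl_mono: "Tl (Suc r) \<le> Tl r"
  unfolding Tl_def by (intro mult_left_mono dl_mono) (auto simp: c0_def)

lemma fL_le_V:
  assumes "r \<le> 2 * lam" "l < K" "g \<le> r"
  shows "fL r l g \<le> V r l g"
  using assms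
proof (induction "2 * lam - r" arbitrary: r l g)
  case 0
  then have r: "r = 2 * lam" by simp
  have V: "Bt r l \<le> V r l g"
    unfolding V_def using nonneg(2)[of g] nonneg(4)[of r] nonneg(5) nonneg(6)[of r l] r by simp
  have "fL r l g \<le> (if l = q then 16 ^ lam else 0)" using fL_end[OF 0(3)] r by simp
  \<comment> \<open>In pass \<open>2 * lam\<close> arm \<open>q\<close> can be pulled only as the
    leader. Such a leader is too bad to reject arms with the gap of \<open>q\<close>, so
    \<open>Bt\<close> still holds a multiple of \<open>4 ^ r = 16 ^ lam\<close>.\<close>
  also have "\<dots> \<le> Bt r l"
  proof (cases "l = q")
    case True
    have p: "(16::real) ^ lam = 4 ^ r" unfolding r power_mult by simp
    have ng: "\<not> gd r q m" using m(1) dl_pos[of m] dl_pos[of r] unfolding gd_def by linarith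
    have l1: "(1::real) * 1 \<le> c0 * lam" using lam by (intro mult_mono) (auto simp: c0_def)
    show ?thesis
    proof (cases "r \<le> m")
      case True
      then have "(4::real) * 4 ^ r \<le> 4 ^ Suc m" using power_increasing[of r m "4::real"] by simp
      moreover have "(4::real) ^ r \<le> 4 * 4 ^ r - 4 ^ r" by simp
      ultimately have "(4::real) ^ r \<le> 4 ^ Suc m - 4 ^ r" by linarith
      then have "(21 * 1) * (4::real) ^ r \<le> (21 * (c0 * lam)) * (4 ^ Suc m - 4 ^ r)"
        using l1 by (intro mult_mono) auto
      moreover have "(4::real) ^ r \<le> (21 * 1) * 4 ^ r" by simp
      ultimately have "(4::real) ^ r \<le> (21 * (c0 * lam)) * (4 ^ Suc m - 4 ^ r)" by linarith
      then show ?thesis using True \<open>l = q\<close> p by (simp add: Bt_def mult_ac)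
    next
      case False
      have "(14 * 1) * (4::real) ^ r \<le> (14 * (c0 * lam)) * 4 ^ r"
        using l1 by (intro mult_right_mono) auto
      then show ?thesis using False \<open>l = q\<close> p ng by (simp add: Bt_def mult_ac)
    qed
  next
    case False
    then show ?thesis using nonneg(3) by simp
  qed
  finally show ?case using V by linarith
next
  case (Suc x)
  then have r: "r < 2 * lam" by simp
  have IH: "fL (Suc r) cand g \<le> V (Suc r) cand g" if "cand < K" "g \<le> Suc r" for cand g
    using Suc.hyps(1)[of "Suc r" cand g] Suc.hyps(2) that r by simp
  have "E l r r lam (\<lambda>e. fC r 0 0 g l e l e) \<le> U r l 0 g (1 / 16) + At g + eps"
  proof (rule E_lam)
    show "0 \<le> U r l 0 g (1 / 16) + At g" using U_nonneg[of r 0 "1/16" l g] nonneg(2) r by simp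
    fix e assume e: "\<bar>hat r e - mu l\<bar> \<le> dl r / 16"
    then have i: "inv r l e" using Suc.prems by (simp add: inv_def)
    have "(if 0 < K then fC r 0 0 g l e l e else fL (Suc r) l g) \<le> U r l 0 g (ph r 0 e) + At g"
      by (rule pass[OF r i IH]) (use i Suc.prems in auto)
    then show "fC r 0 0 g l e l e \<le> U r l 0 g (1 / 16) + At g"
      using q by (simp add: ph_def)
  qed (use Suc.prems fC_le in auto)
  then have main: "fL r l g \<le> (if l = q then c0 * 4 ^ r * lam else 0) + U r l 0 g (1 / 16) + At g + eps"
    using fL_step[OF Suc.prems(2), of r g] by linarith
  have "l = q \<Longrightarrow> \<not> gd r l m" using m(1) dl_pos[of m] dl_pos[of r] unfolding gd_def by auto
  then have cost: "(if l = q then c0 * 4 ^ r * lam else 0) \<le> (if m < r \<and> gd r l m then 0 else c0 * lam * 4 ^ r)"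
    by (auto simp: c0_def)
  let ?w = "c0 * lam * 4 ^ r"
  have w: "0 \<le> ?w" by (simp add: c0_def)
  \<comment> \<open>A bad pass costs at most \<open>7 * c0 * lam * 4 ^ r\<close>: 1 for the leader
    and 6 for the slot of \<open>q\<close>. The coefficient 14 fits since
    \<open>14 * 4 / 16 + 7\<close> is at most 14, and 21 since \<open>21 * 3 = 7 + 14 * 4\<close> is
    what is needed at \<open>r = m\<close>.\<close>
  have 1: "(if m < r \<and> gd r l m then 0 else ?w) + Sb r l g + Bn r l (1 / 16) + Tl (Suc r)
    \<le> Bt r l + Tl r + Cm * (1 + real (gm r l g - m))"
  proof -
    have C: "0 \<le> Cm * (1 + real (gm r l g - m))" using nonneg(5) by simp
    consider "r < m" | "r = m" | "m < r" "gd r l m" | "m < r" "\<not> gd r l m" by linarith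
    then show ?thesis
    proof cases
      case 1
      then show ?thesis using C w Tl_mono[of r] by (simp add: Sb_def Bn_def Bt_def algebra_simps)
    next
      case 2
      then show ?thesis using C w Tl_mono[of r] by (simp add: Sb_def Bn_def Bt_def algebra_simps)
    next
      case 3
      then show ?thesis using tail_le[of r] by (simp add: Sb_def Bn_def Bt_def)
    next
      case 4
      then show ?thesis using C w Tl_mono[of r] by (simp add: Sb_def Bn_def Bt_def)
    qed
  qed
  \<comment> \<open>The amount by which the level may outrun \<open>max g m0\<close> in this pass.
    The level is never lowered within the epoch, so \<open>Ov\<close> has to pay for it in all
    remaining passes.\<close>
  define y where "y = (if gd r l m0 \<or> r \<le> m0 then 0 else real r - real m0)"
  have "\<not> r \<le> m0 \<Longrightarrow> real m0 \<le> real r" by simp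
  then have 2: "y + On r l (1 / 16) \<le> Ov r l" by (auto simp: y_def On_def Ov_def field_simps)
  have 3: "real (gm r l g - m) \<le> real (max g m0 - m) + y"
    using mm0 Suc.prems by (auto simp: gm_def y_def of_nat_diff)
  have y: "0 \<le> y" by (simp add: y_def)
  have "Cm * (2 * real lam - r) * (1 + real (gm r l g - m))
     \<le> Cm * (2 * real lam - r) * (1 + real (max g m0 - m) + y)"
    using 3 nonneg(5) r by (intro mult_left_mono) auto
  moreover have "Cm * (2 * real lam - r) * y \<le> Cm * (2 * real lam) * y"
    using y nonneg(5) r by (intro mult_right_mono mult_left_mono) auto
  moreover have "Cm * (2 * real lam) * (y + On r l (1 / 16)) \<le> Cm * (2 * real lam) * Ov r l"
    using 2 nonneg(5) by (intro mult_left_mono) auto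
  ultimately have 4: "Cm * (2 * real lam - r) * (1 + real (gm r l g - m)) + Cm * (2 * real lam) * On r l (1 / 16)
    \<le> Cm * (2 * real lam - r) * (1 + real (max g m0 - m)) + Cm * (2 * real lam) * Ov r l"
    by (simp add: distrib_left)
  \<comment> \<open>A pass makes at most \<open>2 * lam + 1\<close> charges \<open>eps\<close> in
    each of its \<open>K\<close> slots, and one more for the estimate of the leader.\<close>
  have 5: "real K * (2 * real lam + 1) * eps + eps \<le> xi"
    using eps by (simp add: xi_def algebra_simps)
  show ?case
    using main cost 1 4 5 unfolding V_def U_def by (simp add: algebra_simps)
qed

theorem epoch_bound:
  assumes "l < K"
  shows "fL 0 l 0 \<le> 30000 * c0 * lam * 4 ^ m * (1 + real (m0 - m)) + 2 * real lam * xi"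
proof -
  define L where "L = c0 * lam * 4 ^ m"
  define x where "x = 1 + real (m0 - m)"
  have L: "0 \<le> L" by (simp add: L_def c0_def)
  have x: "1 \<le> x" by (simp add: x_def)
  have Lx: "L \<le> L * x" using L x mult_left_mono[of 1 x L] by simp
  have "At 0 \<le> 38 * L" by (auto simp: At_def L_def c0_def)
  moreover have "Bt 0 l \<le> 84 * L" by (auto simp: Bt_def L_def c0_def algebra_simps)
  moreover have "Tl 0 \<le> 2 * L" by (auto simp: Tl_def L_def dl_def)
  moreover have "Cm * (2 * real lam - 0) * (1 + real (max 0 m0 - m)) = 636 * (L * x)"
    by (simp add: Cm_def L_def x_def)
  moreover have "Cm * (2 * real lam) * Ov 0 l = 2544 * L"
    by (simp add: Cm_def L_def Ov_def)
  moreover have "fL 0 l 0 \<le> V 0 l 0" using fL_le_V[OF _ assms, of 0 0] by simp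
  ultimately have "fL 0 l 0 \<le> 2 * real lam * xi + 2668 * L + 636 * (L * x)"
    unfolding V_def of_nat_0 diff_zero by linarith
  also have "\<dots> \<le> 2 * real lam * xi + 30000 * (L * x)" using Lx L by linarith
  finally show ?thesis by (simp add: L_def x_def mult_ac)
qed

end

subsection \<open>The player as an automaton\<close>

text \<open>
  The phase \<open>md\<close> is 0 in the warm-up, 1 while the leader is estimated, 2 in a cheap test and 3 in a
  verification. A test in progress has \<open>cnt\<close> of its \<open>len\<close> pulls left and the sum \<open>acc\<close> of readings with
  precision \<open>prec\<close>, which is \<open>256 * 2\<^sup>r\<close> in pass \<open>r\<close>. The scale is \<open>lev\<close>, with \<open>bj = 4096 * 4\<^sup>j\<close> and
  \<open>thr = prec / 2\<^sup>j\<^sup>+\<^sup>1\<close> for \<open>j = lev\<close>, and the level is \<open>gl\<close>. The estimates of the leader and of the candidate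
  \<open>cnd\<close> are \<open>bm\<close> and \<open>cbst\<close>. Finally, \<open>lm\<close> is the parameter of the epoch, which has length
  \<open>hor = 16 ^ lm\<close> and of which \<open>tau\<close> pulls are left.
\<close>

record st =
  md :: nat
  arm :: nat
  cnt :: nat
  len :: nat
  acc :: nat
  lev :: nat
  gl :: nat
  prec :: nat
  bm :: nat
  cnd :: nat
  cbst :: nat
  bj :: nat
  thr :: nat
  lm :: nat
  tau :: nat
  hor :: nat

text \<open>In pass \<open>r\<close> the term \<open>prec s * prec s div 16\<close> is
  \<open>4096 * 4 ^ r\<close>; neither the pass number nor a power of it needs a word of its
  own.\<close>

definition setlen :: "st \<Rightarrow> st" where
  "setlen s = (let n = (if md s = 1 then prec s * prec s div 16 * lm s
      else if md s = 2 then bj s * wt (gl s) (lev s) else bj s * lm s)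
    in s\<lparr>acc := 0, len := n, cnt := n\<rparr>)"

definition reset :: "st \<Rightarrow> st" where
  "reset s = setlen (s\<lparr>lev := 0, bj := 4096, thr := prec s div 2\<rparr>)"

definition adv :: "st \<Rightarrow> st" where
  "adv s = setlen (s\<lparr>lev := Suc (lev s), bj := 4 * bj s, thr := thr s div 2\<rparr>)"

definition next_arm :: "nat \<Rightarrow> st \<Rightarrow> st" where
  "next_arm K s = (if Suc (arm s) < K then reset (s\<lparr>md := 2, arm := Suc (arm s)\<rparr>)
     else reset (s\<lparr>md := 1, arm := cnd s, prec := 2 * prec s, bm := 0, cbst := 0\<rparr>))"

text \<open>As \<open>thr\<close> is \<open>128 * 2 ^ (r - j)\<close>, the comparison
  \<open>128 < thr s\<close> decides \<open>j < r\<close>. For \<open>v\<close> uniform below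
  \<open>lm s\<close>, the comparison with \<open>Suc (lev s) - gl s\<close> triggers a verification
  with the probability \<open>hz\<close>.\<close>

definition bend :: "nat \<Rightarrow> st \<Rightarrow> nat \<Rightarrow> st" where
  "bend K s v = (let e = acc s div len s in
     if md s = 1 then reset (s\<lparr>md := 2, arm := 0, bm := e, cnd := arm s, cbst := e\<rparr>)
     else if md s = 2 then
       (if e + thr s < bm s then next_arm K s
        else if 128 < thr s \<and> \<not> v < Suc (lev s) - gl s then adv s
        else reset (s\<lparr>md := 3\<rparr>))
     else
       (if e + thr s < bm s then next_arm K (s\<lparr>gl := max (gl s) (lev s)\<rparr>)
        else if 128 < thr s then adv s
        else next_arm K (if cbst s < e then s\<lparr>cnd := arm s, cbst := e\<rparr> else s)))"

text \<open>\<open>y\<close> is the reading of the current pull and \<open>v\<close> a uniform number below \<open>lm s\<close>. The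
  functions \<open>ev\<close> and \<open>av\<close> below are the expectations over these two.\<close>

definition kstep :: "nat \<Rightarrow> st \<Rightarrow> nat \<Rightarrow> nat \<Rightarrow> st" where
  "kstep K s y v = (let s' = s\<lparr>acc := acc s + y\<rparr> in
     if 1 < cnt s then s'\<lparr>cnt := cnt s - 1\<rparr> else bend K s' v)"

definition start_epoch :: "st \<Rightarrow> st" where
  "start_epoch s = reset (s\<lparr>md := 1, arm := 0, gl := 0, prec := 256, bm := 0, cnd := 0, cbst := 0,
     tau := hor s\<rparr>)"

text \<open>The squaring of \<open>hor\<close> until it reaches \<open>K\<close> is spread over the
  warm-up, at most one squaring per pull, so that the program needs no inner loop.\<close>

definition nxt :: "nat \<Rightarrow> st \<Rightarrow> nat \<Rightarrow> nat \<Rightarrow> st" where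
  "nxt K s y v =
    (if md s = 0 then
       (let s' = (if hor s < arm s + 2 then s\<lparr>lm := 2 * lm s, hor := hor s * hor s\<rparr> else s) in
        if Suc (arm s) < K then s'\<lparr>arm := Suc (arm s)\<rparr> else start_epoch s')
     else if 1 < tau s then kstep K (s\<lparr>tau := tau s - 1\<rparr>) y v
     else start_epoch (s\<lparr>lm := 2 * lm s, hor := hor s * hor s\<rparr>))"

definition av :: "nat \<Rightarrow> (nat \<Rightarrow> real) \<Rightarrow> real" where
  "av L f = (\<Sum>v<L. f v) / L"

lemma av_const: "0 < L \<Longrightarrow> av L (\<lambda>v. c) = c"
  by (simp add: av_def)

lemma av_mono: "(\<And>v. v < L \<Longrightarrow> f v \<le> g v) \<Longrightarrow> av L f \<le> av L g"
  unfolding av_def by (intro divide_right_mono sum_mono) auto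

lemma av_if:
  assumes "0 < L"
  shows "av L (\<lambda>v. if v < h then a else b) = min 1 (real h / L) * a + (1 - min 1 (real h / L)) * b"
proof (cases "h \<le> L")
  case True
  have "(\<Sum>v<L. if v < h then a else b) = (\<Sum>v<h. a) + (\<Sum>v\<in>{h..<L}. b)"
    using True by (subst sum.atLeastLessThan_concat[of 0 h L "\<lambda>v. if v < h then a else b", symmetric,
        unfolded lessThan_atLeast0[symmetric]]) (auto simp: lessThan_atLeast0 intro!: arg_cong2[where f="(+)"] sum.cong)
  also have "\<dots> = real h * a + (real L - real h) * b"
    using True by (simp add: of_nat_diff)
  finally have 1: "av L (\<lambda>v. if v < h then a else b) = (real h * a + (real L - real h) * b) / L"
    by (simp add: av_def)
  have 2: "min 1 (real h / L) = real h / L" using True assms by simp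
  show ?thesis unfolding 1 2 using assms by (simp add: field_simps)
next
  case False
  then have "av L (\<lambda>v. if v < h then a else b) = av L (\<lambda>v. a)"
    unfolding av_def by (intro arg_cong2[where f="(/)"] sum.cong) auto
  moreover have "min 1 (real h / L) = 1" using False assms by simp
  ultimately show ?thesis using av_const[OF assms] by simp
qed

section \<open>Expectations over readings, and Hoeffding's bound\<close>

locale bandit =
  fixes K :: nat and D :: "nat \<Rightarrow> real measure"
  assumes K: "0 < K" and inst: "bandit_instance K D"
begin

lemma D: "i < K \<Longrightarrow> prob_space (D i)" "i < K \<Longrightarrow> sets (D i) = sets borel" "i < K \<Longrightarrow> emeasure (D i) {0..1} = 1"
  using inst by (auto simp: bandit_instance_def)

lemma AE_D: "i < K \<Longrightarrow> AE z in D i. z \<in> {0..1}"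
  using prob_space.AE_prob_1[of "D i" "{0..1}"] D[of i] by (simp add: measure_def)

definition pr :: "nat \<Rightarrow> nat \<Rightarrow> nat \<Rightarrow> real" where
  "pr a Q y = measure (D a) {z. nat \<lfloor>z * real Q\<rfloor> = y}"

definition ev :: "nat \<Rightarrow> nat \<Rightarrow> (nat \<Rightarrow> real) \<Rightarrow> real" where
  "ev a Q f = (\<Sum>y\<le>Q. pr a Q y * f y)"

lemma pr_nonneg: "0 \<le> pr a Q y" by (simp add: pr_def)

lemma floor_measurable: "i < K \<Longrightarrow> (\<lambda>z. nat \<lfloor>z * real Q\<rfloor>) \<in> measurable (D i) (count_space UNIV)"
  by (subst measurable_cong_sets[OF D(2) refl]) measurable

lemma reward_le: "z \<in> {0..1} \<Longrightarrow> nat \<lfloor>z * real Q\<rfloor> \<le> Q"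
proof -
  assume "z \<in> {0..1}"
  then have "z * real Q \<le> 1 * real Q" by (intro mult_right_mono) auto
  then have "\<lfloor>z * real Q\<rfloor> \<le> int Q" by (simp add: floor_le_iff)
  then show ?thesis by linarith
qed

lemma ev_integral:
  assumes a: "a < K"
  shows "ev a Q f = (\<integral>z. f (nat \<lfloor>z * real Q\<rfloor>) \<partial>D a)"
proof -
  interpret prob_space "D a" using D(1)[OF a] .
  note [measurable] = floor_measurable[OF a]
  have sp: "space (D a) = UNIV" using sets_eq_imp_space_eq[OF D(2)[OF a]] by simp
  have m: "{z. nat \<lfloor>z * real Q\<rfloor> = y} \<in> sets (D a)" for y
    using measurable_sets[OF floor_measurable[OF a, of Q], of "{y}"] sp by (simp add: vimage_def)
  have "(\<integral>z. f (nat \<lfloor>z * real Q\<rfloor>) \<partial>D a) = (\<integral>z. (\<Sum>y\<le>Q. indicator {z. nat \<lfloor>z * real Q\<rfloor> = y} z * f y) \<partial>D a)"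
  proof (rule integral_cong_AE)
    show "(\<lambda>z. f (nat \<lfloor>z * real Q\<rfloor>)) \<in> borel_measurable (D a)"
      by (rule measurable_compose[OF floor_measurable[OF a]]) simp
    show "(\<lambda>z. \<Sum>y\<le>Q. indicator {z. nat \<lfloor>z * real Q\<rfloor> = y} z * f y) \<in> borel_measurable (D a)"
      using m by (intro borel_measurable_sum borel_measurable_times) auto
    show "AE z in D a. f (nat \<lfloor>z * real Q\<rfloor>) = (\<Sum>y\<le>Q. indicator {z. nat \<lfloor>z * real Q\<rfloor> = y} z * f y)"
      using AE_D[OF a]
    proof eventually_elim
      case (elim z)
      have "(\<Sum>y\<le>Q. indicator {z. nat \<lfloor>z * real Q\<rfloor> = y} z * f y)
        = (\<Sum>y\<le>Q. if y = nat \<lfloor>z * real Q\<rfloor> then f y else 0)"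
        by (intro sum.cong) (auto simp: indicator_def)
      then show ?case using reward_le[OF elim, of Q] by simp
    qed
  qed
  also have "\<dots> = (\<Sum>y\<le>Q. measure (D a) {z. nat \<lfloor>z * real Q\<rfloor> = y} * f y)"
    using m by (subst Bochner_Integration.integral_sum) (auto simp: emeasure_eq_measure sp)
  finally show ?thesis by (simp add: ev_def pr_def)
qed

lemma ev_const: "a < K \<Longrightarrow> ev a Q (\<lambda>y. c) = c"
  using ev_integral[of a Q "\<lambda>y. c"] prob_space.prob_space[OF D(1)] by simp

lemma ev_mono: "(\<And>y. y \<le> Q \<Longrightarrow> f y \<le> g y) \<Longrightarrow> ev a Q f \<le> ev a Q g"
  unfolding ev_def by (intro sum_mono mult_left_mono pr_nonneg) auto

lemma ev_add: "ev a Q (\<lambda>y. f y + g y) = ev a Q f + ev a Q g"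
  by (simp add: ev_def distrib_left sum.distrib)

lemma ev_cmult: "ev a Q (\<lambda>y. c * f y) = c * ev a Q f"
  by (simp add: ev_def sum_distrib_left mult_ac)

text \<open>The expectation over \<open>n\<close> independent readings added to the sum
  \<open>s\<close>, as an iterated one-step expectation; this matches the recursion over states and
  avoids product measures.\<close>

fun EB :: "nat \<Rightarrow> nat \<Rightarrow> nat \<Rightarrow> (nat \<Rightarrow> real) \<Rightarrow> nat \<Rightarrow> real" where
  "EB a Q 0 f s = f s"
| "EB a Q (Suc n) f s = ev a Q (\<lambda>y. EB a Q n f (s + y))"

lemma EB_mono: "(\<And>s. f s \<le> g s) \<Longrightarrow> EB a Q n f s \<le> EB a Q n g s"
  by (induction n arbitrary: s) (auto intro: ev_mono)

lemma EB_add: "EB a Q n (\<lambda>s. f s + g s) s = EB a Q n f s + EB a Q n g s"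
  by (induction n arbitrary: s) (auto simp: ev_add)

lemma EB_cmult: "EB a Q n (\<lambda>s. c * f s) s = c * EB a Q n f s"
  by (induction n arbitrary: s) (auto simp: ev_cmult)

lemma EB_const: "a < K \<Longrightarrow> EB a Q n (\<lambda>s. c) s = c"
  by (induction n arbitrary: s) (auto simp: ev_const)

lemma EB_exp: "EB a Q n (\<lambda>s. exp (c * real s)) s = exp (c * real s) * ev a Q (\<lambda>y. exp (c * real y)) ^ n"
proof (induction n arbitrary: s)
  case (Suc n)
  have "EB a Q (Suc n) (\<lambda>s. exp (c * real s)) s
    = ev a Q (\<lambda>y. (exp (c * real s) * ev a Q (\<lambda>y. exp (c * real y)) ^ n) * exp (c * real y))"
    by (simp add: Suc distrib_left exp_add mult_ac)
  also have "\<dots> = (exp (c * real s) * ev a Q (\<lambda>y. exp (c * real y)) ^ n) * ev a Q (\<lambda>y. exp (c * real y))"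
    by (rule ev_cmult)
  finally show ?case by simp
qed simp

definition mq :: "nat \<Rightarrow> nat \<Rightarrow> real" where "mq a Q = ev a Q (\<lambda>y. real y / Q)"

lemma rounded:
  assumes "a < K" "0 < Q"
  shows "interval_bounded_random_variable (D a) (\<lambda>z. real (nat \<lfloor>z * real Q\<rfloor>) / Q) 0 1"
proof -
  interpret prob_space "D a" using D(1)[OF assms(1)] .
  show ?thesis
  proof
    show "(\<lambda>z. real (nat \<lfloor>z * real Q\<rfloor>) / Q) \<in> borel_measurable (D a)"
      by (rule measurable_compose[OF floor_measurable[OF assms(1)]]) simp
    show "AE z in D a. real (nat \<lfloor>z * real Q\<rfloor>) / real Q \<in> {0..1}"
      using AE_D[OF assms(1)]
    proof eventually_elim
      case (elim z)
      have "real (nat \<lfloor>z * real Q\<rfloor>) \<le> real Q" using reward_le[OF elim, of Q] by (simp only: of_nat_le_iff)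
      moreover have "0 \<le> real (nat \<lfloor>z * real Q\<rfloor>)" by (rule of_nat_0_le_iff)
      ultimately show ?case using assms(2) by (simp add: divide_le_eq)
    qed
  qed
qed

lemma mq_bounds:
  assumes "a < K" "0 < Q"
  shows "mean D a - 1 / Q \<le> mq a Q" "mq a Q \<le> mean D a"
proof -
  interpret R: interval_bounded_random_variable "D a" "\<lambda>z. real (nat \<lfloor>z * real Q\<rfloor>) / Q" 0 1
    by (rule rounded[OF assms])
  have idm: "(\<lambda>z. z) \<in> borel_measurable (D a)"
    by (subst measurable_cong_sets[OF D(2)[OF assms(1)] refl]) simp
  have int: "integrable (D a) (\<lambda>z. z)"
    by (rule R.integrable_const_bound[where B = 1])
      (use AE_D[OF assms(1)] idm in \<open>auto elim!: eventually_mono[OF AE_D[OF assms(1)]]\<close>)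
  have eq: "mq a Q = (\<integral>z. real (nat \<lfloor>z * real Q\<rfloor>) / Q \<partial>D a)"
    unfolding mq_def by (rule ev_integral[OF assms(1)])
  show "mq a Q \<le> mean D a"
    unfolding eq mean_def
  proof (rule integral_mono_AE[OF R.integrable int])
    show "AE z in D a. real (nat \<lfloor>z * real Q\<rfloor>) / real Q \<le> z"
      using AE_D[OF assms(1)]
    proof eventually_elim
      case (elim z)
      have "real (nat \<lfloor>z * real Q\<rfloor>) \<le> z * real Q" using elim by (simp add: of_nat_nat)
      then show ?case using assms(2) by (simp add: field_simps)
    qed
  qed
  have "(\<integral>z. z - 1 / Q \<partial>D a) \<le> mq a Q"
    unfolding eq
  proof (rule integral_mono_AE)
    show "AE z in D a. z - 1 / real Q \<le> real (nat \<lfloor>z * real Q\<rfloor>) / real Q"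
      using AE_D[OF assms(1)]
    proof eventually_elim
      case (elim z)
      have "z * real Q - 1 \<le> real (nat \<lfloor>z * real Q\<rfloor>)" using elim
        by (simp add: of_nat_nat)
      then have "(z * real Q - 1) / Q \<le> real (nat \<lfloor>z * real Q\<rfloor>) / real Q" by (rule divide_right_mono) simp
      then show ?case using assms(2) by (simp add: diff_divide_distrib)
    qed
  qed (use int R.integrable in auto)
  also have "(\<integral>z. z - 1 / Q \<partial>D a) = mean D a - 1 / Q"
    using int by (subst Bochner_Integration.integral_diff) (auto simp: mean_def R.prob_space)
  finally show "mean D a - 1 / Q \<le> mq a Q" .
qed

text \<open>Hoeffding's lemma for a rounded reading; the two signs \<open>b\<close> serve the two
  tails.\<close>

lemma exp_ev:
  assumes "a < K" "0 < Q" "0 < s" and b: "b = 1 \<or> b = - 1"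
  shows "ev a Q (\<lambda>y. exp (s * (b * (real y / Q - mq a Q)))) \<le> exp (s\<^sup>2 / 8)"
proof -
  interpret R: interval_bounded_random_variable "D a" "\<lambda>z. real (nat \<lfloor>z * real Q\<rfloor>) / Q" 0 1
    by (rule rounded[OF assms(1,2)])
  let ?f = "\<lambda>z. b * (real (nat \<lfloor>z * real Q\<rfloor>) / Q)"
  have m: "?f \<in> borel_measurable (D a)"
    by (intro borel_measurable_times R.random_variable) simp
  interpret S: interval_bounded_random_variable "D a" ?f "if b = 1 then 0 else - 1" "if b = 1 then 1 else 0"
  proof
    show "AE x in D a. ?f x \<in> {if b = 1 then 0 else - 1..if b = 1 then 1 else 0}"
      using R.AE_in_interval by eventually_elim (use b in auto)
  qed (fact m)
  have eq: "R.expectation ?f = b * mq a Q"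
    using ev_integral[OF assms(1), of Q "\<lambda>y. real y / Q"] by (simp add: mq_def)
  have "ennreal (ev a Q (\<lambda>y. exp (s * (b * (real y / Q - mq a Q)))))
    = ennreal (\<integral>z. exp (s * (?f z - R.expectation ?f)) \<partial>D a)"
    unfolding eq by (subst ev_integral[OF assms(1)]) (simp add: right_diff_distrib)
  also have "\<dots> = (\<integral>\<^sup>+z. ennreal (exp (s * (?f z - R.expectation ?f))) \<partial>D a)"
  proof (rule nn_integral_eq_integral[symmetric])
    have "\<exists>B. AE z in D a. norm (exp (s * (?f z - R.expectation ?f))) \<le> B"
    proof (intro exI)
      show "AE z in D a. norm (exp (s * (?f z - R.expectation ?f))) \<le> exp (s * (1 - R.expectation ?f))"
        using S.AE_in_interval
      proof eventually_elim
        case (elim z)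
        then have "?f z \<le> 1" by (simp split: if_splits)
        then have "s * (?f z - R.expectation ?f) \<le> s * (1 - R.expectation ?f)"
          using assms(3) by (intro mult_left_mono) auto
        then show ?case by simp
      qed
    qed
    then obtain B where "AE z in D a. norm (exp (s * (?f z - R.expectation ?f))) \<le> B" by blast
    then show "integrable (D a) (\<lambda>z. exp (s * (?f z - R.expectation ?f)))"
    proof (rule R.integrable_const_bound)
      show "(\<lambda>z. exp (s * (?f z - R.expectation ?f))) \<in> borel_measurable (D a)"
        by (rule measurable_compose[OF m, of "\<lambda>x. exp (s * (x - R.expectation ?f))"]) measurable
    qed
  qed simp
  also have "\<dots> \<le> ennreal (exp (s\<^sup>2 * ((if b = 1 then 1 else 0) - (if b = 1 then 0 else - 1))\<^sup>2 / 8))"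
    by (rule S.Hoeffdings_lemma_nn_integral[OF assms(3)])
  also have "\<dots> = ennreal (exp (s\<^sup>2 / 8))" by simp
  finally show ?thesis by simp
qed

lemma EB_exp_le:
  assumes "a < K" "0 < Q" "0 < t" and b: "b = 1 \<or> b = - 1"
  shows "EB a Q n (\<lambda>s. exp (4 * t * (b * (real s / Q - n * mq a Q) - n * t))) 0 \<le> exp (- 2 * real n * t\<^sup>2)"
proof -
  \<comment> \<open>The minimiser of \<open>s ^ 2 / 8 - s * t\<close>, with minimum
    \<open>- 2 * t ^ 2\<close>.\<close>
  let ?s = "4 * t"
  let ?M = "ev a Q (\<lambda>y. exp (?s * (b * (real y / Q - mq a Q))))"
  have M0: "0 \<le> ?M" unfolding ev_def by (intro sum_nonneg mult_nonneg_nonneg pr_nonneg) auto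
  have "ev a Q (\<lambda>y. exp (?s * b / Q * real y)) = ev a Q (\<lambda>y. exp (?s * (b * mq a Q)) * exp (?s * (b * (real y / Q - mq a Q))))"
    by (simp add: exp_add[symmetric] algebra_simps)
  then have M: "ev a Q (\<lambda>y. exp (?s * b / Q * real y)) = exp (?s * (b * mq a Q)) * ?M"
    by (simp add: ev_cmult)
  have "EB a Q n (\<lambda>s. exp (?s * (b * (real s / Q - n * mq a Q) - n * t))) 0
    = EB a Q n (\<lambda>s. exp (- ?s * n * t - ?s * b * n * mq a Q) * exp (?s * b / Q * real s)) 0"
    by (simp add: exp_add[symmetric] algebra_simps)
  also have "\<dots> = exp (- ?s * n * t - ?s * b * n * mq a Q) * (exp (?s * (b * mq a Q)) * ?M) ^ n"
    unfolding EB_cmult EB_exp M by simp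
  also have "\<dots> = exp (- ?s * n * t) * ?M ^ n"
    by (simp add: power_mult_distrib exp_of_nat_mult[symmetric] exp_add[symmetric] exp_diff algebra_simps)
  also have "\<dots> \<le> exp (- ?s * n * t) * exp (?s\<^sup>2 / 8) ^ n"
    using exp_ev[OF assms(1,2), of ?s b] assms(3) b M0
    by (intro mult_left_mono power_mono) auto
  also have "\<dots> = exp (- 2 * real n * t\<^sup>2)"
    by (simp add: exp_of_nat_mult[symmetric] exp_add[symmetric] power2_eq_square)
  finally show ?thesis .
qed

lemma concentration:
  assumes a: "a < K" and j: "j \<le> r" and w: "1 \<le> w"
  shows "EB a (256 * 2 ^ r) (4096 * 4 ^ j * w)
    (\<lambda>s. if \<bar>hat r (s div (4096 * 4 ^ j * w)) - mean D a\<bar> \<le> dl j / 16 then 0 else 1) 0 \<le> rho ^ w"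
proof -
  define Q where "Q = (256 * 2 ^ r :: nat)"
  define n where "n = (4096 * 4 ^ j * w :: nat)"
  \<comment> \<open>Of the permitted error \<open>8 / 128 * dl j\<close>, rounding the readings and
    dividing the sum take at most \<open>1 / Q\<close> each, together at most
    \<open>dl j / 128\<close>.\<close>
  define t where "t = 7 / 128 * dl j"
  have Q: "0 < Q" and n: "0 < n" and t: "0 < t" using w dl_pos[of j] by (auto simp: Q_def n_def t_def)
  have Qr: "1 / real Q \<le> dl j / 256" using dl_mono[OF j] by (simp add: Q_def dl_def)
  let ?g = "\<lambda>b s. exp (4 * t * (b * (real s / Q - n * mq a Q) - n * t))"
  \<comment> \<open>Chernoff's argument: for an inaccurate estimate one of the two exponents is
    nonnegative.\<close>
  have "(if \<bar>hat r (s div n) - mean D a\<bar> \<le> dl j / 16 then 0 else 1) \<le> ?g 1 s + ?g (- 1) s" for s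
  proof (rule ccontr)
    assume neg: "\<not> ?thesis"
    have pos: "0 < ?g 1 s" "0 < ?g (- 1) s" by simp_all
    have bad: "\<not> \<bar>hat r (s div n) - mean D a\<bar> \<le> dl j / 16"
    proof
      assume "\<bar>hat r (s div n) - mean D a\<bar> \<le> dl j / 16"
      then show False using neg add_pos_pos[OF pos] by simp
    qed
    then have "\<not> 1 \<le> ?g 1 s + ?g (- 1) s" using neg by simp
    then have lt: "?g 1 s < 1" "?g (- 1) s < 1" using pos by linarith+
    have "1 * (real s / Q - n * mq a Q) - n * t < 0" "- 1 * (real s / Q - n * mq a Q) - n * t < 0"
      using lt t unfolding exp_less_one_iff by (simp_all only: mult_less_0_iff) auto
    then have dev: "\<bar>real s / Q - n * mq a Q\<bar> < n * t" by (auto simp: abs_less_iff)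
    have 1: "real (s div n) \<le> real s / n" by (rule of_nat_div_le_of_nat)
    have "s \<le> n * (s div n) + n"
      using mult_div_mod_eq[of n s] mod_less_divisor[OF n, of s] by linarith
    then have "real s \<le> real n * (real (s div n) + 1)"
      by (simp add: distrib_left flip: of_nat_mult of_nat_add)
    then have 2: "real s / n - 1 \<le> real (s div n)" using n by (simp add: field_simps)
    have h: "hat r (s div n) = real (s div n) / Q" by (simp add: hat_def Q_def)
    have 3: "hat r (s div n) \<le> real s / n / Q" unfolding h using 1 by (rule divide_right_mono) simp
    have "(real s / n - 1) / Q \<le> hat r (s div n)" unfolding h using 2 by (rule divide_right_mono) simp
    then have 4: "real s / n / Q - 1 / Q \<le> hat r (s div n)" by (simp add: diff_divide_distrib)
    have "real s / Q - n * mq a Q = n * (real s / n / Q - mq a Q)"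
      using n by (simp add: field_simps)
    then have "\<bar>real s / n / Q - mq a Q\<bar> = \<bar>real s / Q - n * mq a Q\<bar> / n"
      using n by (simp add: abs_mult)
    also have "\<dots> < t" using dev n by (simp add: pos_divide_less_eq mult.commute)
    finally have "\<bar>hat r (s div n) - mean D a\<bar> \<le> t + 2 / Q"
      using 3 4 mq_bounds[OF a Q] by (auto simp: abs_le_iff abs_less_iff)
    also have "\<dots> \<le> dl j / 16" using Qr by (simp add: t_def)
    finally show False using bad by simp
  qed
  then have "EB a Q n (\<lambda>s. if \<bar>hat r (s div n) - mean D a\<bar> \<le> dl j / 16 then 0 else 1) 0
    \<le> EB a Q n (\<lambda>s. ?g 1 s + ?g (- 1) s) 0" by (rule EB_mono)
  also have "\<dots> \<le> exp (- 2 * real n * t\<^sup>2) + exp (- 2 * real n * t\<^sup>2)"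
    unfolding EB_add by (intro add_mono EB_exp_le a Q t) auto
  also have "- 2 * real n * t\<^sup>2 = - 49 / 2 * real w"
  proof -
    have "(4::real) ^ j * (dl j)\<^sup>2 = 1"
      by (simp add: dl_def power2_eq_square power_mult_distrib[symmetric] field_simps)
    moreover have "- 2 * real n * t\<^sup>2 = - 49 / 2 * real w * (4 ^ j * (dl j)\<^sup>2)"
      by (simp add: n_def t_def power2_eq_square)
    ultimately show ?thesis by simp
  qed
  also have "exp (- 49 / 2 * real w) + exp (- 49 / 2 * real w) \<le> rho ^ w"
  proof -
    have "(2::real) ^ 24 \<le> exp 1 ^ 24" using exp_ge_add_one_self[of 1] by (intro power_mono) auto
    then have e: "2 ^ 24 \<le> exp (24 :: real)" by (simp add: exp_of_nat_mult[symmetric])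
    have "exp (- 49 / 2 * real w) \<le> exp (real w * (- 24))" by simp
    also have "\<dots> = exp (- 24) ^ w" by (rule exp_of_nat_mult)
    \<comment> \<open>The factor 1/2 makes room for the sum of the two tails.\<close>
    also have "\<dots> \<le> (rho / 2) ^ w"
      using e by (intro power_mono) (auto simp: rho_def exp_minus field_simps)
    also have "\<dots> = rho ^ w / 2 ^ w" by (simp add: power_divide)
    also have "\<dots> \<le> rho ^ w / 2"
      using w rho_pos power_increasing[of 1 w "2::real"] by (intro divide_left_mono) auto
    finally show ?thesis by simp
  qed
  finally show ?thesis by (simp add: Q_def n_def)
qed

definition EE :: "nat \<Rightarrow> nat \<Rightarrow> nat \<Rightarrow> nat \<Rightarrow> (nat \<Rightarrow> real) \<Rightarrow> real" where
  "EE a r j w f = EB a (256 * 2 ^ r) (4096 * 4 ^ j * w) (\<lambda>s. f (s div (4096 * 4 ^ j * w))) 0"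

lemma EE_rule:
  assumes "a < K" "j \<le> r" "1 \<le> w" "0 \<le> d"
    and "\<And>e. \<bar>hat r e - mean D a\<bar> \<le> dl j / 16 \<Longrightarrow> f e \<le> c" and "\<And>e. f e \<le> c + d"
  shows "EE a r j w f \<le> c + rho ^ w * d"
proof -
  let ?n = "4096 * 4 ^ j * w"
  let ?g = "\<lambda>s. if \<bar>hat r (s div ?n) - mean D a\<bar> \<le> dl j / 16 then 0 else (1::real)"
  have "EE a r j w f \<le> EB a (256 * 2 ^ r) ?n (\<lambda>s. c + d * ?g s) 0"
    unfolding EE_def by (rule EB_mono) (use assms(5,6) in auto)
  also have "\<dots> = c + d * EB a (256 * 2 ^ r) ?n ?g 0"
    by (simp add: EB_add EB_cmult EB_const assms(1))
  also have "\<dots> \<le> c + d * rho ^ w"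
    using concentration[OF assms(1-3)] assms(4) by (intro add_left_mono mult_left_mono)
  finally show ?thesis by (simp add: mult.commute)
qed

end

section \<open>Expected numbers of pulls as functions of the state\<close>

context bandit
begin

text \<open>The expected number of pulls of \<open>q\<close> in the next \<open>T\<close> steps, by
  recursion over states. It involves no sample space; \<open>pulls_ec\<close> connects it with the
  random run.\<close>

fun ec :: "(st \<Rightarrow> nat \<Rightarrow> nat \<Rightarrow> st) \<Rightarrow> nat \<Rightarrow> nat \<Rightarrow> st \<Rightarrow> real" where
  "ec nx q 0 s = 0"
| "ec nx q (Suc T) s = (if arm s = q then 1 else 0)
     + ev (arm s) (prec s) (\<lambda>y. av (lm s) (\<lambda>v. ec nx q T (nx s y v)))"

definition ok :: "st \<Rightarrow> bool" where
  "ok s \<longleftrightarrow> arm s < K \<and> cnd s < K \<and> 0 < lm s"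

lemmas defs = setlen_def reset_def adv_def next_arm_def bend_def kstep_def start_epoch_def nxt_def

lemma ok_kstep: "ok s \<Longrightarrow> ok (kstep K s y v)"
  using K by (simp add: ok_def defs Let_def)

lemma ok_nxt: "ok s \<Longrightarrow> ok (nxt K s y v)"
  using K by (simp add: ok_def defs Let_def)

lemma ec_nonneg: "0 \<le> ec nx q T s"
proof (induction T arbitrary: s)
  case (Suc T)
  then show ?case unfolding ec.simps ev_def av_def
    by (intro add_nonneg_nonneg sum_nonneg mult_nonneg_nonneg divide_nonneg_nonneg pr_nonneg) auto
qed simp

lemma ev_av_const: "ok s \<Longrightarrow> ev (arm s) (prec s) (\<lambda>y. av (lm s) (\<lambda>v. c)) = c"
  by (simp add: ok_def av_const ev_const)

lemma ec_le:
  assumes "ok s" and nx: "\<And>s y v. ok s \<Longrightarrow> ok (nx s y v)"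
  shows "ec nx q T s \<le> T"
  using assms(1)
proof (induction T arbitrary: s)
  case (Suc T)
  have "ev (arm s) (prec s) (\<lambda>y. av (lm s) (\<lambda>v. ec nx q T (nx s y v)))
    \<le> ev (arm s) (prec s) (\<lambda>y. av (lm s) (\<lambda>v. real T))"
    by (intro ev_mono av_mono Suc nx)
  moreover have "(if arm s = q then 1 else 0) \<le> (1::real)" by simp
  ultimately show ?case unfolding ec.simps ev_av_const[OF Suc.prems] of_nat_Suc by linarith
qed simp

lemma ec_Suc: "ec nx q T s \<le> ec nx q (Suc T) s"
proof (induction T arbitrary: s)
  case 0
  show ?case using ec_nonneg[of nx q "Suc 0" s] by simp
next
  case (Suc T)
  show ?case by (subst (1 2) ec.simps) (intro add_left_mono ev_mono av_mono Suc)
qed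

lemma kstep_more: "1 < cnt s \<Longrightarrow> kstep K s y v = s\<lparr>acc := acc s + y, cnt := cnt s - 1\<rparr>"
  by (simp add: kstep_def)

lemma kstep_last: "cnt s = 1 \<Longrightarrow> kstep K s y v = bend K (s\<lparr>acc := acc s + y, cnt := 1\<rparr>) v"
  by (cases s) (simp add: kstep_def)

text \<open>Contracts a whole test into one expectation. The horizon after the test is relaxed to
  the full \<open>T\<close>, which is sound as \<open>ec\<close> grows with \<open>T\<close>; thus
  the costs in the locale \<open>analysis\<close> need not depend on the elapsed time.\<close>

lemma ec_block:
  assumes "cnt s = Suc n" "ok s"
  shows "ec (kstep K) q T s \<le> (if arm s = q then real (Suc n) else 0) +
    EB (arm s) (prec s) (Suc n) (\<lambda>S. av (lm s) (\<lambda>v. ec (kstep K) q T (bend K (s\<lparr>acc := S, cnt := 1\<rparr>) v))) (acc s)"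
  using assms
proof (induction n arbitrary: s T)
  case 0
  show ?case
  proof (cases T)
    case 0
    then show ?thesis by (simp add: ev_def av_def)
  next
    case (Suc T')
    have "ec (kstep K) q T s = (if arm s = q then 1 else 0) + ev (arm s) (prec s) (\<lambda>y. av (lm s)
       (\<lambda>v. ec (kstep K) q T' (bend K (s\<lparr>acc := acc s + y, cnt := 1\<rparr>) v)))"
      using 0 by (simp add: Suc kstep_last)
    also have "\<dots> \<le> (if arm s = q then 1 else 0) + ev (arm s) (prec s) (\<lambda>y. av (lm s)
       (\<lambda>v. ec (kstep K) q T (bend K (s\<lparr>acc := acc s + y, cnt := 1\<rparr>) v)))"
      unfolding Suc by (intro add_left_mono ev_mono av_mono ec_Suc)
    finally show ?thesis by (simp only: EB.simps of_nat_Suc of_nat_0 add_0_right)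
  qed
next
  case (Suc n)
  let ?R = "\<lambda>T. EB (arm s) (prec s) (Suc n) (\<lambda>S. av (lm s) (\<lambda>v. ec (kstep K) q T (bend K (s\<lparr>acc := S, cnt := 1\<rparr>) v)))"
  show ?case
  proof (cases T)
    case 0
    have z: "EB a Q n (\<lambda>s. 0) x = 0" for a Q n x
      by (induction n arbitrary: x) (auto simp: ev_def)
    show ?thesis using z by (simp add: 0 av_def ev_def del: EB.simps)
  next
    case (Suc T')
    have IH: "ec (kstep K) q T' (s\<lparr>acc := acc s + y, cnt := Suc n\<rparr>)
      \<le> (if arm s = q then real (Suc n) else 0) + ?R T (acc s + y)" for y
    proof -
      let ?s = "s\<lparr>acc := acc s + y, cnt := Suc n\<rparr>"
      have "ok ?s" using Suc.prems(2) by (simp add: ok_def)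
      from Suc.IH[OF _ this, of T'] have "ec (kstep K) q T' ?s
      \<le> (if arm s = q then real (Suc n) else 0) + ?R T' (acc s + y)" by simp
      moreover have "?R T' (acc s + y) \<le> ?R T (acc s + y)"
        unfolding Suc by (intro EB_mono av_mono ec_Suc)
      ultimately show ?thesis by linarith
    qed
    have "ec (kstep K) q T s = (if arm s = q then 1 else 0) + ev (arm s) (prec s) (\<lambda>y. av (lm s)
       (\<lambda>v. ec (kstep K) q T' (s\<lparr>acc := acc s + y, cnt := Suc n\<rparr>)))"
      using Suc.prems by (simp add: Suc kstep_more)
    also have "\<dots> \<le> (if arm s = q then 1 else 0) + ev (arm s) (prec s) (\<lambda>y. av (lm s)
       (\<lambda>v. (if arm s = q then real (Suc n) else 0) + ?R T (acc s + y)))"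
      by (intro add_left_mono ev_mono av_mono IH)
    also have "\<dots> = (if arm s = q then 1 else 0) + ev (arm s) (prec s) (\<lambda>y.
       (if arm s = q then real (Suc n) else 0) + ?R T (acc s + y))"
      using Suc.prems(2) by (simp add: av_const ok_def)
    also have "\<dots> = (if arm s = q then 1 else 0) + ((if arm s = q then real (Suc n) else 0)
       + ev (arm s) (prec s) (\<lambda>y. ?R T (acc s + y)))"
      using Suc.prems(2) by (subst ev_add) (simp add: ev_const ok_def)
    finally show ?thesis by (auto simp del: EB.simps(2)[of _ _ "n"])
  qed
qed

lemma ec_long:
  assumes "T \<le> cnt s" "ok s"
  shows "ec (kstep K) q T s \<le> (if arm s = q then real T else 0)"
  using assms
proof (induction T arbitrary: s)
  case (Suc T)
  show ?case
  proof (cases T)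
    case 0
    then show ?thesis using ev_av_const[OF Suc.prems(2), of 0] by simp
  next
    case (Suc T')
    have "ec (kstep K) q T (kstep K s y v) \<le> (if arm s = q then real T else 0)" for y v
    proof -
      have "1 < cnt s" using Suc Suc.prems by simp
      then show ?thesis
        using Suc.IH[of "s\<lparr>acc := acc s + y, cnt := cnt s - 1\<rparr>"] Suc.prems by (simp add: kstep_more ok_def)
    qed
    then have "ev (arm s) (prec s) (\<lambda>y. av (lm s) (\<lambda>v. ec (kstep K) q T (kstep K s y v)))
      \<le> ev (arm s) (prec s) (\<lambda>y. av (lm s) (\<lambda>v. (if arm s = q then real T else 0)))"
      by (intro ev_mono av_mono)
    then show ?thesis using ev_av_const[OF Suc.prems(2)] by auto
  qed
qed simp

text \<open>The states at the beginning of a test. Only \<open>lm\<close>, \<open>tau\<close> and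
  \<open>hor\<close> are inherited from \<open>z\<close>.\<close>

definition Lst :: "st \<Rightarrow> nat \<Rightarrow> nat \<Rightarrow> nat \<Rightarrow> st" where
  "Lst z r l g = z\<lparr>md := 1, arm := l, cnt := 4096 * 4 ^ r * lm z, len := 4096 * 4 ^ r * lm z, acc := 0,
     lev := 0, gl := g, prec := 256 * 2 ^ r, bm := 0, cnd := l, cbst := 0, bj := 4096, thr := 128 * 2 ^ r\<rparr>"

definition Cst :: "st \<Rightarrow> nat \<Rightarrow> nat \<Rightarrow> nat \<Rightarrow> nat \<Rightarrow> nat \<Rightarrow> nat \<Rightarrow> nat \<Rightarrow> st" where
  "Cst z r i j g b c cb = z\<lparr>md := 2, arm := i, cnt := 4096 * 4 ^ j * wt g j, len := 4096 * 4 ^ j * wt g j,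
     acc := 0, lev := j, gl := g, prec := 256 * 2 ^ r, bm := b, cnd := c, cbst := cb,
     bj := 4096 * 4 ^ j, thr := 128 * 2 ^ (r - j)\<rparr>"

definition Vst :: "st \<Rightarrow> nat \<Rightarrow> nat \<Rightarrow> nat \<Rightarrow> nat \<Rightarrow> nat \<Rightarrow> nat \<Rightarrow> nat \<Rightarrow> st" where
  "Vst z r i j g b c cb = z\<lparr>md := 3, arm := i, cnt := 4096 * 4 ^ j * lm z, len := 4096 * 4 ^ j * lm z,
     acc := 0, lev := j, gl := g, prec := 256 * 2 ^ r, bm := b, cnd := c, cbst := cb,
     bj := 4096 * 4 ^ j, thr := 128 * 2 ^ (r - j)\<rparr>"

definition Xst :: "st \<Rightarrow> nat \<Rightarrow> nat \<Rightarrow> nat \<Rightarrow> nat \<Rightarrow> nat \<Rightarrow> nat \<Rightarrow> st" where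
  "Xst z r i g b c cb = (if Suc i < K then Cst z r (Suc i) 0 g b c cb else Lst z (Suc r) c g)"

lemma start_epoch: "start_epoch s = Lst (s\<lparr>tau := hor s\<rparr>) 0 0 0"
  by (simp add: start_epoch_def reset_def setlen_def Lst_def Let_def)

lemma prec_sq: "256 * 2 ^ r * (256 * 2 ^ r) div 16 = (4096 * 4 ^ r :: nat)"
proof -
  have "256 * 2 ^ r * (256 * 2 ^ r) = 16 * (4096 * 4 ^ r :: nat)"
    by (simp add: power_mult_distrib[symmetric])
  then show ?thesis by simp
qed

lemma next_arm_eq:
  "prec s = 256 * 2 ^ r \<Longrightarrow> next_arm K s = Xst s r (arm s) (gl s) (bm s) (cnd s) (cbst s)"
  using prec_sq[of "Suc r"]
  by (simp add: next_arm_def Xst_def reset_def setlen_def Cst_def Lst_def Let_def)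

lemma Xst_update:
  "Xst (z\<lparr>md := x\<rparr>) = Xst z" "Xst (z\<lparr>arm := x\<rparr>) = Xst z" "Xst (z\<lparr>cnt := x\<rparr>) = Xst z"
  "Xst (z\<lparr>len := x\<rparr>) = Xst z" "Xst (z\<lparr>acc := x\<rparr>) = Xst z" "Xst (z\<lparr>lev := x\<rparr>) = Xst z"
  "Xst (z\<lparr>gl := x\<rparr>) = Xst z" "Xst (z\<lparr>prec := x\<rparr>) = Xst z" "Xst (z\<lparr>bm := x\<rparr>) = Xst z"
  "Xst (z\<lparr>cnd := x\<rparr>) = Xst z" "Xst (z\<lparr>cbst := x\<rparr>) = Xst z" "Xst (z\<lparr>bj := x\<rparr>) = Xst z"
  "Xst (z\<lparr>thr := x\<rparr>) = Xst z"
  by (simp_all add: fun_eq_iff Xst_def Cst_def Lst_def)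

lemma bend_L: "bend K (Lst z r l g\<lparr>acc := S, cnt := 1\<rparr>) v =
   Cst z r 0 0 g (S div (4096 * 4 ^ r * lm z)) l (S div (4096 * 4 ^ r * lm z))"
  by (simp add: bend_def Lst_def Cst_def reset_def setlen_def Let_def)

lemma thr_half: "j < r \<Longrightarrow> 128 * 2 ^ (r - j) div 2 = (128 * 2 ^ (r - Suc j) :: nat)"
proof -
  assume "j < r"
  then have "r - j = Suc (r - Suc j)" by simp
  then show ?thesis by simp
qed

lemma thr_less: "j \<le> r \<Longrightarrow> 128 < 128 * (2::nat) ^ (r - j) \<longleftrightarrow> j < r"
  using one_less_power[of "2::nat" "r - j"] by (cases "j < r") auto

lemma bend_C:
  assumes "j \<le> r"
  shows "bend K (Cst z r i j g b c cb\<lparr>acc := S, cnt := 1\<rparr>) v =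
   (if killed r j b (S div (4096 * 4 ^ j * wt g j)) then Xst z r i g b c cb
    else if j < r then (if v < Suc j - g then Vst z r i 0 g b c cb else Cst z r i (Suc j) g b c cb)
    else Vst z r i 0 g b c cb)"
  using assms thr_half[of j r] thr_less[OF assms]
  by (simp add: bend_def Cst_def killed_def next_arm_eq Xst_update adv_def Vst_def reset_def setlen_def Let_def)

lemma bend_V:
  assumes "j \<le> r"
  shows "bend K (Vst z r i j g b c cb\<lparr>acc := S, cnt := 1\<rparr>) v =
   (let e = S div (4096 * 4 ^ j * lm z) in
    if killed r j b e then Xst z r i (max g j) b c cb
    else if j < r then Vst z r i (Suc j) g b c cb
    else if cb < e then Xst z r i g b i e else Xst z r i g b c cb)"
  using assms thr_half[of j r] thr_less[OF assms]
  by (simp add: bend_def killed_def next_arm_eq Xst_update adv_def Vst_def reset_def setlen_def Let_def)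

lemma EE_nonneg:
  assumes "a < K" "\<And>e. 0 \<le> f e"
  shows "0 \<le> EE a r j w f"
proof -
  have "EB a (256 * 2 ^ r) (4096 * 4 ^ j * w) (\<lambda>s. 0) 0 \<le> EE a r j w f"
    unfolding EE_def by (rule EB_mono) (rule assms(2))
  then show ?thesis by (simp add: EB_const assms(1))
qed

lemma block_EE:
  assumes ok: "ok s" and "cnt s = 4096 * 4 ^ j * w" "1 \<le> w" "acc s = 0" "prec s = 256 * 2 ^ r"
    and f: "\<And>S. av (lm s) (\<lambda>v. ec (kstep K) q T (bend K (s\<lparr>acc := S, cnt := 1\<rparr>) v)) = f (S div (4096 * 4 ^ j * w))"
  shows "ec (kstep K) q T s \<le> (if arm s = q then c0 * 4 ^ j * w else 0) + EE (arm s) r j w f"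
proof -
  have pos: "0 < 4096 * 4 ^ j * w" using assms(3) by simp
  then obtain n where n: "4096 * 4 ^ j * w = Suc n" using gr0_implies_Suc by blast
  have real_n: "c0 * 4 ^ j * real w = real (Suc n)" unfolding n[symmetric] by (simp add: c0_def)
  show ?thesis
    unfolding real_n EE_def n using ec_block[OF assms(2)[unfolded n] ok, of q T] assms(4,5) f n by simp
qed

text \<open>The value 0 outside the valid arms is needed because the inequalities of
  \<open>analysis\<close> range over arbitrary candidates.\<close>

definition fC' where
  "fC' q T z r i j g (l::nat) b c cb = (if i < K \<and> c < K then ec (kstep K) q T (Cst z r i j g b c cb) else 0)"

definition fV' where
  "fV' q T z r i j g (l::nat) b c cb = (if i < K \<and> c < K then ec (kstep K) q T (Vst z r i j g b c cb) else 0)"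

definition fL' where
  "fL' q T z r l g = (if l < K then ec (kstep K) q T (Lst z r l g) else 0)"

definition fX' where
  "fX' q T z r i g (l::nat) b c cb = (if Suc i < K then fC' q T z r (Suc i) 0 g l b c cb else fL' q T z (Suc r) c g)"

lemma fX': "i < K \<Longrightarrow> c < K \<Longrightarrow> fX' q T z r i g l b c cb = ec (kstep K) q T (Xst z r i g b c cb)"
  by (simp add: fX'_def fC'_def fL'_def Xst_def)

lemma f'_nonneg: "0 \<le> fC' q T z r i j g l b c cb" "0 \<le> fV' q T z r i j g l b c cb" "0 \<le> fL' q T z r l g"
  "0 \<le> fX' q T z r i g l b c cb"
  by (simp_all add: fC'_def fV'_def fL'_def fX'_def ec_nonneg)

lemma epoch_cost:
  assumes q: "q < K" "istar < K" and star: "\<And>i. i < K \<Longrightarrow> mean D i \<le> mean D istar"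
    and m: "dl m \<le> mean D istar - mean D q" "mean D istar - mean D q < 2 * dl m"
    and m0: "\<And>i. i < K \<Longrightarrow> mean D i < mean D istar \<Longrightarrow> dl m0 \<le> mean D istar - mean D i" and mm0: "m \<le> m0"
    and L: "1 \<le> lm z" "K \<le> 16 ^ lm z" and T: "T \<le> 16 ^ lm z"
  shows "ec (kstep K) q T (Lst z 0 0 0) \<le> 30000 * c0 * lm z * 4 ^ m * (1 + real (m0 - m)) + 1"
proof -
  define eps :: real where "eps = rho ^ lm z * 16 ^ lm z"
  have Tr: "real T \<le> 16 ^ lm z" using T by (metis of_nat_le_iff of_nat_numeral of_nat_power)
  have okC: "i < K \<Longrightarrow> c < K \<Longrightarrow> ok (Cst z r i j g b c cb)" for r i j g b c cb
    using L by (simp add: ok_def Cst_def)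
  have okV: "i < K \<Longrightarrow> c < K \<Longrightarrow> ok (Vst z r i j g b c cb)" for r i j g b c cb
    using L by (simp add: ok_def Vst_def)
  have okL: "l < K \<Longrightarrow> ok (Lst z r l g)" for r l g
    using L by (simp add: ok_def Lst_def)
  have le: "ok s \<Longrightarrow> ec (kstep K) q T s \<le> 16 ^ lm z" for s
    using ec_le[where nx = "kstep K" and s = s and q = q and T = T, OF _ ok_kstep] Tr by linarith
  interpret an: analysis K "lm z" eps "mean D" EE q istar m m0 "fL' q T z" "fC' q T z" "fV' q T z" "fX' q T z"
  proof unfold_locales
    show "1 \<le> lm z" "q < K" "istar < K" "m \<le> m0" by fact+
    show "0 \<le> eps" using rho_pos by (simp add: eps_def)
    show "EE a r j w f \<le> c + rho ^ w * d" if "a < K" "j \<le> r" "1 \<le> w" "0 \<le> d"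
      "\<And>e. \<bar>hat r e - mean D a\<bar> \<le> dl j / 16 \<Longrightarrow> f e \<le> c" "\<And>e. f e \<le> c + d" for a r j w f c d
      by (rule EE_rule) fact+
    show "EE a r j (lm z) f \<le> c + eps" if "a < K" "j \<le> r" "0 \<le> c"
      "\<And>e. \<bar>hat r e - mean D a\<bar> \<le> dl j / 16 \<Longrightarrow> f e \<le> c" "\<And>e. f e \<le> 16 ^ lm z" for a r j f c
      unfolding eps_def
    proof (rule EE_rule)
      show "f e \<le> c + 16 ^ lm z" for e using that(3) that(5)[of e] by linarith
    qed (use that L in auto)
    show "fL' q T z r l g \<le> 16 ^ lm z" for r l g using le[OF okL] by (simp add: fL'_def)
    show "fC' q T z r i j g l b c cb \<le> 16 ^ lm z" for r i j g l b c cb using le[OF okC] by (simp add: fC'_def)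
    show "fV' q T z r i j g l b c cb \<le> 16 ^ lm z" for r i j g l b c cb using le[OF okV] by (simp add: fV'_def)
    show "fX' q T z r i g l b cand cb = (if Suc i < K then fC' q T z r (Suc i) 0 g l b cand cb else fL' q T z (Suc r) cand g)"
      for r i g l b cand cb by (simp add: fX'_def)
    show "fL' q T z (2 * lm z) l g \<le> (if l = q then 16 ^ lm z else 0)" if "l < K" for l g
    proof -
      \<comment> \<open>In pass \<open>2 * lm z\<close> the estimate of the leader alone takes at
        least \<open>16 ^ lm z\<close> pulls, so the horizon ends before another arm is
        tested.\<close>
      have "T \<le> 4 ^ (2 * lm z) * 1" using T by (simp add: power_mult)
      also have "\<dots> \<le> 4 ^ (2 * lm z) * (4096 * lm z)" using L by (intro mult_left_mono) auto
      finally have "T \<le> cnt (Lst z (2 * lm z) l g)" by (simp add: Lst_def mult_ac)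
      from ec_long[OF this okL[OF that], of q] have "ec (kstep K) q T (Lst z (2 * lm z) l g) \<le> (if l = q then real T else 0)"
        by (simp add: Lst_def)
      then show ?thesis using le[OF okL[OF that]] that by (auto simp: fL'_def)
    qed
    show "fL' q T z r l g \<le> (if l = q then c0 * 4 ^ r * real (lm z) else 0) + EE l r r (lm z) (\<lambda>e. fC' q T z r 0 0 g l e l e)"
      if "l < K" for r l g
    proof -
      have lm: "lm (Lst z r l g) = lm z" "arm (Lst z r l g) = l" by (simp_all add: Lst_def)
      have "ec (kstep K) q T (Lst z r l g) \<le> (if arm (Lst z r l g) = q then c0 * 4 ^ r * real (lm z) else 0)
        + EE (arm (Lst z r l g)) r r (lm z) (\<lambda>e. fC' q T z r 0 0 g l e l e)"
        by (rule block_EE[OF okL[OF that]])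
          (use L K that in \<open>simp_all only: bend_L lm fC'_def\<close>, simp_all add: Lst_def av_const)
      then show ?thesis using that by (simp add: fL'_def lm)
    qed
    show "fC' q T z r i j g l b cand cb \<le> (if i = q then c0 * 4 ^ j * real (wt g j) else 0)
      + EE i r j (wt g j) (\<lambda>e. if killed r j b e then fX' q T z r i g l b cand cb
          else if j < r then min 1 (real (Suc j - g) / real (lm z)) * fV' q T z r i 0 g l b cand cb
            + (1 - min 1 (real (Suc j - g) / real (lm z))) * fC' q T z r i (Suc j) g l b cand cb
          else fV' q T z r i 0 g l b cand cb)" (is "_ \<le> _ + EE i r j (wt g j) ?f")
      if "i < K" "j \<le> r" for r i j g l b cand cb
    proof (cases "cand < K")
      case True
      have lm: "lm (Cst z r i j g b cand cb) = lm z" "arm (Cst z r i j g b cand cb) = i" by (simp_all add: Cst_def)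
      have "ec (kstep K) q T (Cst z r i j g b cand cb) \<le> (if arm (Cst z r i j g b cand cb) = q then c0 * 4 ^ j * real (wt g j) else 0)
        + EE (arm (Cst z r i j g b cand cb)) r j (wt g j) ?f"
      proof (rule block_EE[OF okC[OF that(1) True]])
        fix S
        let ?e = "S div (4096 * 4 ^ j * wt g j)"
        have "av (lm z) (\<lambda>v. ec (kstep K) q T (bend K (Cst z r i j g b cand cb\<lparr>acc := S, cnt := 1\<rparr>) v)) =
          (if killed r j b ?e then av (lm z) (\<lambda>v. ec (kstep K) q T (Xst z r i g b cand cb))
           else if j < r then av (lm z) (\<lambda>v. if v < Suc j - g then ec (kstep K) q T (Vst z r i 0 g b cand cb)
              else ec (kstep K) q T (Cst z r i (Suc j) g b cand cb))
           else av (lm z) (\<lambda>v. ec (kstep K) q T (Vst z r i 0 g b cand cb)))"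
          unfolding bend_C[OF that(2)] by (simp add: if_distrib[of "ec (kstep K) q T"])
        also have "\<dots> = ?f ?e"
          using L that True by (simp add: av_const av_if fX' fC'_def fV'_def)
        finally show "av (lm (Cst z r i j g b cand cb)) (\<lambda>v. ec (kstep K) q T (bend K (Cst z r i j g b cand cb\<lparr>acc := S, cnt := 1\<rparr>) v))
          = ?f ?e" unfolding lm .
      qed (simp_all add: Cst_def wt_def)
      then show ?thesis using True that by (simp only: fC'_def lm simp_thms if_True)
    next
      case False
      have "0 \<le> EE i r j (wt g j) ?f"
        by (rule EE_nonneg[OF that(1)]) (use L in \<open>simp add: f'_nonneg\<close>)
      then show ?thesis using False by (simp add: fC'_def c0_def)
    qed
    show "fV' q T z r i j g l b cand cb \<le> (if i = q then c0 * 4 ^ j * real (lm z) else 0)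
      + EE i r j (lm z) (\<lambda>e. if killed r j b e then fX' q T z r i (max g j) l b cand cb
          else if j < r then fV' q T z r i (Suc j) g l b cand cb
          else if cb < e then fX' q T z r i g l b i e else fX' q T z r i g l b cand cb)" (is "_ \<le> _ + EE i r j (lm z) ?f")
      if "i < K" "j \<le> r" for r i j g l b cand cb
    proof (cases "cand < K")
      case True
      have lm: "lm (Vst z r i j g b cand cb) = lm z" "arm (Vst z r i j g b cand cb) = i" by (simp_all add: Vst_def)
      have "ec (kstep K) q T (Vst z r i j g b cand cb) \<le> (if arm (Vst z r i j g b cand cb) = q then c0 * 4 ^ j * real (lm z) else 0)
        + EE (arm (Vst z r i j g b cand cb)) r j (lm z) ?f"
      proof (rule block_EE[OF okV[OF that(1) True]])
        fix S
        let ?e = "S div (4096 * 4 ^ j * lm z)"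
        show "av (lm (Vst z r i j g b cand cb)) (\<lambda>v. ec (kstep K) q T (bend K (Vst z r i j g b cand cb\<lparr>acc := S, cnt := 1\<rparr>) v))
          = ?f ?e" unfolding lm bend_V[OF that(2)] Let_def
          using L that True by (simp add: av_const fX' fV'_def)
      qed (use L in \<open>simp_all add: Vst_def\<close>)
      then show ?thesis using True that by (simp only: fV'_def lm simp_thms if_True)
    next
      case False
      have "0 \<le> EE i r j (lm z) ?f"
        by (rule EE_nonneg[OF that(1)]) (simp add: f'_nonneg)
      then show ?thesis using False by (simp add: fV'_def c0_def)
    qed
  qed (use star m m0 in auto)
  have xi_eq: "an.xi = (real K + 1) * (2 * real (lm z) + 1) * eps" by (simp add: an.xi_def)
  have "2 * real (lm z) * an.xi \<le> 1"
  proof -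
    \<comment> \<open>In powers of \<open>P\<close>: \<open>K + 1\<close> is at most
      \<open>2 * P ^ 4\<close>, \<open>lm z\<close> is at most \<open>P\<close>, and
      \<open>eps\<close> is \<open>1 / P ^ 16\<close>; the product is at most
      \<open>12 / P ^ 10\<close>.\<close>
    define P :: real where "P = 2 ^ lm z"
    have P1: "1 \<le> P" by (simp add: P_def)
    have LP: "real (lm z) \<le> P" unfolding P_def using of_nat_less_two_power[of "lm z"] by (simp add: less_imp_le)
    have "real K \<le> 16 ^ lm z" using L(2) by (metis of_nat_le_iff of_nat_numeral of_nat_power)
    also have "(16::real) ^ lm z = P ^ 4" unfolding P_def power_mult[symmetric] by (subst mult.commute) (simp add: power_mult)
    finally have KP: "real K + 1 \<le> 2 * P ^ 4" using one_le_power[OF P1, of 4] by linarith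
    have r20: "rho ^ lm z = 1 / P ^ 20"
      unfolding rho_def P_def power_mult[symmetric] power_divide by (subst (2) mult.commute) (simp add: power_mult)
    have e: "eps = 1 / P ^ 16"
    proof -
      have "(16::real) ^ lm z = P ^ 4" unfolding P_def power_mult[symmetric] by (subst mult.commute) (simp add: power_mult)
      then show ?thesis unfolding eps_def r20 using P1 by (simp add: field_simps flip: power_add)
    qed
    have "2 * real (lm z) * an.xi = 2 * real (lm z) * ((real K + 1) * (2 * real (lm z) + 1)) / P ^ 16"
      by (subst xi_eq) (simp add: e)
    also have "\<dots> \<le> 2 * P * ((2 * P ^ 4) * (2 * P + P)) / P ^ 16"
      using LP KP P1 by (intro divide_right_mono mult_mono add_mono) auto
    also have "\<dots> = 12 * P ^ 6 / P ^ 16" by (simp add: algebra_simps power_Suc numeral_eq_Suc)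
    also have "\<dots> = 12 / P ^ 10" using P1 by (simp add: field_simps flip: power_add)
    also have "\<dots> \<le> 1"
    proof -
      have "2 \<le> P" using power_increasing[OF L(1), of "2::real"] by (simp add: P_def)
      then have "2 ^ 10 \<le> P ^ 10" by (intro power_mono) auto
      then show ?thesis using P1 by (simp add: field_simps)
    qed
    finally show ?thesis .
  qed
  moreover have "fL' q T z 0 0 0 \<le> 30000 * c0 * real (lm z) * 4 ^ m * (1 + real (m0 - m)) + 2 * real (lm z) * an.xi"
    by (rule an.epoch_bound[OF K])
  ultimately show ?thesis using K by (simp add: fL'_def)
qed

end

definition s0 :: st where
  "s0 = \<lparr>md = 0, arm = 0, cnt = 0, len = 0, acc = 0, lev = 0, gl = 0, prec = 0, bm = 0, cnd = 0,
     cbst = 0, bj = 0, thr = 0, lm = 1, tau = 0, hor = 16\<rparr>"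

context bandit
begin

subsection \<open>Restarts\<close>

lemma setlen_tau: "setlen (s\<lparr>tau := x\<rparr>) = setlen s\<lparr>tau := x\<rparr>"
  by (simp add: setlen_def Let_def)

lemma reset_tau: "reset (s\<lparr>tau := x\<rparr>) = reset s\<lparr>tau := x\<rparr>"
  using setlen_tau[of x "s\<lparr>lev := 0, bj := 4096, thr := prec s div 2\<rparr>"] by (cases s) (simp add: reset_def)

lemma adv_tau: "adv (s\<lparr>tau := x\<rparr>) = adv s\<lparr>tau := x\<rparr>"
  using setlen_tau[of x "s\<lparr>lev := Suc (lev s), bj := 4 * bj s, thr := thr s div 2\<rparr>"] by (cases s) (simp add: adv_def)

lemma next_arm_tau: "next_arm K (s\<lparr>tau := x\<rparr>) = next_arm K s\<lparr>tau := x\<rparr>"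
  using reset_tau[of x "s\<lparr>md := 2, arm := Suc (arm s)\<rparr>"]
    reset_tau[of x "s\<lparr>md := 1, arm := cnd s, prec := 2 * prec s, bm := 0, cbst := 0\<rparr>"]
  by (cases s) (simp add: next_arm_def)

lemma bend_tau: "bend K (s\<lparr>tau := x\<rparr>) v = bend K s v\<lparr>tau := x\<rparr>"
proof -
  have 1: "next_arm K (s\<lparr>tau := x, gl := g\<rparr>) = next_arm K (s\<lparr>gl := g\<rparr>)\<lparr>tau := x\<rparr>" for g
    using next_arm_tau[of x "s\<lparr>gl := g\<rparr>"] by (cases s) simp
  have 2: "next_arm K (s\<lparr>tau := x, cnd := c, cbst := e\<rparr>) = next_arm K (s\<lparr>cnd := c, cbst := e\<rparr>)\<lparr>tau := x\<rparr>" for c e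
    using next_arm_tau[of x "s\<lparr>cnd := c, cbst := e\<rparr>"] by (cases s) simp
  have 3: "reset (s\<lparr>tau := x, md := d\<rparr>) = reset (s\<lparr>md := d\<rparr>)\<lparr>tau := x\<rparr>" for d
    using reset_tau[of x "s\<lparr>md := d\<rparr>"] by (cases s) simp
  have 4: "reset (s\<lparr>tau := x, md := 2, arm := 0, bm := e, cnd := c, cbst := e\<rparr>)
    = reset (s\<lparr>md := 2, arm := 0, bm := e, cnd := c, cbst := e\<rparr>)\<lparr>tau := x\<rparr>" for c e
    using reset_tau[of x "s\<lparr>md := 2, arm := 0, bm := e, cnd := c, cbst := e\<rparr>"] by (cases s) simp
  show ?thesis
    by (cases "md s = 1"; cases "md s = 2"; cases "acc s div len s + thr s < bm s"; cases "128 < thr s";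
        cases "v < Suc (lev s) - gl s"; cases "cbst s < acc s div len s")
      (simp_all add: bend_def Let_def 1 2 3 4 next_arm_tau adv_tau)
qed

lemma kstep_tau: "kstep K (s\<lparr>tau := x\<rparr>) y v = kstep K s y v\<lparr>tau := x\<rparr>"
  using bend_tau[of x "s\<lparr>acc := acc s + y\<rparr>" v] by (cases s) (simp add: kstep_def Let_def)

lemma next_arm_fields: "lm (next_arm K s) = lm s" "hor (next_arm K s) = hor s" "tau (next_arm K s) = tau s"
    "0 < md (next_arm K s)"
  by (simp_all add: next_arm_def reset_def setlen_def Let_def)

lemma adv_fields: "lm (adv s) = lm s" "hor (adv s) = hor s" "tau (adv s) = tau s" "md (adv s) = md s"
  by (simp_all add: adv_def setlen_def Let_def)

lemma reset_fields: "lm (reset s) = lm s" "hor (reset s) = hor s" "tau (reset s) = tau s" "md (reset s) = md s"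
  by (simp_all add: reset_def setlen_def Let_def)

lemma bend_fields: "lm (bend K s v) = lm s" "hor (bend K s v) = hor s" "tau (bend K s v) = tau s"
  "0 < md s \<Longrightarrow> 0 < md (bend K s v)"
  by (simp_all add: bend_def Let_def next_arm_fields adv_fields reset_fields)

lemma kstep_fields: "lm (kstep K s y v) = lm s" "hor (kstep K s y v) = hor s" "tau (kstep K s y v) = tau s"
  "0 < md s \<Longrightarrow> 0 < md (kstep K s y v)"
  by (simp_all add: kstep_def Let_def bend_fields)

text \<open>Within an epoch the countdown is never read, so its cost can be analysed as that of a
  run without restarts.\<close>

lemma ec_tau: "ec (kstep K) q T (s\<lparr>tau := x\<rparr>) = ec (kstep K) q T s"
  by (induction T arbitrary: s) (simp_all add: kstep_tau)

text \<open>The zeros are placeholders, overwritten by \<open>Lst\<close>.\<close>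

definition E0 :: "nat \<Rightarrow> nat \<Rightarrow> st" where
  "E0 L H = Lst \<lparr>md = 0, arm = 0, cnt = 0, len = 0, acc = 0, lev = 0, gl = 0, prec = 0, bm = 0, cnd = 0,
     cbst = 0, bj = 0, thr = 0, lm = L, tau = H, hor = H\<rparr> 0 0 0"

lemma start_epoch_E0: "start_epoch s = E0 (lm s) (hor s)"
  by (simp add: start_epoch E0_def Lst_def)

lemma nxt_epoch:
  assumes "md s \<noteq> 0"
  shows "1 < tau s \<Longrightarrow> nxt K s y v = kstep K (s\<lparr>tau := tau s - 1\<rparr>) y v"
    and "\<not> 1 < tau s \<Longrightarrow> nxt K s y v = E0 (2 * lm s) (hor s * hor s)"
  using assms by (simp_all add: nxt_def start_epoch_E0)

lemma av_add: "av L (\<lambda>v. f v + g v) = av L f + av L g"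
  by (simp add: av_def sum.distrib add_divide_distrib)

text \<open>The next epoch starts in a state that does not depend on the course of this one, so its
  cost is a constant that leaves the expectation.\<close>

lemma ec_epoch:
  assumes "md s \<noteq> 0" "1 \<le> tau s" "ok s"
  shows "ec (nxt K) q T s = ec (kstep K) q (min T (tau s)) s
    + ec (nxt K) q (T - tau s) (E0 (2 * lm s) (hor s * hor s))"
  using assms
proof (induction T arbitrary: s)
  case (Suc T)
  let ?E = "E0 (2 * lm s) (hor s * hor s)"
  show ?case
  proof (cases "1 < tau s")
    case True
    let ?s = "s\<lparr>tau := tau s - 1\<rparr>"
    let ?c = "ec (nxt K) q (Suc T - tau s) ?E"
    have "ec (nxt K) q T (nxt K s y v) = ec (kstep K) q (min T (tau s - 1)) (kstep K s y v) + ?c" for y v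
    proof -
      have "ok (kstep K ?s y v)" by (rule ok_kstep) (use Suc.prems in \<open>simp add: ok_def\<close>)
      moreover have "T - (tau s - 1) = Suc T - tau s" using True by simp
      ultimately show ?thesis
        unfolding nxt_epoch(1)[OF Suc.prems(1) True]
        using Suc.IH[of "kstep K ?s y v"] True Suc.prems by (simp add: kstep_fields kstep_tau ec_tau)
    qed
    then have "ec (nxt K) q (Suc T) s = (if arm s = q then 1 else 0) + ev (arm s) (prec s)
      (\<lambda>y. av (lm s) (\<lambda>v. ec (kstep K) q (min T (tau s - 1)) (kstep K s y v) + ?c))"
      by simp
    also have "\<dots> = (if arm s = q then 1 else 0) + ev (arm s) (prec s)
      (\<lambda>y. av (lm s) (\<lambda>v. ec (kstep K) q (min T (tau s - 1)) (kstep K s y v))) + ?c"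
      unfolding av_add ev_add using ev_av_const[OF Suc.prems(3)] by simp
    also have "\<dots> = ec (kstep K) q (Suc (min T (tau s - 1))) s + ?c" by simp
    also have "Suc (min T (tau s - 1)) = min (Suc T) (tau s)" using True by simp
    finally show ?thesis .
  next
    case False
    then have "tau s = 1" using Suc.prems by simp
    moreover have "ec (nxt K) q T (nxt K s y v) = ec (nxt K) q T ?E" for y v
      unfolding nxt_epoch(2)[OF Suc.prems(1) False] ..
    ultimately show ?thesis
      using ev_av_const[OF Suc.prems(3), of "ec (nxt K) q T ?E"] ev_av_const[OF Suc.prems(3), of 0] by simp
  qed
qed simp

lemma E0_fields [simp]: "md (E0 L H) = 1" "tau (E0 L H) = H" "lm (E0 L H) = L" "hor (E0 L H) = H"
  "arm (E0 L H) = 0" "cnd (E0 L H) = 0"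
  by (simp_all add: E0_def Lst_def)

text \<open>Here \<open>x\<close> is at least the logarithm of the horizon to base 16. The
  subtracted \<open>L\<close> closes the induction: for \<open>L \<le> x\<close> both
  \<open>L + 2 * L\<close> and \<open>L + (4 * x - 2 * L)\<close> are at most
  \<open>4 * x - L\<close>.\<close>

lemma ec_epochs:
  assumes cost: "\<And>L T. 1 \<le> L \<Longrightarrow> K \<le> 16 ^ L \<Longrightarrow> T \<le> 16 ^ L \<Longrightarrow>
      ec (kstep K) q T (E0 L (16 ^ L)) \<le> A * real L"
    and A: "0 \<le> A" and "1 \<le> L" "K \<le> 16 ^ L" "real L \<le> x \<or> T \<le> 16 ^ L" "real T \<le> 16 powr x"
  shows "ec (nxt K) q T (E0 L (16 ^ L)) \<le> A * max (real L) (4 * x - real L)"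
  using assms(3-)
proof (induction T arbitrary: L rule: less_induct)
  case (less T)
  have ok: "ok (E0 L (16 ^ L))" using less K by (simp add: ok_def)
  have eq: "ec (nxt K) q T (E0 L (16 ^ L)) = ec (kstep K) q (min T (16 ^ L)) (E0 L (16 ^ L))
    + ec (nxt K) q (T - 16 ^ L) (E0 (2 * L) (16 ^ L * 16 ^ L))"
    using ec_epoch[OF _ _ ok, of q T] by simp
  have sq: "16 ^ L * 16 ^ L = (16 :: nat) ^ (2 * L)" by (simp add: mult_2 power_add)
  have c: "ec (kstep K) q (min T (16 ^ L)) (E0 L (16 ^ L)) \<le> A * real L"
    by (rule cost) (use less in auto)
  show ?case
  proof (cases "T \<le> 16 ^ L")
    case True
    then have "ec (nxt K) q T (E0 L (16 ^ L)) \<le> A * real L" using eq c by simp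
    also have "\<dots> \<le> A * max (real L) (4 * x - real L)" using A by (intro mult_left_mono) auto
    finally show ?thesis .
  next
    case False
    have xL: "real L \<le> x" using less.prems False by simp
    have cond: "real (2 * L) \<le> x \<or> T - 16 ^ L \<le> 16 ^ (2 * L)"
    proof (rule disjCI)
      assume "\<not> T - 16 ^ L \<le> 16 ^ (2 * L)"
      then have "16 ^ (2 * L) \<le> T" by linarith
      then have "real (16 ^ (2 * L)) \<le> real T" by (simp only: of_nat_le_iff)
      from order_trans[OF this less.prems(4)] have "(16::real) ^ (2 * L) \<le> 16 powr x" by simp
      moreover have "(16::real) powr (real (2 * L)) = 16 ^ (2 * L)" by (rule powr_realpow) simp
      ultimately have "(16::real) powr (real (2 * L)) \<le> 16 powr x" by simp
      then show "real (2 * L) \<le> x" by simp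
    qed
    have "ec (nxt K) q (T - 16 ^ L) (E0 (2 * L) (16 ^ (2 * L))) \<le> A * max (real (2 * L)) (4 * x - real (2 * L))"
    proof (rule less.IH)
      show "T - 16 ^ L < T" using False by (intro diff_less) auto
      have "(16::nat) ^ L \<le> 16 ^ (2 * L)" by (intro power_increasing) auto
      then show "K \<le> 16 ^ (2 * L)" using less.prems(2) by linarith
      show "real (T - 16 ^ L) \<le> 16 powr x" using less.prems(4) by linarith
    qed (use less.prems cond in auto)
    then have "ec (nxt K) q T (E0 L (16 ^ L)) \<le> A * real L + A * max (real (2 * L)) (4 * x - real (2 * L))"
      unfolding eq sq using c by linarith
    also have "\<dots> = A * (real L + max (real (2 * L)) (4 * x - real (2 * L)))" by (simp add: distrib_left)
    also have "\<dots> \<le> A * max (real L) (4 * x - real L)"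
      using A xL by (intro mult_left_mono) auto
    finally show ?thesis .
  qed
qed

text \<open>In the warm-up every arm is pulled once, after which \<open>hor \<ge> K\<close>.\<close>

lemma ec_warmup:
  assumes "md s = 0" "arm s < K" "cnd s = 0" "hor s = 16 ^ lm s" "arm s < hor s"
    and "lm s = 1 \<or> 1 \<le> lm s \<and> hor s \<le> (K + 1)\<^sup>2"
  shows "\<exists>L. 1 \<le> L \<and> K \<le> 16 ^ L \<and> (L = 1 \<or> 16 ^ L \<le> (K + 1)\<^sup>2) \<and>
    (\<forall>T. ec (nxt K) q T s \<le> (if arm s \<le> q then 1 else 0) + ec (nxt K) q (T - (K - arm s)) (E0 L (16 ^ L)))"
  using assms
proof (induction "K - arm s" arbitrary: s)
  case (Suc n)
  define s' where "s' = (if hor s < arm s + 2 then s\<lparr>lm := 2 * lm s, hor := hor s * hor s\<rparr> else s)"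
  have s': "md s' = 0" "arm s' = arm s" "cnd s' = 0" using Suc by (auto simp: s'_def)
  have h: "hor s' = 16 ^ lm s'" using Suc by (auto simp: s'_def mult_2 power_add)
  \<comment> \<open>A single squaring suffices, because \<open>hor\<close> was at least
    \<open>arm s + 1\<close> and at least 2.\<close>
  have big: "arm s + 2 \<le> hor s'"
  proof (cases "hor s < arm s + 2")
    case True
    then have "hor s = arm s + 1" "2 \<le> hor s" using Suc.prems(4-6) power_increasing[of 1 "lm s" "16::nat"] by auto
    then have "2 * (arm s + 1) \<le> hor s * hor s" by (intro mult_le_mono) auto
    then show ?thesis using True by (simp add: s'_def)
  qed (simp add: s'_def)
  \<comment> \<open>Only numbers of at most \<open>K + 1\<close> are squared, so the overshoot of
    the warm-up is at most a square.\<close>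
  have l: "lm s' = 1 \<or> 1 \<le> lm s' \<and> hor s' \<le> (K + 1)\<^sup>2"
  proof (cases "hor s < arm s + 2")
    case True
    then have "hor s \<le> K + 1" using Suc.prems(2) by simp
    then have "hor s * hor s \<le> (K + 1) * (K + 1)" by (intro mult_le_mono)
    then show ?thesis using True Suc.prems(6) by (auto simp: s'_def power2_eq_square)
  next
    case False
    then show ?thesis using Suc.prems by (simp add: s'_def)
  qed
  have ok: "ok s" using Suc.prems K by (auto simp: ok_def)
  show ?case
  proof (cases "Suc (arm s) < K")
    case True
    let ?t = "s'\<lparr>arm := Suc (arm s)\<rparr>"
    have nx: "nxt K s y v = ?t" for y v
      using Suc.prems True by (simp add: nxt_def s'_def Let_def)
    have arm_t: "arm ?t = Suc (arm s)" by simp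
    have "n = K - arm ?t" using Suc.hyps(2) by simp
    from Suc.hyps(1)[OF this]
    have "\<exists>L. 1 \<le> L \<and> K \<le> 16 ^ L \<and> (L = 1 \<or> 16 ^ L \<le> (K + 1)\<^sup>2) \<and>
      (\<forall>T. ec (nxt K) q T ?t \<le> (if arm ?t \<le> q then 1 else 0) + ec (nxt K) q (T - (K - arm ?t)) (E0 L (16 ^ L)))"
      using True s' h big l by simp
    then obtain L where L: "1 \<le> L" "K \<le> 16 ^ L" "L = 1 \<or> 16 ^ L \<le> (K + 1)\<^sup>2"
      and ec: "\<And>T. ec (nxt K) q T ?t \<le> (if Suc (arm s) \<le> q then 1 else 0) + ec (nxt K) q (T - (K - Suc (arm s))) (E0 L (16 ^ L))"
      unfolding arm_t by blast
    have "ec (nxt K) q T s \<le> (if arm s \<le> q then 1 else 0) + ec (nxt K) q (T - (K - arm s)) (E0 L (16 ^ L))" for T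
    proof (cases T)
      case 0
      then show ?thesis by simp
    next
      case T: (Suc T')
      have "ec (nxt K) q T s = (if arm s = q then 1 else 0) + ec (nxt K) q T' ?t"
        unfolding T ec.simps nx ev_av_const[OF ok] ..
      also have "\<dots> \<le> (if arm s \<le> q then 1 else 0) + ec (nxt K) q (T' - (K - Suc (arm s))) (E0 L (16 ^ L))"
        using ec[of T'] by auto
      also have "T' - (K - Suc (arm s)) = T - (K - arm s)" using T True by simp
      finally show ?thesis .
    qed
    then show ?thesis using L by blast
  next
    case False
    then have Ka: "K = Suc (arm s)" using Suc.prems by simp
    have nx: "nxt K s y v = E0 (lm s') (16 ^ lm s')" for y v
      using Suc.prems False h by (simp add: nxt_def s'_def Let_def start_epoch_E0)
    have "ec (nxt K) q T s \<le> (if arm s \<le> q then 1 else 0) + ec (nxt K) q (T - (K - arm s)) (E0 (lm s') (16 ^ lm s'))" for T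
    proof (cases T)
      case T: (Suc T')
      have "ec (nxt K) q T s = (if arm s = q then 1 else 0) + ec (nxt K) q T' (E0 (lm s') (16 ^ lm s'))"
        unfolding T ec.simps nx ev_av_const[OF ok] ..
      then show ?thesis using T Ka by auto
    qed simp
    moreover have "K \<le> 16 ^ lm s'" using big h Ka by simp
    moreover have "1 \<le> lm s'" "lm s' = 1 \<or> 16 ^ lm s' \<le> (K + 1)\<^sup>2" using l h by auto
    ultimately show ?thesis by blast
  qed
qed simp

lemma pulls_bound:
  assumes q: "q < K" "istar < K" and star: "\<And>i. i < K \<Longrightarrow> mean D i \<le> mean D istar"
    and m: "dl m \<le> mean D istar - mean D q" "mean D istar - mean D q < 2 * dl m"
    and m0: "\<And>i. i < K \<Longrightarrow> mean D i < mean D istar \<Longrightarrow> dl m0 \<le> mean D istar - mean D i" and mm0: "m \<le> m0"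
    and T: "0 < T"
  shows "ec (nxt K) q T s0 \<le> 10 * (30000 * c0 * 4 ^ m * (1 + real (m0 - m)) + 1) * log1 (real T)"
proof -
  define A where "A = 30000 * c0 * 4 ^ m * (1 + real (m0 - m)) + 1"
  have A: "1 \<le> A" by (simp add: A_def c0_def)
  have log1: "1 \<le> log1 (real T)" "ln (real T) \<le> log1 (real T)" by (simp_all add: log1_def)
  have cost: "ec (kstep K) q T (E0 L (16 ^ L)) \<le> A * real L"
    if "1 \<le> L" "K \<le> 16 ^ L" "T \<le> 16 ^ L" for L T
  proof -
    define z :: st where "z = \<lparr>md = 0, arm = 0, cnt = 0, len = 0, acc = 0, lev = 0, gl = 0, prec = 0, bm = 0,
      cnd = 0, cbst = 0, bj = 0, thr = 0, lm = L, tau = 16 ^ L, hor = 16 ^ L\<rparr>"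
    have z: "E0 L (16 ^ L) = Lst z 0 0 0" "lm z = L" by (simp_all only: E0_def z_def st.select_convs)
    have "ec (kstep K) q T (E0 L (16 ^ L)) \<le> 30000 * c0 * L * 4 ^ m * (1 + real (m0 - m)) + 1"
      unfolding z(1) using epoch_cost[OF q star m m0 mm0, of z T] that z(2) by simp
    also have "\<dots> \<le> A * real L" using that by (simp add: A_def algebra_simps)
    finally show ?thesis .
  qed
  obtain L where L: "1 \<le> L" "K \<le> 16 ^ L" "L = 1 \<or> 16 ^ L \<le> (K + 1)\<^sup>2"
    and ec: "\<And>T. ec (nxt K) q T s0 \<le> 1 + ec (nxt K) q (T - K) (E0 L (16 ^ L))"
  proof -
    have s: "md s0 = 0" "arm s0 = 0" "cnd s0 = 0" "hor s0 = 16 ^ lm s0" "arm s0 < hor s0" "lm s0 = 1"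
      by (simp_all add: s0_def)
    show thesis
      using ec_warmup[of s0 q] s K that by fastforce
  qed
  show ?thesis
  proof (cases "T \<le> K")
    case True
    then have "ec (nxt K) q T s0 \<le> 1 * 1" using ec[of T] by simp
    also have "\<dots> \<le> (10 * A) * log1 (real T)" using A log1 by (intro mult_mono) auto
    finally show ?thesis by (simp add: A_def)
  next
    case False
    define y where "y = log 16 (real T)"
    have Ty: "real T = 16 powr y" using T by (simp add: y_def)
    have "y = ln (real T) / ln 16" by (simp add: y_def log_def)
    also have "\<dots> \<le> ln (real T)"
    proof -
      have "(1::real) \<le> ln 16"
        using ln_mono[of "exp 1" "16::real"] exp_le by simp
      then show ?thesis using T by (simp add: divide_le_eq mult_le_cancel_left1)
    qed
    finally have y: "y \<le> log1 (real T)" using log1 by linarith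
    have y0: "0 \<le> y" using T by (simp add: y_def)
    \<comment> \<open>The first epoch may be longer than \<open>T\<close>, but as
      \<open>T > K\<close> the overshoot of the warm-up leaves \<open>16 ^ L\<close> at most
      \<open>T ^ 2\<close>, unless \<open>L = 1\<close>.\<close>
    have Ly: "real L \<le> 1 + 2 * y"
    proof (cases "L = 1")
      case False
      have "(K + 1)\<^sup>2 \<le> T\<^sup>2" using \<open>\<not> T \<le> K\<close> by (intro power_mono) auto
      then have "16 ^ L \<le> T\<^sup>2" using L(3) False by linarith
      then have "real (16 ^ L) \<le> real (T\<^sup>2)" by (simp only: of_nat_le_iff)
      then have "(16::real) ^ L \<le> (16 powr y)\<^sup>2" unfolding Ty[symmetric] by simp
      moreover have "(16::real) powr real L = 16 ^ L" by (rule powr_realpow) simp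
      ultimately have "(16::real) powr real L \<le> (16 powr y)\<^sup>2" by simp
      also have "\<dots> = 16 powr (2 * y)" by (simp add: powr_power)
      finally show ?thesis by simp
    qed (use y0 in simp)
    define x where "x = max y (real L)"
    have "ec (nxt K) q (T - K) (E0 L (16 ^ L)) \<le> A * max (real L) (4 * x - real L)"
    proof (rule ec_epochs[OF cost])
      have "real (T - K) \<le> 16 powr y" using Ty by linarith
      also have "\<dots> \<le> 16 powr x" by (simp add: x_def)
      finally show "real (T - K) \<le> 16 powr x" .
    qed (use A L in \<open>auto simp: x_def\<close>)
    also have "\<dots> \<le> A * (3 + 6 * y)"
      using A y0 Ly by (intro mult_left_mono) (auto simp: x_def)
    finally have "ec (nxt K) q T s0 \<le> 1 + A * (3 + 6 * y)" using ec[of T] by linarith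
    also have "\<dots> \<le> A * (4 + 6 * y)" using A by (simp add: algebra_simps)
    also have "\<dots> \<le> A * (10 * log1 (real T))" using A y log1 by (intro mult_left_mono) auto
    finally show ?thesis by (simp add: A_def mult_ac)
  qed
qed

end

subsection \<open>The random sequence of states\<close>

text \<open>With countably many states, measurability for each fixed state is enough: the discrete
  sigma-algebra serves for the run.\<close>

instance st_ext :: (countable) countable
proof (rule countable_classI[of "\<lambda>s. to_nat ([md s, arm s, cnt s, len s, acc s, lev s, gl s, prec s,
    bm s, cnd s, cbst s, bj s, thr s, lm s, tau s, hor s], st.more s)"])
qed (auto intro: st.equality)

text \<open>Rewards lie in the unit interval only almost surely; clipping makes them bounded
  everywhere, as the resampling lemmas require.\<close>

definition clip :: "real \<Rightarrow> real" where "clip z = max 0 (min 1 z)"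

text \<open>One seed is drawn with every pull, whether the transition uses it or not; so transition
  \<open>t\<close> reads the rewards of time \<open>Suc t\<close> and seed \<open>t\<close>.\<close>

primrec sq :: "nat \<Rightarrow> (nat \<times> nat \<Rightarrow> real) \<Rightarrow> (nat \<Rightarrow> real) \<Rightarrow> nat \<Rightarrow> st" where
  "sq K x u 0 = s0"
| "sq K x u (Suc t) = (let s = sq K x u t in
     nxt K s (nat \<lfloor>x (arm s, Suc t) * real (prec s)\<rfloor>) (nat \<lfloor>u t * real (lm s)\<rfloor>))"

lemma sq_cong:
  assumes "\<And>i k. k \<le> t \<Longrightarrow> x (i, k) = x' (i, k)" "\<And>k. k < t \<Longrightarrow> u k = u' k"
  shows "sq K x u t = sq K x' u' t"
  using assms by (induction t) (simp_all add: Let_def)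

abbreviation "unif \<equiv> uniform_measure lborel {0..<1 :: real}"

lemma prob_unif: "prob_space unif"
  by (rule prob_space_uniform_measure) auto

lemma sets_unif: "sets unif = sets borel" by simp

lemma AE_unif: "AE w in unif. 0 \<le> w \<and> w < 1"
  by (rule AE_uniform_measureI) auto

lemma floor_meas: "(\<lambda>z. nat \<lfloor>z * real Q\<rfloor>) \<in> measurable borel (count_space UNIV)"
  by measurable

lemma av_integral:
  assumes "0 < L"
  shows "av L f = (\<integral>w. f (nat \<lfloor>w * real L\<rfloor>) \<partial>unif)"
proof -
  interpret prob_space unif by (rule prob_unif)
  have m: "{z::real. nat \<lfloor>z * real L\<rfloor> = y} \<in> sets borel" for y
    using measurable_sets[OF floor_meas[of L], of "{y}"] by (simp add: vimage_def)
  have p: "measure unif {z. nat \<lfloor>z * real L\<rfloor> = y} = 1 / L" if "y < L" for y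
  proof -
    have "{0..<1} \<inter> {z::real. nat \<lfloor>z * real L\<rfloor> = y} = {real y / L..<real (Suc y) / L}"
    proof (intro set_eqI iffI)
      fix z assume z: "z \<in> {0..<1} \<inter> {z::real. nat \<lfloor>z * real L\<rfloor> = y}"
      then have "\<lfloor>z * real L\<rfloor> = int y" by auto
      then have "real y \<le> z * real L" "z * real L < real y + 1" by (simp_all add: floor_eq_iff)
      then show "z \<in> {real y / L..<real (Suc y) / L}" using assms by (simp add: field_simps)
    next
      fix z assume z: "z \<in> {real y / L..<real (Suc y) / L}"
      then have "real y \<le> z * real L" "z * real L < real y + 1" using assms by (simp_all add: field_simps)
      then have "\<lfloor>z * real L\<rfloor> = int y" by (simp add: floor_eq_iff)
      moreover have "0 \<le> z" using z by (auto intro: order.trans[rotated])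
      moreover have "z < 1"
      proof -
        have "real (Suc y) \<le> real L" using that by simp
        then have "real (Suc y) / L \<le> 1" using assms by (simp add: divide_le_eq)
        then show ?thesis using z by simp
      qed
      ultimately show "z \<in> {0..<1} \<inter> {z::real. nat \<lfloor>z * real L\<rfloor> = y}" by simp
    qed
    then show ?thesis using m[of y] assms
      by (subst measure_uniform_measure) (auto simp: diff_divide_distrib[symmetric] field_simps)
  qed
  have "(\<integral>z. f (nat \<lfloor>z * real L\<rfloor>) \<partial>unif) = (\<integral>z. (\<Sum>y<L. indicator {z. nat \<lfloor>z * real L\<rfloor> = y} z * f y) \<partial>unif)"
  proof (rule integral_cong_AE)
    show "(\<lambda>z. f (nat \<lfloor>z * real L\<rfloor>)) \<in> borel_measurable unif"
      by (subst measurable_cong_sets[OF sets_unif refl], rule measurable_compose[OF floor_meas]) simp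
    show "(\<lambda>z. \<Sum>y<L. indicator {z. nat \<lfloor>z * real L\<rfloor> = y} z * f y) \<in> borel_measurable unif"
      using m by (intro borel_measurable_sum borel_measurable_times) auto
    show "AE z in unif. f (nat \<lfloor>z * real L\<rfloor>) = (\<Sum>y<L. indicator {z. nat \<lfloor>z * real L\<rfloor> = y} z * f y)"
      using AE_unif
    proof eventually_elim
      case (elim z)
      have "z * real L < real L" using elim assms by simp
      then have "nat \<lfloor>z * real L\<rfloor> < L" using elim assms by (simp add: nat_less_iff floor_less_iff)
      moreover have "(\<Sum>y<L. indicator {z. nat \<lfloor>z * real L\<rfloor> = y} z * f y)
        = (\<Sum>y<L. if y = nat \<lfloor>z * real L\<rfloor> then f y else 0)"
        by (intro sum.cong) (auto simp: indicator_def)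
      ultimately show ?case by simp
    qed
  qed
  also have "\<dots> = (\<Sum>y<L. measure unif {z. nat \<lfloor>z * real L\<rfloor> = y} * f y)"
    using m by (subst Bochner_Integration.integral_sum) (auto simp: emeasure_eq_measure)
  also have "\<dots> = (\<Sum>y<L. 1 / L * f y)"
    by (rule sum.cong[OF refl]) (simp only: p lessThan_iff)
  finally show ?thesis by (simp add: av_def sum_divide_distrib)
qed

section \<open>Measurability of the run, and resampling\<close>

context bandit
begin

abbreviation "I \<equiv> {..<K} \<times> {1::nat..}"
abbreviation "PX \<equiv> PiM I (\<lambda>p. D (fst p))"
abbreviation "PU \<equiv> PiM (UNIV :: nat set) (\<lambda>_. unif)"
abbreviation "BS \<equiv> PX \<Otimes>\<^sub>M PU"

lemma BS: "bandit_space K D = BS" by (simp add: bandit_space_def)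

lemma prob_PX: "prob_space PX" by (rule prob_space_PiM) (auto intro: D)
lemma prob_PU: "prob_space PU" by (rule prob_space_PiM) (rule prob_unif)

lemma prob_BS: "prob_space BS"
  by (rule prob_space_pair[OF prob_PX prob_PU])

lemma coord_meas: "a < K \<Longrightarrow> 1 \<le> t \<Longrightarrow> (\<lambda>\<omega>. fst \<omega> (a, t)) \<in> borel_measurable BS"
proof -
  assume "a < K" "1 \<le> t"
  then have "(\<lambda>x. x (a, t)) \<in> measurable PX (D (fst (a, t)))" by (intro measurable_component_singleton) auto
  then have "(\<lambda>x. x (a, t)) \<in> borel_measurable PX"
    using measurable_cong_sets[OF refl D(2)[OF \<open>a < K\<close>], of PX] by simp
  then show ?thesis by (rule measurable_compose[OF measurable_fst])
qed

lemma seed_meas: "(\<lambda>\<omega>. snd \<omega> n) \<in> borel_measurable BS"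
proof -
  have "(\<lambda>u. u n) \<in> measurable PU unif" by (intro measurable_component_singleton) auto
  then have "(\<lambda>u. u n) \<in> borel_measurable PU"
    using measurable_cong_sets[OF refl sets_unif, of PU] by simp
  then show ?thesis by (rule measurable_compose[OF measurable_snd])
qed

lemma bounded_integrable:
  assumes "prob_space M" "f \<in> borel_measurable M" "\<And>x. \<bar>f x :: real\<bar> \<le> B"
  shows "integrable M f"
proof -
  interpret prob_space M by fact
  show ?thesis by (rule integrable_const_bound[of _ B]) (use assms in auto)
qed

text \<open>The \<open>t\<close>-th state depends only on the first \<open>t\<close> rewards and seeds, so that resampling the coordinates
  which the next step reads replaces filtrations and conditional expectations.\<close>

lemma resample_PiM:
  fixes G :: "('i \<Rightarrow> real) \<Rightarrow> real"
  assumes M: "\<And>i. i \<in> J \<Longrightarrow> prob_space (M i)" and p: "p \<in> J"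
    and G: "G \<in> borel_measurable (PiM J M)" "\<And>x. \<bar>G x\<bar> \<le> B"
  shows "(\<integral>x. G x \<partial>PiM J M) = (\<integral>x. (\<integral>z. G (x(p := z)) \<partial>M p) \<partial>PiM J M)"
proof -
  have P: "prob_space (PiM J M)" by (rule prob_space_PiM) (rule M)
  have Mp: "prob_space (M p)" by (rule M[OF p])
  interpret pair_prob_space "M p" "PiM J M"
    using P Mp by (simp add: pair_prob_space_def pair_sigma_finite_def prob_space_imp_sigma_finite)
  have ins: "insert p J = J" using p by auto
  have eq: "distr (M p \<Otimes>\<^sub>M PiM J M) (PiM J M) (\<lambda>(x, X). X(p := x)) = PiM J M"
    using distr_pair_PiM_eq_PiM[of J M p] M p unfolding ins by simp
  have m: "(\<lambda>(x, X). X(p := x)) \<in> measurable (M p \<Otimes>\<^sub>M PiM J M) (PiM J M)"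
    unfolding case_prod_beta
    by (rule measurable_fun_upd[of J J p]) (use p in auto)
  have int: "integrable (M p \<Otimes>\<^sub>M PiM J M) (\<lambda>(z, X). G (X(p := z)))"
    using measurable_compose[OF m G(1)] G(2)
    by (intro bounded_integrable[OF P.prob_space_axioms, where B = B]) (auto simp: case_prod_beta)
  have "(\<integral>x. G x \<partial>PiM J M) = (\<integral>x. G x \<partial>distr (M p \<Otimes>\<^sub>M PiM J M) (PiM J M) (\<lambda>(x, X). X(p := x)))"
    unfolding eq ..
  also have "\<dots> = (\<integral>zX. G (case zX of (z, X) \<Rightarrow> X(p := z)) \<partial>(M p \<Otimes>\<^sub>M PiM J M))"
    by (rule integral_distr[OF m G(1)])
  also have "\<dots> = (\<integral>x. (\<integral>z. G (x(p := z)) \<partial>M p) \<partial>PiM J M)"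
    using integral_snd[OF int] by (simp add: case_prod_unfold)
  finally show ?thesis .
qed

lemma resample_X:
  fixes F :: "(nat \<times> nat \<Rightarrow> real) \<times> (nat \<Rightarrow> real) \<Rightarrow> real"
  assumes p: "p \<in> I" and F: "F \<in> borel_measurable BS" "\<And>\<omega>. \<bar>F \<omega>\<bar> \<le> B"
  shows "(\<integral>\<omega>. F \<omega> \<partial>BS) = (\<integral>u. (\<integral>x. (\<integral>z. F (x(p := z), u) \<partial>D (fst p)) \<partial>PX) \<partial>PU)"
proof -
  interpret pair_prob_space PX PU
    using prob_PX prob_PU by (simp add: pair_prob_space_def pair_sigma_finite_def prob_space_imp_sigma_finite)
  have "(\<integral>\<omega>. F \<omega> \<partial>BS) = (\<integral>u. (\<integral>x. F (x, u) \<partial>PX) \<partial>PU)"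
    using integral_snd[of "\<lambda>x u. F (x, u)"] bounded_integrable[OF prob_BS F] by simp
  also have "\<dots> = (\<integral>u. (\<integral>x. (\<integral>z. F (x(p := z), u) \<partial>D (fst p)) \<partial>PX) \<partial>PU)"
  proof (rule Bochner_Integration.integral_cong[OF refl])
    fix u assume "u \<in> space PU"
    then have "(\<lambda>x. F (x, u)) \<in> borel_measurable PX"
      by (intro measurable_compose[OF _ F(1)]) simp
    then show "(\<integral>x. F (x, u) \<partial>PX) = (\<integral>x. (\<integral>z. F (x(p := z), u) \<partial>D (fst p)) \<partial>PX)"
      using D F(2) by (intro resample_PiM[where B = B]) (use p in auto)
  qed
  finally show ?thesis .
qed

lemma resample_U:
  fixes F :: "(nat \<times> nat \<Rightarrow> real) \<times> (nat \<Rightarrow> real) \<Rightarrow> real"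
  assumes F: "F \<in> borel_measurable BS" "\<And>\<omega>. \<bar>F \<omega>\<bar> \<le> B"
  shows "(\<integral>\<omega>. F \<omega> \<partial>BS) = (\<integral>x. (\<integral>u. (\<integral>w. F (x, u(n := w)) \<partial>unif) \<partial>PU) \<partial>PX)"
proof -
  interpret pair_prob_space PX PU
    using prob_PX prob_PU by (simp add: pair_prob_space_def pair_sigma_finite_def prob_space_imp_sigma_finite)
  have "(\<integral>\<omega>. F \<omega> \<partial>BS) = (\<integral>x. (\<integral>u. F (x, u) \<partial>PU) \<partial>PX)"
    using integral_fst[of "\<lambda>x u. F (x, u)"] bounded_integrable[OF prob_BS F] by simp
  also have "\<dots> = (\<integral>x. (\<integral>u. (\<integral>w. F (x, u(n := w)) \<partial>unif) \<partial>PU) \<partial>PX)"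
  proof (rule Bochner_Integration.integral_cong[OF refl])
    fix x assume "x \<in> space PX"
    then have "(\<lambda>u. F (x, u)) \<in> borel_measurable PU"
      by (intro measurable_compose[OF _ F(1)]) simp
    then show "(\<integral>u. F (x, u) \<partial>PU) = (\<integral>u. (\<integral>w. F (x, u(n := w)) \<partial>unif) \<partial>PU)"
      using F(2) prob_unif by (intro resample_PiM[where B = B]) auto
  qed
  finally show ?thesis .
qed

lemma ok_sq: "ok (sq K x u t)"
proof (induction t)
  case 0
  show ?case using K by (simp add: ok_def s0_def)
qed (simp add: Let_def ok_nxt)

lemma arm_sq: "arm (sq K x u t) < K" and lm_sq: "0 < lm (sq K x u t)"
  using ok_sq[of x u t] by (simp_all add: ok_def)

abbreviation "S \<equiv> \<lambda>t \<omega>. sq K (fst \<omega>) (snd \<omega>) t"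

lemma reading_meas: "a < K \<Longrightarrow> (\<lambda>\<omega>. nat \<lfloor>fst \<omega> (a, Suc t) * real Q\<rfloor>) \<in> measurable BS (count_space UNIV)"
  by (rule measurable_compose[OF coord_meas floor_meas]) auto

lemma sq_meas: "S t \<in> measurable BS (count_space UNIV)"
proof (induction t)
  case (Suc t)
  \<comment> \<open>The guard makes \<open>g s\<close> measurable for every \<open>s\<close>: arms
    from \<open>K\<close> on are no coordinates of the product space.\<close>
  define g where "g s \<omega> = (if arm s < K then nxt K s (nat \<lfloor>fst \<omega> (arm s, Suc t) * real (prec s)\<rfloor>)
    (nat \<lfloor>snd \<omega> t * real (lm s)\<rfloor>) else s)" for s and \<omega> :: "(nat \<times> nat \<Rightarrow> real) \<times> (nat \<Rightarrow> real)"
  have V: "(\<lambda>\<omega>. nat \<lfloor>snd \<omega> t * real L\<rfloor>) \<in> measurable BS (count_space UNIV)" for L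
    by (rule measurable_compose[OF seed_meas floor_meas])
  have "g s \<in> measurable BS (count_space UNIV)" for s
  proof (cases "arm s < K")
    case True
    have "(\<lambda>\<omega>. nxt K s y (nat \<lfloor>snd \<omega> t * real (lm s)\<rfloor>)) \<in> measurable BS (count_space UNIV)" for y
      by (rule measurable_compose[OF V]) simp
    from measurable_compose_countable[where f = "\<lambda>y \<omega>. nxt K s y (nat \<lfloor>snd \<omega> t * real (lm s)\<rfloor>)",
        OF this reading_meas[OF True, of t "prec s"]]
    show ?thesis unfolding g_def[abs_def] by (simp only: True if_True)
  qed (simp add: g_def[abs_def])
  from measurable_compose_countable[where f = g, OF this Suc]
  show ?case by (simp only: g_def arm_sq if_True sq.simps Let_def)
qed simp

lemma state_meas:
  assumes "\<And>s. arm s < K \<Longrightarrow> \<phi> s \<in> measurable BS N"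
  shows "(\<lambda>\<omega>. \<phi> (S t \<omega>) \<omega>) \<in> measurable BS N"
proof -
  have "K - 1 < K" using K by simp
  then have "(\<lambda>\<omega>. \<phi> (if arm s < K then s else s\<lparr>arm := 0\<rparr>) \<omega>) \<in> measurable BS N" for s
    using assms[of s] assms[of "s\<lparr>arm := 0\<rparr>"] K by simp
  from measurable_compose_countable[where f = "\<lambda>s. \<phi> (if arm s < K then s else s\<lparr>arm := 0\<rparr>)", OF this sq_meas[of t]]
  show ?thesis by (simp only: arm_sq if_True)
qed

lemma BS_snd:
  fixes F :: "(nat \<times> nat \<Rightarrow> real) \<times> (nat \<Rightarrow> real) \<Rightarrow> real"
  assumes "F \<in> borel_measurable BS" "\<And>\<omega>. \<bar>F \<omega>\<bar> \<le> B"
  shows "(\<integral>u. (\<integral>x. F (x, u) \<partial>PX) \<partial>PU) = (\<integral>\<omega>. F \<omega> \<partial>BS)"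
    and "(\<integral>x. (\<integral>u. F (x, u) \<partial>PU) \<partial>PX) = (\<integral>\<omega>. F \<omega> \<partial>BS)"
proof -
  interpret pair_prob_space PX PU
    using prob_PX prob_PU by (simp add: pair_prob_space_def pair_sigma_finite_def prob_space_imp_sigma_finite)
  show "(\<integral>u. (\<integral>x. F (x, u) \<partial>PX) \<partial>PU) = (\<integral>\<omega>. F \<omega> \<partial>BS)"
    using integral_snd[of "\<lambda>x u. F (x, u)"] bounded_integrable[OF prob_BS assms] by simp
  show "(\<integral>x. (\<integral>u. F (x, u) \<partial>PU) \<partial>PX) = (\<integral>\<omega>. F \<omega> \<partial>BS)"
    using integral_fst[of "\<lambda>x u. F (x, u)"] bounded_integrable[OF prob_BS assms] by simp
qed

text \<open>After splitting by the arm \<open>a\<close> that is pulled, the coordinate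
  \<open>(a, Suc t)\<close> can be resampled, since the state at time \<open>t\<close> does not
  depend on it.\<close>

lemma step_X:
  fixes \<phi> :: "st \<Rightarrow> real \<Rightarrow> real"
  assumes B: "\<And>s z. \<bar>\<phi> s z\<bar> \<le> B" and m: "\<And>s. \<phi> s \<in> borel_measurable borel"
  shows "(\<integral>\<omega>. \<phi> (S t \<omega>) (fst \<omega> (arm (S t \<omega>), Suc t)) \<partial>BS)
    = (\<integral>\<omega>. (\<integral>z. \<phi> (S t \<omega>) z \<partial>D (arm (S t \<omega>))) \<partial>BS)"
proof -
  define F where "F a \<omega> = (if arm (S t \<omega>) = a then \<phi> (S t \<omega>) (fst \<omega> (a, Suc t)) else 0)" for a \<omega>
  define H where "H a \<omega> = (if arm (S t \<omega>) = a then (\<integral>z. \<phi> (S t \<omega>) z \<partial>D a) else 0)" for a \<omega>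
  have B0: "0 \<le> B" using B[of undefined 0] by linarith
  have FB: "\<bar>F a \<omega>\<bar> \<le> B" for a \<omega> using B B0 by (simp add: F_def)
  have HB: "\<bar>H a \<omega>\<bar> \<le> B" if "a < K" for a \<omega>
  proof -
    interpret prob_space "D a" by (rule D(1)[OF that])
    have "\<phi> s \<in> borel_measurable (D a)" for s using m measurable_cong_sets[OF D(2)[OF that] refl] by blast
    then have i: "integrable (D a) (\<phi> s)" for s
      by (rule bounded_integrable[OF D(1)[OF that], where B = B]) (rule B)
    have "\<bar>\<integral>z. \<phi> s z \<partial>D a\<bar> \<le> B" for s
    proof -
      have "\<phi> s z \<le> B" "- B \<le> \<phi> s z" for z using B[of s z] by (simp_all add: abs_le_iff)
      then have "(\<integral>z. \<phi> s z \<partial>D a) \<le> (\<integral>z. B \<partial>D a)" "(\<integral>z. - B \<partial>D a) \<le> (\<integral>z. \<phi> s z \<partial>D a)"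
        by (intro integral_mono i; simp)+
      then show ?thesis by (simp add: prob_space abs_le_iff)
    qed
    then show ?thesis using B0 by (simp add: H_def)
  qed
  have Fm: "F a \<in> borel_measurable BS" if "a < K" for a
  proof -
    have "(\<lambda>\<omega>. (\<lambda>s \<omega>. if arm s = a then \<phi> s (fst \<omega> (a, Suc t)) else 0) (S t \<omega>) \<omega>) \<in> borel_measurable BS"
    proof (rule state_meas)
      fix s
      have "(\<lambda>\<omega>. \<phi> s (fst \<omega> (a, Suc t))) \<in> borel_measurable BS"
        by (rule measurable_compose[OF coord_meas m]) (use that in auto)
      then show "(\<lambda>\<omega>. if arm s = a then \<phi> s (fst \<omega> (a, Suc t)) else 0) \<in> borel_measurable BS" by simp
    qed
    then show ?thesis by (simp add: F_def[abs_def])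
  qed
  have Hm: "H a \<in> borel_measurable BS" for a
  proof -
    have "(\<lambda>\<omega>. (\<lambda>s \<omega>. if arm s = a then (\<integral>z. \<phi> s z \<partial>D a) else 0) (S t \<omega>) \<omega>) \<in> borel_measurable BS"
      by (rule state_meas) simp
    then show ?thesis by (simp add: H_def[abs_def])
  qed
  have FH: "(\<integral>\<omega>. F a \<omega> \<partial>BS) = (\<integral>\<omega>. H a \<omega> \<partial>BS)" if a: "a < K" for a
  proof -
    have p: "(a, Suc t) \<in> I" using a by simp
    have sq: "sq K (x((a, Suc t) := z)) u t = sq K x u t" for x z u by (rule sq_cong) auto
    have "(\<integral>\<omega>. F a \<omega> \<partial>BS) = (\<integral>u. (\<integral>x. (\<integral>z. F a (x((a, Suc t) := z), u) \<partial>D a) \<partial>PX) \<partial>PU)"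
      using resample_X[OF p Fm[OF a] FB] by simp
    also have "\<dots> = (\<integral>u. (\<integral>x. H a (x, u) \<partial>PX) \<partial>PU)"
    proof -
      have "(\<integral>z. F a (x((a, Suc t) := z), u) \<partial>D a) = H a (x, u)" for x u
        by (simp add: F_def H_def sq)
      then show ?thesis by simp
    qed
    also have "\<dots> = (\<integral>\<omega>. H a \<omega> \<partial>BS)" by (rule BS_snd(1)[OF Hm HB[OF a]])
    finally show ?thesis .
  qed
  have "(\<integral>\<omega>. \<phi> (S t \<omega>) (fst \<omega> (arm (S t \<omega>), Suc t)) \<partial>BS) = (\<integral>\<omega>. (\<Sum>a<K. F a \<omega>) \<partial>BS)"
    using arm_sq by (simp add: F_def)
  also have "\<dots> = (\<Sum>a<K. \<integral>\<omega>. F a \<omega> \<partial>BS)"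
    by (rule Bochner_Integration.integral_sum) (use bounded_integrable[OF prob_BS Fm FB] in auto)
  also have "\<dots> = (\<Sum>a<K. \<integral>\<omega>. H a \<omega> \<partial>BS)" by (rule sum.cong[OF refl]) (rule FH, simp)
  also have "\<dots> = (\<integral>\<omega>. (\<Sum>a<K. H a \<omega>) \<partial>BS)"
    by (rule Bochner_Integration.integral_sum[symmetric]) (use bounded_integrable[OF prob_BS Hm HB] in auto)
  also have "\<dots> = (\<integral>\<omega>. (\<integral>z. \<phi> (S t \<omega>) z \<partial>D (arm (S t \<omega>))) \<partial>BS)"
    using arm_sq by (simp add: H_def)
  finally show ?thesis .
qed

lemma S_meas: "(\<lambda>\<omega>. f (S t \<omega>) :: real) \<in> borel_measurable BS"
  by (rule measurable_compose[OF sq_meas]) simp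

text \<open>The Markov property: seed \<open>t\<close> is resampled first, then the reward at time
  \<open>Suc t\<close>, neither of which influences the state at time \<open>t\<close>.\<close>

lemma step_state:
  fixes f :: "st \<Rightarrow> real"
  assumes B: "\<And>s. \<bar>f s\<bar> \<le> B"
  shows "(\<integral>\<omega>. f (S (Suc t) \<omega>) \<partial>BS)
    = (\<integral>\<omega>. ev (arm (S t \<omega>)) (prec (S t \<omega>)) (\<lambda>y. av (lm (S t \<omega>)) (\<lambda>v. f (nxt K (S t \<omega>) y v))) \<partial>BS)"
proof -
  define \<phi> where "\<phi> s z = av (lm s) (\<lambda>v. f (nxt K s (nat \<lfloor>z * real (prec s)\<rfloor>) v))" for s z
  have B0: "0 \<le> B" using B[of undefined] by linarith
  have avB: "\<bar>av L (\<lambda>v. f (h v))\<bar> \<le> B" for L h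
  proof -
    have "\<bar>\<Sum>v<L. f (h v)\<bar> \<le> (\<Sum>v<L. B)" by (rule order.trans[OF sum_abs sum_mono]) (rule B)
    then have "\<bar>\<Sum>v<L. f (h v)\<bar> / L \<le> real L * B / L" by (intro divide_right_mono) auto
    also have "\<dots> \<le> B" using B0 by simp
    finally show ?thesis by (simp add: av_def)
  qed
  have \<phi>B: "\<bar>\<phi> s z\<bar> \<le> B" for s z unfolding \<phi>_def by (rule avB)
  have \<phi>m: "\<phi> s \<in> borel_measurable borel" for s
    unfolding \<phi>_def[abs_def] by (rule measurable_compose[OF floor_meas]) simp
  define G where "G \<omega> = \<phi> (S t \<omega>) (fst \<omega> (arm (S t \<omega>), Suc t))" for \<omega>
  have Gm: "G \<in> borel_measurable BS"
  proof -
    have "(\<lambda>\<omega>. (\<lambda>s \<omega>. \<phi> s (fst \<omega> (arm s, Suc t))) (S t \<omega>) \<omega>) \<in> borel_measurable BS"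
      by (rule state_meas) (rule measurable_compose[OF coord_meas \<phi>m], auto)
    then show ?thesis by (simp add: G_def[abs_def])
  qed
  have GB: "\<bar>G \<omega>\<bar> \<le> B" for \<omega> unfolding G_def by (rule \<phi>B)
  have sq: "sq K x (u(t := w)) t = sq K x u t" for x u w by (rule sq_cong) auto
  have "(\<integral>\<omega>. f (S (Suc t) \<omega>) \<partial>BS) = (\<integral>x. (\<integral>u. (\<integral>w. f (S (Suc t) (x, u(t := w))) \<partial>unif) \<partial>PU) \<partial>PX)"
    by (rule resample_U[OF S_meas B])
  also have "\<dots> = (\<integral>x. (\<integral>u. G (x, u) \<partial>PU) \<partial>PX)"
  proof -
    have "(\<integral>w. f (S (Suc t) (x, u(t := w))) \<partial>unif) = G (x, u)" for x u
      using av_integral[OF lm_sq[of x u t], of "\<lambda>v. f (nxt K (sq K x u t)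
        (nat \<lfloor>x (arm (sq K x u t), Suc t) * real (prec (sq K x u t))\<rfloor>) v)"]
      by (simp add: G_def \<phi>_def sq Let_def)
    then show ?thesis by simp
  qed
  also have "\<dots> = (\<integral>\<omega>. G \<omega> \<partial>BS)" by (rule BS_snd(2)[OF Gm GB])
  also have "\<dots> = (\<integral>\<omega>. (\<integral>z. \<phi> (S t \<omega>) z \<partial>D (arm (S t \<omega>))) \<partial>BS)"
    unfolding G_def by (rule step_X[OF \<phi>B \<phi>m])
  also have "\<dots> = (\<integral>\<omega>. ev (arm (S t \<omega>)) (prec (S t \<omega>)) (\<lambda>y. av (lm (S t \<omega>)) (\<lambda>v. f (nxt K (S t \<omega>) y v))) \<partial>BS)"
    using arm_sq by (simp add: \<phi>_def ev_integral)
  finally show ?thesis .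
qed

definition pull_prob :: "nat \<Rightarrow> nat \<Rightarrow> real" where
  "pull_prob q t = (\<integral>\<omega>. (if arm (S t \<omega>) = q then 1 else 0) \<partial>BS)"

lemma S_integrable:
  fixes f :: "st \<Rightarrow> real"
  assumes "\<And>s. ok s \<Longrightarrow> \<bar>f s\<bar> \<le> B"
  shows "integrable BS (\<lambda>\<omega>. f (S t \<omega>))"
  by (rule bounded_integrable[OF prob_BS S_meas]) (rule assms, rule ok_sq)

lemma ec_abs: "ok s \<Longrightarrow> \<bar>ec (nxt K) q n s\<bar> \<le> real n"
  using ec_nonneg[of "nxt K" q n s] ec_le[where nx = "nxt K" and s = s and q = q and T = n, OF _ ok_nxt] by simp

lemma pull_integrable: "integrable BS (\<lambda>\<omega>. if arm (S t \<omega>) = q then 1 else 0 :: real)"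
  by (rule S_integrable[where B = 1 and f = "\<lambda>s. if arm s = q then 1 else 0"]) simp

text \<open>In expectation, one unfolding of \<open>ec\<close> exchanges a step of the horizon for a
  pull probability and the next state; the sum telescopes.\<close>

lemma pulls_ec: "(\<Sum>t<T. pull_prob q t) = ec (nxt K) q T s0"
proof -
  have step: "(\<integral>\<omega>. ec (nxt K) q (Suc n) (S t \<omega>) \<partial>BS) = pull_prob q t + (\<integral>\<omega>. ec (nxt K) q n (S (Suc t) \<omega>) \<partial>BS)" for n t
  proof -
    \<comment> \<open>\<open>ec\<close> is known to be bounded on valid states only, whereas
      \<open>step_state\<close> wants a bound for all states.\<close>
    define f where "f s = (if ok s then ec (nxt K) q n s else 0)" for s
    have f: "\<bar>f s\<bar> \<le> real n" for s using ec_abs by (simp add: f_def)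
    have fe: "f (nxt K (S t \<omega>) y v) = ec (nxt K) q n (nxt K (S t \<omega>) y v)" for \<omega> y v
      using ok_nxt[OF ok_sq] by (simp add: f_def)
    define g where "g s = ev (arm s) (prec s) (\<lambda>y. av (lm s) (\<lambda>v. ec (nxt K) q n (nxt K s y v)))" for s
    have gE: "g s = ec (nxt K) q (Suc n) s - (if arm s = q then 1 else 0)" for s by (simp add: g_def)
    have gi: "integrable BS (\<lambda>\<omega>. g (S t \<omega>))"
    proof (rule S_integrable)
      show "\<bar>g s\<bar> \<le> real (Suc n) + 1" if "ok s" for s
      proof -
        have "0 \<le> (if arm s = q then 1 else 0 :: real)" "(if arm s = q then 1 else 0 :: real) \<le> 1" by simp_all
        then show ?thesis using ec_abs[OF that, of q "Suc n"] unfolding gE by linarith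
      qed
    qed

    have "(\<integral>\<omega>. ec (nxt K) q (Suc n) (S t \<omega>) \<partial>BS) = (\<integral>\<omega>. (if arm (S t \<omega>) = q then 1 else 0) + g (S t \<omega>) \<partial>BS)"
      by (simp add: g_def)
    also have "\<dots> = pull_prob q t + (\<integral>\<omega>. g (S t \<omega>) \<partial>BS)"
      unfolding pull_prob_def by (rule Bochner_Integration.integral_add[OF pull_integrable gi])
    also have "(\<integral>\<omega>. g (S t \<omega>) \<partial>BS) = (\<integral>\<omega>. f (S (Suc t) \<omega>) \<partial>BS)"
      using step_state[where f = f and t = t, OF f] by (simp only: g_def fe)
    also have "\<dots> = (\<integral>\<omega>. ec (nxt K) q n (S (Suc t) \<omega>) \<partial>BS)" by (simp only: f_def ok_sq if_True)
    finally show ?thesis .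
  qed
  have "(\<integral>\<omega>. ec (nxt K) q n (S t \<omega>) \<partial>BS) = (\<Sum>k<n. pull_prob q (t + k))" for n t
  proof (induction n arbitrary: t)
    case (Suc n)
    show ?case unfolding step Suc sum.lessThan_Suc_shift by simp
  qed simp
  from this[of T 0] show ?thesis
    using prob_space.prob_space[OF prob_BS] by simp
qed

lemma AE_coord:
  assumes "a < K"
  shows "AE \<omega> in BS. fst \<omega> (a, Suc t) \<in> {0..1}"
proof -
  have "AE x in PX. x (a, Suc t) \<in> {0..1}"
    by (rule AE_PiM_component[where P = "\<lambda>z. z \<in> {0..1}" and M = "\<lambda>p. D (fst p)"])
      (use assms AE_D[OF assms] in \<open>simp_all only: fst_conv\<close>, auto intro: D)
  moreover have "distr BS PX fst = PX"
    by (rule prob_space.distr_pair_fst[OF prob_PU])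
  ultimately have "AE x in distr BS PX fst. x (a, Suc t) \<in> {0..1}" by (simp only:)
  then show ?thesis by (rule AE_distrD[OF measurable_fst])
qed

lemma coord_integrable: "a < K \<Longrightarrow> integrable BS (\<lambda>\<omega>. fst \<omega> (a, Suc t))"
proof -
  assume a: "a < K"
  interpret prob_space BS by (rule prob_BS)
  show ?thesis
  proof (rule integrable_const_bound[where B = 1])
    show "AE \<omega> in BS. norm (fst \<omega> (a, Suc t)) \<le> 1" using AE_coord[OF a, of t] by eventually_elim simp
  qed (use coord_meas[OF a, of "Suc t"] in simp)
qed

lemma AE_S: "AE \<omega> in BS. fst \<omega> (arm (S t \<omega>), Suc t) \<in> {0..1}"
proof -
  have "AE \<omega> in BS. \<forall>a\<in>{..<K}. fst \<omega> (a, Suc t) \<in> {0..1}"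
    by (rule AE_finite_allI) (auto intro: AE_coord simp del: atLeastAtMost_iff)
  then show ?thesis by eventually_elim (use arm_sq in auto)
qed

lemma S_coord_meas: "(\<lambda>\<omega>. fst \<omega> (arm (S t \<omega>), Suc t)) \<in> borel_measurable BS"
  using state_meas[of "\<lambda>s \<omega>. fst \<omega> (arm s, Suc t)" borel t] coord_meas by simp

lemma S_coord_integrable: "integrable BS (\<lambda>\<omega>. fst \<omega> (arm (S t \<omega>), Suc t))"
proof -
  interpret prob_space BS by (rule prob_BS)
  show ?thesis
  proof (rule integrable_const_bound[where B = 1])
    show "AE \<omega> in BS. norm (fst \<omega> (arm (S t \<omega>), Suc t)) \<le> 1" using AE_S[of t] by eventually_elim simp
  qed (rule S_coord_meas)
qed

lemma clip_meas: "clip \<in> borel_measurable borel"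
  unfolding clip_def[abs_def] by measurable

lemma clip_mean: "a < K \<Longrightarrow> (\<integral>z. clip z \<partial>D a) = mean D a"
proof -
  assume a: "a < K"
  have "(\<lambda>z. z) \<in> borel_measurable (D a)" "clip \<in> borel_measurable (D a)"
    using clip_meas by (simp_all add: measurable_cong_sets[OF D(2)[OF a] refl])
  then show ?thesis unfolding mean_def
  proof (intro integral_cong_AE)
    show "AE z in D a. clip z = z" using AE_D[OF a] by eventually_elim (simp add: clip_def)
  qed
qed

lemma expected_coord: "a < K \<Longrightarrow> (\<integral>\<omega>. fst \<omega> (a, Suc t) \<partial>BS) = mean D a"
proof -
  assume a: "a < K"
  have cm: "(\<lambda>\<omega>. clip (fst \<omega> (a, Suc t))) \<in> borel_measurable BS"
    by (rule measurable_compose[OF coord_meas clip_meas]) (use a in auto)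
  have "(\<integral>\<omega>. fst \<omega> (a, Suc t) \<partial>BS) = (\<integral>\<omega>. clip (fst \<omega> (a, Suc t)) \<partial>BS)"
  proof (rule integral_cong_AE)
    show "AE \<omega> in BS. fst \<omega> (a, Suc t) = clip (fst \<omega> (a, Suc t))"
      using AE_coord[OF a, of t] by eventually_elim (simp add: clip_def)
  qed (use coord_meas[OF a, of "Suc t"] cm in simp_all)
  also have "\<dots> = (\<integral>u. (\<integral>x. (\<integral>z. clip z \<partial>D a) \<partial>PX) \<partial>PU)"
    using resample_X[of "(a, Suc t)" "\<lambda>\<omega>. clip (fst \<omega> (a, Suc t))" 1] a cm by (simp add: clip_def)
  also have "\<dots> = mean D a"
    using prob_space.prob_space[OF prob_PX] prob_space.prob_space[OF prob_PU] clip_mean[OF a] by simp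
  finally show ?thesis .
qed

lemma expected_reward:
  "(\<integral>\<omega>. fst \<omega> (arm (S t \<omega>), Suc t) \<partial>BS) = (\<Sum>a<K. mean D a * pull_prob a t)"
proof -
  have "(\<integral>\<omega>. fst \<omega> (arm (S t \<omega>), Suc t) \<partial>BS) = (\<integral>\<omega>. clip (fst \<omega> (arm (S t \<omega>), Suc t)) \<partial>BS)"
  proof (rule integral_cong_AE)
    show "AE \<omega> in BS. fst \<omega> (arm (S t \<omega>), Suc t) = clip (fst \<omega> (arm (S t \<omega>), Suc t))"
      using AE_S[of t] by eventually_elim (simp add: clip_def)
  qed (rule S_coord_meas, rule measurable_compose[OF S_coord_meas clip_meas])
  also have "\<dots> = (\<integral>\<omega>. (\<integral>z. clip z \<partial>D (arm (S t \<omega>))) \<partial>BS)"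
  proof (rule step_X[where \<phi> = "\<lambda>s. clip" and B = 1])
    show "\<bar>clip z\<bar> \<le> 1" for z by (simp add: clip_def)
  qed (rule clip_meas)
  also have "\<dots> = (\<integral>\<omega>. mean D (arm (S t \<omega>)) \<partial>BS)" using arm_sq by (simp add: clip_mean)
  also have "\<dots> = (\<integral>\<omega>. (\<Sum>a<K. mean D a * (if arm (S t \<omega>) = a then 1 else 0)) \<partial>BS)"
  proof -
    have "mean D (arm s) = (\<Sum>a<K. mean D a * (if arm s = a then 1 else 0))" if "arm s < K" for s
      using that by (simp add: mult_delta_right)
    from this[OF arm_sq] show ?thesis by (simp only:)
  qed
  also have "\<dots> = (\<Sum>a<K. \<integral>\<omega>. mean D a * (if arm (S t \<omega>) = a then 1 else 0) \<partial>BS)"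
    by (rule Bochner_Integration.integral_sum) (rule integrable_mult_right, rule pull_integrable)
  also have "\<dots> = (\<Sum>a<K. mean D a * pull_prob a t)"
    unfolding pull_prob_def by (simp only: integral_mult_right_zero)
  finally show ?thesis .
qed

lemma pull_prob_total: "(\<Sum>a<K. pull_prob a t) = 1"
proof -
  have "(\<Sum>a<K. pull_prob a t) = (\<integral>\<omega>. (\<Sum>a<K. if arm (S t \<omega>) = a then 1 else 0) \<partial>BS)"
    unfolding pull_prob_def
    by (rule Bochner_Integration.integral_sum[symmetric]) (rule pull_integrable)
  also have "\<dots> = 1" using arm_sq prob_space.prob_space[OF prob_BS] by simp
  finally show ?thesis .
qed

end

subsection \<open>The program\<close>

text \<open>Word 0 holds \<open>K\<close>, the words 1 to 16 hold the fields of the state in their order of declaration,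
  17 to 20 are scratch words and 21 to 27 hold the constants 1, 2, 4, 16, 128, 0, 0. The main loop starts
  at instruction 7. The program is cut into pieces of ten instructions since that makes it cheap for the
  simplifier to look up an instruction.\<close>

definition prog0 :: program where
  "prog0 =
  [Const 21 1, Const 22 2, Const 23 4, Const 24 16, Const 14 1,
   Const 16 16, Const 25 128, Pull 2 8 17, Rand 18 14, Jump_Less 27 1 20]"

definition prog1 :: program where
  "prog1 =
  [Add 19 2 22, Jump_Less 16 19 13, Jump 15, Mult 14 22 14, Mult 16 16 16,
   Add 19 2 21, Jump_Less 19 0 18, Jump 71, Add 2 2 21, Jump 101]"

definition prog2 :: program where
  "prog2 =
  [Jump_Less 21 15 24, Mult 14 22 14, Mult 16 16 16, Jump 71, Sub 15 15 21,
   Add 5 5 17, Jump_Less 21 3 28, Jump 30, Sub 3 3 21, Jump 101]"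

definition prog3 :: program where
  "prog3 =
  [Div 19 5 4, Jump_Less 1 22 63, Add 20 19 13, Jump_Less 20 9 47, Jump_Less 25 13 37,
   Jump_Less 22 1 42, Jump 69, Jump_Less 22 1 83, Add 20 6 21, Sub 20 20 7]"

definition prog4 :: program where
  "prog4 =
  [Jump_Less 18 20 69, Jump 83, Jump_Less 11 19 44, Jump 52, Add 10 2 27,
   Add 11 19 27, Jump 52, Jump_Less 22 1 49, Jump 52, Jump_Less 7 6 51]"

definition prog5 :: program where
  "prog5 =
  [Jump 52, Add 7 6 27, Add 20 2 21, Jump_Less 20 0 60, Const 1 1,
   Add 2 10 27, Mult 8 22 8, Const 9 0, Const 11 0, Jump 79]"

definition prog6 :: program where
  "prog6 =
  [Const 1 2, Add 2 20 27, Jump 79, Const 1 2, Add 10 2 27,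
   Const 2 0, Add 9 19 27, Add 11 19 27, Jump 79, Const 1 3]"

definition prog7 :: program where
  "prog7 =
  [Jump 79, Const 1 1, Const 2 0, Const 7 0, Const 8 256,
   Const 9 0, Const 10 0, Const 11 0, Add 15 16 27, Const 6 0]"

definition prog8 :: program where
  "prog8 =
  [Const 12 4096, Div 13 8 22, Jump 86, Add 6 6 21, Mult 12 23 12,
   Div 13 13 22, Const 5 0, Jump_Less 1 22 95, Jump_Less 22 1 99, Sub 20 7 6]"

definition prog9 :: program where
  "prog9 =
  [Sub 4 6 7, Add 20 20 4, Add 20 20 21, Mult 4 12 20, Jump 100,
   Mult 4 8 8, Div 4 4 24, Mult 4 4 14, Jump 100, Mult 4 12 14]"

definition prog10 :: program where
  "prog10 =
  [Add 3 4 27, Const 17 0, Const 18 0, Const 19 0, Const 20 0,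
   Jump 7]"

definition prog :: program where
  "prog = prog0 @ prog1 @ prog2 @ prog3 @ prog4 @ prog5 @ prog6 @ prog7 @ prog8 @ prog9 @ prog10"

lemma length_chunks:
  "length prog0 = 10"
  "length prog1 = 10"
  "length prog2 = 10"
  "length prog3 = 10"
  "length prog4 = 10"
  "length prog5 = 10"
  "length prog6 = 10"
  "length prog7 = 10"
  "length prog8 = 10"
  "length prog9 = 10"
  "length prog10 = 6"
  by (simp_all add: prog0_def prog1_def prog2_def prog3_def prog4_def prog5_def prog6_def prog7_def prog8_def prog9_def prog10_def)

lemma fetch_chunks:
  "prog0 ! 0 = Const 21 1"
  "prog0 ! Suc 0 = Const 22 2"
  "prog0 ! 2 = Const 23 4"
  "prog0 ! 3 = Const 24 16"
  "prog0 ! 4 = Const 14 1"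
  "prog0 ! 5 = Const 16 16"
  "prog0 ! 6 = Const 25 128"
  "prog0 ! 7 = Pull 2 8 17"
  "prog0 ! 8 = Rand 18 14"
  "prog0 ! 9 = Jump_Less 27 1 20"
  "prog1 ! 0 = Add 19 2 22"
  "prog1 ! Suc 0 = Jump_Less 16 19 13"
  "prog1 ! 2 = Jump 15"
  "prog1 ! 3 = Mult 14 22 14"
  "prog1 ! 4 = Mult 16 16 16"
  "prog1 ! 5 = Add 19 2 21"
  "prog1 ! 6 = Jump_Less 19 0 18"
  "prog1 ! 7 = Jump 71"
  "prog1 ! 8 = Add 2 2 21"
  "prog1 ! 9 = Jump 101"
  "prog2 ! 0 = Jump_Less 21 15 24"
  "prog2 ! Suc 0 = Mult 14 22 14"
  "prog2 ! 2 = Mult 16 16 16"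
  "prog2 ! 3 = Jump 71"
  "prog2 ! 4 = Sub 15 15 21"
  "prog2 ! 5 = Add 5 5 17"
  "prog2 ! 6 = Jump_Less 21 3 28"
  "prog2 ! 7 = Jump 30"
  "prog2 ! 8 = Sub 3 3 21"
  "prog2 ! 9 = Jump 101"
  "prog3 ! 0 = Div 19 5 4"
  "prog3 ! Suc 0 = Jump_Less 1 22 63"
  "prog3 ! 2 = Add 20 19 13"
  "prog3 ! 3 = Jump_Less 20 9 47"
  "prog3 ! 4 = Jump_Less 25 13 37"
  "prog3 ! 5 = Jump_Less 22 1 42"
  "prog3 ! 6 = Jump 69"
  "prog3 ! 7 = Jump_Less 22 1 83"
  "prog3 ! 8 = Add 20 6 21"
  "prog3 ! 9 = Sub 20 20 7"
  "prog4 ! 0 = Jump_Less 18 20 69"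
  "prog4 ! Suc 0 = Jump 83"
  "prog4 ! 2 = Jump_Less 11 19 44"
  "prog4 ! 3 = Jump 52"
  "prog4 ! 4 = Add 10 2 27"
  "prog4 ! 5 = Add 11 19 27"
  "prog4 ! 6 = Jump 52"
  "prog4 ! 7 = Jump_Less 22 1 49"
  "prog4 ! 8 = Jump 52"
  "prog4 ! 9 = Jump_Less 7 6 51"
  "prog5 ! 0 = Jump 52"
  "prog5 ! Suc 0 = Add 7 6 27"
  "prog5 ! 2 = Add 20 2 21"
  "prog5 ! 3 = Jump_Less 20 0 60"
  "prog5 ! 4 = Const 1 1"
  "prog5 ! 5 = Add 2 10 27"
  "prog5 ! 6 = Mult 8 22 8"
  "prog5 ! 7 = Const 9 0"
  "prog5 ! 8 = Const 11 0"
  "prog5 ! 9 = Jump 79"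
  "prog6 ! 0 = Const 1 2"
  "prog6 ! Suc 0 = Add 2 20 27"
  "prog6 ! 2 = Jump 79"
  "prog6 ! 3 = Const 1 2"
  "prog6 ! 4 = Add 10 2 27"
  "prog6 ! 5 = Const 2 0"
  "prog6 ! 6 = Add 9 19 27"
  "prog6 ! 7 = Add 11 19 27"
  "prog6 ! 8 = Jump 79"
  "prog6 ! 9 = Const 1 3"
  "prog7 ! 0 = Jump 79"
  "prog7 ! Suc 0 = Const 1 1"
  "prog7 ! 2 = Const 2 0"
  "prog7 ! 3 = Const 7 0"
  "prog7 ! 4 = Const 8 256"
  "prog7 ! 5 = Const 9 0"
  "prog7 ! 6 = Const 10 0"
  "prog7 ! 7 = Const 11 0"
  "prog7 ! 8 = Add 15 16 27"
  "prog7 ! 9 = Const 6 0"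
  "prog8 ! 0 = Const 12 4096"
  "prog8 ! Suc 0 = Div 13 8 22"
  "prog8 ! 2 = Jump 86"
  "prog8 ! 3 = Add 6 6 21"
  "prog8 ! 4 = Mult 12 23 12"
  "prog8 ! 5 = Div 13 13 22"
  "prog8 ! 6 = Const 5 0"
  "prog8 ! 7 = Jump_Less 1 22 95"
  "prog8 ! 8 = Jump_Less 22 1 99"
  "prog8 ! 9 = Sub 20 7 6"
  "prog9 ! 0 = Sub 4 6 7"
  "prog9 ! Suc 0 = Add 20 20 4"
  "prog9 ! 2 = Add 20 20 21"
  "prog9 ! 3 = Mult 4 12 20"
  "prog9 ! 4 = Jump 100"
  "prog9 ! 5 = Mult 4 8 8"
  "prog9 ! 6 = Div 4 4 24"
  "prog9 ! 7 = Mult 4 4 14"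
  "prog9 ! 8 = Jump 100"
  "prog9 ! 9 = Mult 4 12 14"
  "prog10 ! 0 = Add 3 4 27"
  "prog10 ! Suc 0 = Const 17 0"
  "prog10 ! 2 = Const 18 0"
  "prog10 ! 3 = Const 19 0"
  "prog10 ! 4 = Const 20 0"
  "prog10 ! 5 = Jump 7"
  by (simp_all add: prog0_def prog1_def prog2_def prog3_def prog4_def prog5_def prog6_def prog7_def prog8_def prog9_def prog10_def)

lemma fetch:
  "prog ! 0 = Const 21 1"
  "prog ! 1 = Const 22 2"
  "prog ! 2 = Const 23 4"
  "prog ! 3 = Const 24 16"
  "prog ! 4 = Const 14 1"
  "prog ! 5 = Const 16 16"
  "prog ! 6 = Const 25 128"
  "prog ! 7 = Pull 2 8 17"
  "prog ! 8 = Rand 18 14"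
  "prog ! 9 = Jump_Less 27 1 20"
  "prog ! 10 = Add 19 2 22"
  "prog ! 11 = Jump_Less 16 19 13"
  "prog ! 12 = Jump 15"
  "prog ! 13 = Mult 14 22 14"
  "prog ! 14 = Mult 16 16 16"
  "prog ! 15 = Add 19 2 21"
  "prog ! 16 = Jump_Less 19 0 18"
  "prog ! 17 = Jump 71"
  "prog ! 18 = Add 2 2 21"
  "prog ! 19 = Jump 101"
  "prog ! 20 = Jump_Less 21 15 24"
  "prog ! 21 = Mult 14 22 14"
  "prog ! 22 = Mult 16 16 16"
  "prog ! 23 = Jump 71"
  "prog ! 24 = Sub 15 15 21"
  "prog ! 25 = Add 5 5 17"
  "prog ! 26 = Jump_Less 21 3 28"
  "prog ! 27 = Jump 30"
  "prog ! 28 = Sub 3 3 21"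
  "prog ! 29 = Jump 101"
  "prog ! 30 = Div 19 5 4"
  "prog ! 31 = Jump_Less 1 22 63"
  "prog ! 32 = Add 20 19 13"
  "prog ! 33 = Jump_Less 20 9 47"
  "prog ! 34 = Jump_Less 25 13 37"
  "prog ! 35 = Jump_Less 22 1 42"
  "prog ! 36 = Jump 69"
  "prog ! 37 = Jump_Less 22 1 83"
  "prog ! 38 = Add 20 6 21"
  "prog ! 39 = Sub 20 20 7"
  "prog ! 40 = Jump_Less 18 20 69"
  "prog ! 41 = Jump 83"
  "prog ! 42 = Jump_Less 11 19 44"
  "prog ! 43 = Jump 52"
  "prog ! 44 = Add 10 2 27"
  "prog ! 45 = Add 11 19 27"
  "prog ! 46 = Jump 52"
  "prog ! 47 = Jump_Less 22 1 49"
  "prog ! 48 = Jump 52"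
  "prog ! 49 = Jump_Less 7 6 51"
  "prog ! 50 = Jump 52"
  "prog ! 51 = Add 7 6 27"
  "prog ! 52 = Add 20 2 21"
  "prog ! 53 = Jump_Less 20 0 60"
  "prog ! 54 = Const 1 1"
  "prog ! 55 = Add 2 10 27"
  "prog ! 56 = Mult 8 22 8"
  "prog ! 57 = Const 9 0"
  "prog ! 58 = Const 11 0"
  "prog ! 59 = Jump 79"
  "prog ! 60 = Const 1 2"
  "prog ! 61 = Add 2 20 27"
  "prog ! 62 = Jump 79"
  "prog ! 63 = Const 1 2"
  "prog ! 64 = Add 10 2 27"
  "prog ! 65 = Const 2 0"
  "prog ! 66 = Add 9 19 27"
  "prog ! 67 = Add 11 19 27"
  "prog ! 68 = Jump 79"
  "prog ! 69 = Const 1 3"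
  "prog ! 70 = Jump 79"
  "prog ! 71 = Const 1 1"
  "prog ! 72 = Const 2 0"
  "prog ! 73 = Const 7 0"
  "prog ! 74 = Const 8 256"
  "prog ! 75 = Const 9 0"
  "prog ! 76 = Const 10 0"
  "prog ! 77 = Const 11 0"
  "prog ! 78 = Add 15 16 27"
  "prog ! 79 = Const 6 0"
  "prog ! 80 = Const 12 4096"
  "prog ! 81 = Div 13 8 22"
  "prog ! 82 = Jump 86"
  "prog ! 83 = Add 6 6 21"
  "prog ! 84 = Mult 12 23 12"
  "prog ! 85 = Div 13 13 22"
  "prog ! 86 = Const 5 0"
  "prog ! 87 = Jump_Less 1 22 95"
  "prog ! 88 = Jump_Less 22 1 99"
  "prog ! 89 = Sub 20 7 6"
  "prog ! 90 = Sub 4 6 7"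
  "prog ! 91 = Add 20 20 4"
  "prog ! 92 = Add 20 20 21"
  "prog ! 93 = Mult 4 12 20"
  "prog ! 94 = Jump 100"
  "prog ! 95 = Mult 4 8 8"
  "prog ! 96 = Div 4 4 24"
  "prog ! 97 = Mult 4 4 14"
  "prog ! 98 = Jump 100"
  "prog ! 99 = Mult 4 12 14"
  "prog ! 100 = Add 3 4 27"
  "prog ! 101 = Const 17 0"
  "prog ! 102 = Const 18 0"
  "prog ! 103 = Const 19 0"
  "prog ! 104 = Const 20 0"
  "prog ! 105 = Jump 7"
  by (simp_all add: prog_def nth_append length_chunks fetch_chunks)

lemma length_prog: "length prog = 106" by (simp add: prog_def length_chunks)

section \<open>Correspondence of memory and state, and symbolic execution\<close>

definition rel :: "nat \<Rightarrow> st \<Rightarrow> (nat \<Rightarrow> nat) \<Rightarrow> bool" where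
  "rel K s w \<longleftrightarrow> w 0 = K \<and> w 1 = md s \<and> w 2 = arm s \<and> w 3 = cnt s \<and> w 4 = len s \<and> w 5 = acc s \<and>
     w 6 = lev s \<and> w 7 = gl s \<and> w 8 = prec s \<and> w 9 = bm s \<and> w 10 = cnd s \<and> w 11 = cbst s \<and>
     w 12 = bj s \<and> w 13 = thr s \<and> w 14 = lm s \<and> w 15 = tau s \<and> w 16 = hor s \<and>
     w 21 = 1 \<and> w 22 = 2 \<and> w 23 = 4 \<and> w 24 = 16 \<and> w 25 = 128 \<and> w 26 = 0 \<and> w 27 = 0"

text \<open>With the scratch words erased, bounds on the fields of the state bound all words in use
  at the head of the loop.\<close>

definition clean :: "(nat \<Rightarrow> nat) \<Rightarrow> bool" where
  "clean w \<longleftrightarrow> w 17 = 0 \<and> w 18 = 0 \<and> w 19 = 0 \<and> w 20 = 0"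

lemma assign_simps [simp]:
  "pc (assign a v c) = Suc (pc c)" "mem (assign a v c) = (mem c)(a := v)" "time (assign a v c) = time c"
  "last_arm (assign a v c) = last_arm c" "draws (assign a v c) = draws c"
  by (simp_all add: assign_def)

context
  fixes K :: nat and x :: "nat \<times> nat \<Rightarrow> real" and u :: "nat \<Rightarrow> real"
begin

abbreviation "stp \<equiv> Defs.step prog x u"

text \<open>From instruction \<open>p\<close> with memory \<open>w\<close>, the program reaches the head of the loop with state \<open>s\<close> in memory,
  without pulling an arm. All jumps up to there lead forward, hence the bound on the number of steps.\<close>

definition fin :: "nat \<Rightarrow> (nat \<Rightarrow> nat) \<Rightarrow> st \<Rightarrow> bool" where
  "fin p w s \<longleftrightarrow> (\<forall>c :: config. pc c = p \<longrightarrow> mem c = w \<longrightarrow> (\<exists>k \<le> 106 - p.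
     pc ((stp ^^ k) c) = 7 \<and> rel K s (mem ((stp ^^ k) c)) \<and> clean (mem ((stp ^^ k) c)) \<and>
     draws ((stp ^^ k) c) = draws c \<and>
     (\<forall>i\<le>k. time ((stp ^^ i) c) = time c \<and> last_arm ((stp ^^ i) c) = last_arm c)))"

lemma stp: "pc (c :: config) < 106 \<Longrightarrow> stp c = exec x u (prog ! pc c) c"
  by (simp add: Defs.step_def length_prog)

text \<open>Execution is followed backwards: what is known from \<open>p'\<close> on is extended by
  one instruction, and as \<open>p < p'\<close> the additional step fits into the bound
  \<open>106 - p\<close>.\<close>

lemma fin_next:
  assumes f: "fin p' w' s" and p: "p < p'" "p' < 106" "p \<noteq> 7"
    and c: "\<And>c :: config. pc c = p \<Longrightarrow> mem c = w \<Longrightarrow> pc (stp c) = p' \<and> mem (stp c) = w' \<and> time (stp c) = time c \<and>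
      last_arm (stp c) = last_arm c \<and> draws (stp c) = draws c"
  shows "fin p w s"
  unfolding fin_def
proof (intro allI impI)
  fix c :: config assume pc: "pc c = p" "mem c = w"
  let ?d = "stp c"
  have d: "pc ?d = p'" "mem ?d = w'" "time ?d = time c" "last_arm ?d = last_arm c" "draws ?d = draws c"
    using c[OF pc] by auto
  obtain k where k: "k \<le> 106 - p'" "pc ((stp ^^ k) ?d) = 7" "rel K s (mem ((stp ^^ k) ?d))"
    "clean (mem ((stp ^^ k) ?d))" "draws ((stp ^^ k) ?d) = draws ?d"
    "\<forall>i\<le>k. time ((stp ^^ i) ?d) = time ?d \<and> last_arm ((stp ^^ i) ?d) = last_arm ?d"
    using f d(1,2) unfolding fin_def by blast
  have e: "(stp ^^ Suc i) c = (stp ^^ i) ?d" for i by (simp only: funpow_Suc_right comp_apply)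
  have "time ((stp ^^ i) c) = time c \<and> last_arm ((stp ^^ i) c) = last_arm c" if "i \<le> Suc k" for i
    using that k(6) d e by (cases i) (auto simp del: funpow.simps(2))
  then show "\<exists>k\<le>106 - p. pc ((stp ^^ k) c) = 7 \<and> rel K s (mem ((stp ^^ k) c)) \<and> clean (mem ((stp ^^ k) c)) \<and>
     draws ((stp ^^ k) c) = draws c \<and>
     (\<forall>i\<le>k. time ((stp ^^ i) c) = time c \<and> last_arm ((stp ^^ i) c) = last_arm c)"
    using k d p by (intro exI[of _ "Suc k"]) (simp only: e, auto)
qed

lemma fin_Const: "prog ! p = Const a k \<Longrightarrow> p \<noteq> 7 \<Longrightarrow> Suc p < 106 \<Longrightarrow> fin (Suc p) (w(a := k)) s \<Longrightarrow> fin p w s"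
  by (rule fin_next) (auto simp: stp)

lemma fin_Add: "prog ! p = Add a b d \<Longrightarrow> p \<noteq> 7 \<Longrightarrow> Suc p < 106 \<Longrightarrow> fin (Suc p) (w(a := w b + w d)) s \<Longrightarrow> fin p w s"
  by (rule fin_next) (auto simp: stp)

lemma fin_Sub: "prog ! p = Sub a b d \<Longrightarrow> p \<noteq> 7 \<Longrightarrow> Suc p < 106 \<Longrightarrow> fin (Suc p) (w(a := w b - w d)) s \<Longrightarrow> fin p w s"
  by (rule fin_next) (auto simp: stp)

lemma fin_Mult: "prog ! p = Mult a b d \<Longrightarrow> p \<noteq> 7 \<Longrightarrow> Suc p < 106 \<Longrightarrow> fin (Suc p) (w(a := w b * w d)) s \<Longrightarrow> fin p w s"
  by (rule fin_next) (auto simp: stp)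

lemma fin_Div: "prog ! p = Div a b d \<Longrightarrow> p \<noteq> 7 \<Longrightarrow> Suc p < 106 \<Longrightarrow> fin (Suc p) (w(a := w b div w d)) s \<Longrightarrow> fin p w s"
  by (rule fin_next) (auto simp: stp)

lemma fin_Jump: "prog ! p = Jump l \<Longrightarrow> p \<noteq> 7 \<Longrightarrow> l < 106 \<Longrightarrow> p < l \<Longrightarrow> fin l w s \<Longrightarrow> fin p w s"
  by (rule fin_next) (auto simp: stp)

lemma fin_Jump_Less: "prog ! p = Jump_Less a b l \<Longrightarrow> p \<noteq> 7 \<Longrightarrow> Suc p < 106 \<Longrightarrow> l < 106 \<Longrightarrow> p < l \<Longrightarrow>
    (w a < w b \<Longrightarrow> fin l w s) \<Longrightarrow> (\<not> w a < w b \<Longrightarrow> fin (Suc p) w s) \<Longrightarrow> fin p w s"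
  by (cases "w a < w b"; rule fin_next) (auto simp: stp)

text \<open>The fact \<open>run(n)\<close> belongs to instruction \<open>n + 8\<close>.\<close>

lemmas run =
  fin_Jump_Less[OF fetch(10), simplified]  fin_Add[OF fetch(11), simplified]
  fin_Jump_Less[OF fetch(12), simplified]  fin_Jump[OF fetch(13), simplified]
  fin_Mult[OF fetch(14), simplified]  fin_Mult[OF fetch(15), simplified]
  fin_Add[OF fetch(16), simplified]  fin_Jump_Less[OF fetch(17), simplified]
  fin_Jump[OF fetch(18), simplified]  fin_Add[OF fetch(19), simplified]
  fin_Jump[OF fetch(20), simplified]  fin_Jump_Less[OF fetch(21), simplified]
  fin_Mult[OF fetch(22), simplified]  fin_Mult[OF fetch(23), simplified]
  fin_Jump[OF fetch(24), simplified]  fin_Sub[OF fetch(25), simplified]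
  fin_Add[OF fetch(26), simplified]  fin_Jump_Less[OF fetch(27), simplified]
  fin_Jump[OF fetch(28), simplified]  fin_Sub[OF fetch(29), simplified]
  fin_Jump[OF fetch(30), simplified]  fin_Div[OF fetch(31), simplified]
  fin_Jump_Less[OF fetch(32), simplified]  fin_Add[OF fetch(33), simplified]
  fin_Jump_Less[OF fetch(34), simplified]  fin_Jump_Less[OF fetch(35), simplified]
  fin_Jump_Less[OF fetch(36), simplified]  fin_Jump[OF fetch(37), simplified]
  fin_Jump_Less[OF fetch(38), simplified]  fin_Add[OF fetch(39), simplified]
  fin_Sub[OF fetch(40), simplified]  fin_Jump_Less[OF fetch(41), simplified]
  fin_Jump[OF fetch(42), simplified]  fin_Jump_Less[OF fetch(43), simplified]
  fin_Jump[OF fetch(44), simplified]  fin_Add[OF fetch(45), simplified]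
  fin_Add[OF fetch(46), simplified]  fin_Jump[OF fetch(47), simplified]
  fin_Jump_Less[OF fetch(48), simplified]  fin_Jump[OF fetch(49), simplified]
  fin_Jump_Less[OF fetch(50), simplified]  fin_Jump[OF fetch(51), simplified]
  fin_Add[OF fetch(52), simplified]  fin_Add[OF fetch(53), simplified]
  fin_Jump_Less[OF fetch(54), simplified]  fin_Const[OF fetch(55), simplified]
  fin_Add[OF fetch(56), simplified]  fin_Mult[OF fetch(57), simplified]
  fin_Const[OF fetch(58), simplified]  fin_Const[OF fetch(59), simplified]
  fin_Jump[OF fetch(60), simplified]  fin_Const[OF fetch(61), simplified]
  fin_Add[OF fetch(62), simplified]  fin_Jump[OF fetch(63), simplified]
  fin_Const[OF fetch(64), simplified]  fin_Add[OF fetch(65), simplified]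
  fin_Const[OF fetch(66), simplified]  fin_Add[OF fetch(67), simplified]
  fin_Add[OF fetch(68), simplified]  fin_Jump[OF fetch(69), simplified]
  fin_Const[OF fetch(70), simplified]  fin_Jump[OF fetch(71), simplified]
  fin_Const[OF fetch(72), simplified]  fin_Const[OF fetch(73), simplified]
  fin_Const[OF fetch(74), simplified]  fin_Const[OF fetch(75), simplified]
  fin_Const[OF fetch(76), simplified]  fin_Const[OF fetch(77), simplified]
  fin_Const[OF fetch(78), simplified]  fin_Add[OF fetch(79), simplified]
  fin_Const[OF fetch(80), simplified]  fin_Const[OF fetch(81), simplified]
  fin_Div[OF fetch(82), simplified]  fin_Jump[OF fetch(83), simplified]
  fin_Add[OF fetch(84), simplified]  fin_Mult[OF fetch(85), simplified]
  fin_Div[OF fetch(86), simplified]  fin_Const[OF fetch(87), simplified]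
  fin_Jump_Less[OF fetch(88), simplified]  fin_Jump_Less[OF fetch(89), simplified]
  fin_Sub[OF fetch(90), simplified]  fin_Sub[OF fetch(91), simplified]
  fin_Add[OF fetch(92), simplified]  fin_Add[OF fetch(93), simplified]
  fin_Mult[OF fetch(94), simplified]  fin_Jump[OF fetch(95), simplified]
  fin_Mult[OF fetch(96), simplified]  fin_Div[OF fetch(97), simplified]
  fin_Mult[OF fetch(98), simplified]  fin_Jump[OF fetch(99), simplified]
  fin_Mult[OF fetch(100), simplified]  fin_Add[OF fetch(101), simplified]
  fin_Const[OF fetch(102), simplified]  fin_Const[OF fetch(103), simplified]
  fin_Const[OF fetch(104), simplified]  fin_Const[OF fetch(105), simplified]

lemma fin_end:
  assumes "rel K s w" "clean w"
  shows "fin 105 w s"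
  unfolding fin_def
proof (intro allI impI)
  fix c :: config assume c: "pc c = 105" "mem c = w"
  have "stp c = c\<lparr>pc := 7\<rparr>" using c by (simp add: stp fetch)
  then show "\<exists>k\<le>106 - 105. pc ((stp ^^ k) c) = 7 \<and> rel K s (mem ((stp ^^ k) c)) \<and> clean (mem ((stp ^^ k) c)) \<and>
     draws ((stp ^^ k) c) = draws c \<and>
     (\<forall>i\<le>k. time ((stp ^^ i) c) = time c \<and> last_arm ((stp ^^ i) c) = last_arm c)"
    using assms c by (intro exI[of _ 1]) (auto simp: le_Suc_eq)
qed

text \<open>The functions of the automaton are executed symbolically from the end of the program to
  its beginning, so that each segment runs into one already treated.\<close>

lemma seg_clean:
  assumes "rel K s w"
  shows "fin 101 w s"
  by (intro run(93-96) fin_end) (use assms in \<open>simp_all add: rel_def clean_def\<close>)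

lemma seg_setlen:
  assumes "rel K s w" "md s \<noteq> 0"
  shows "fin 86 w (setlen s)"
  by (intro run(78-92) seg_clean)
    (use assms in \<open>auto simp: rel_def setlen_def Let_def wt_def\<close>)

lemma seg_reset:
  assumes "rel K s w" "md s \<noteq> 0"
  shows "fin 79 w (reset s)"
  unfolding reset_def
  by (intro run(71-74) seg_setlen) (simp_all add: assms[unfolded rel_def, simplified] rel_def)

lemma seg_adv:
  assumes "rel K s w" "md s \<noteq> 0"
  shows "fin 83 w (adv s)"
  unfolding adv_def
  by (intro run(75-77) seg_setlen) (simp_all add: assms[unfolded rel_def, simplified] rel_def)

lemma seg_next:
  assumes "rel K s w"
  shows "fin 52 w (next_arm K s)"
proof (cases "Suc (arm s) < K")
  case True
  then have e: "next_arm K s = reset (s\<lparr>md := 2, arm := Suc (arm s)\<rparr>)" by (simp add: next_arm_def)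
  show ?thesis unfolding e
    by (intro run(44-45) run(52-54) seg_reset) (use True in \<open>simp_all add: assms[unfolded rel_def, simplified] rel_def\<close>)
next
  case False
  then have e: "next_arm K s = reset (s\<lparr>md := 1, arm := cnd s, prec := 2 * prec s, bm := 0, cbst := 0\<rparr>)"
    by (simp add: next_arm_def)
  show ?thesis unfolding e
    by (intro run(44-51) seg_reset) (use False in \<open>simp_all add: assms[unfolded rel_def, simplified] rel_def\<close>)
qed

lemma seg_epoch:
  assumes "rel K s w"
  shows "fin 71 w (start_epoch s)"
  unfolding start_epoch_def
  by (intro run(63-70) seg_reset) (simp_all add: assms[unfolded rel_def, simplified] rel_def)

lemma seg_bend:
  assumes r: "rel K s w" "md s \<noteq> 0" "w 18 = v"
  shows "fin 30 w (bend K s v)"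
proof -
  let ?e = "acc s div len s"
  consider (a) "md s = 1"
    | (b) "md s = 2" "?e + thr s < bm s"
    | (c) "md s = 2" "\<not> ?e + thr s < bm s" "128 < thr s" "\<not> v < Suc (lev s) - gl s"
    | (d) "md s = 2" "\<not> ?e + thr s < bm s" "128 < thr s" "v < Suc (lev s) - gl s"
    | (d') "md s = 2" "\<not> ?e + thr s < bm s" "\<not> 128 < thr s"
    | (e) "2 < md s" "?e + thr s < bm s" "gl s < lev s"
    | (e') "2 < md s" "?e + thr s < bm s" "\<not> gl s < lev s"
    | (f) "2 < md s" "\<not> ?e + thr s < bm s" "128 < thr s"
    | (g) "2 < md s" "\<not> ?e + thr s < bm s" "\<not> 128 < thr s" "cbst s < ?e"
    | (g') "2 < md s" "\<not> ?e + thr s < bm s" "\<not> 128 < thr s" "\<not> cbst s < ?e"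
  proof -
    have "md s = 1 \<or> md s = 2 \<or> 2 < md s" using r(2) by linarith
    then show thesis using that by blast
  qed
  then show ?thesis
  proof cases
    case a
    then have e: "bend K s v = reset (s\<lparr>md := 2, arm := 0, bm := ?e, cnd := arm s, cbst := ?e\<rparr>)"
      by (simp add: bend_def Let_def)
    show ?thesis unfolding e
      by (intro run(22-23) run(55-60) seg_reset) (use a in \<open>simp_all add: r[unfolded rel_def, simplified] rel_def\<close>)
  next
    case b
    then have e: "bend K s v = next_arm K s" by (simp add: bend_def Let_def)
    show ?thesis unfolding e
      by (intro run(22-25) run(39-40) seg_next) (use b in \<open>simp_all add: r[unfolded rel_def, simplified] rel_def\<close>)
  next
    case c
    then have e: "bend K s v = adv s" by (simp add: bend_def Let_def)
    show ?thesis unfolding e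
      by (intro run(22-26) run(29-33) seg_adv) (use c in \<open>simp_all add: r[unfolded rel_def, simplified] rel_def\<close>)
  next
    case d
    then have e: "bend K s v = reset (s\<lparr>md := 3\<rparr>)" by (simp add: bend_def Let_def)
    show ?thesis unfolding e
      by (intro run(22-26) run(29-32) run(61-62) seg_reset) (use d in \<open>simp_all add: r[unfolded rel_def, simplified] rel_def\<close>)
  next
    case d'
    then have e: "bend K s v = reset (s\<lparr>md := 3\<rparr>)" by (simp add: bend_def Let_def)
    show ?thesis unfolding e
      by (intro run(22-28) run(61-62) seg_reset) (use d' in \<open>simp_all add: r[unfolded rel_def, simplified] rel_def\<close>)
  next
    case e
    then have e': "bend K s v = next_arm K (s\<lparr>gl := lev s\<rparr>)" by (simp add: bend_def Let_def)
    show ?thesis unfolding e'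
      by (intro run(22-25) run(39) run(41) run(43) seg_next) (use e in \<open>simp_all add: r[unfolded rel_def, simplified] rel_def\<close>)
  next
    case e'
    then have e: "bend K s v = next_arm K (s\<lparr>gl := gl s\<rparr>)" by (simp add: bend_def Let_def)
    show ?thesis unfolding e
      by (intro run(22-25) run(39) run(41-42) seg_next) (use e' in \<open>simp_all add: r[unfolded rel_def, simplified] rel_def\<close>)
  next
    case f
    then have e: "bend K s v = adv s" by (simp add: bend_def Let_def)
    show ?thesis unfolding e
      by (intro run(22-26) run(29) seg_adv) (use f in \<open>simp_all add: r[unfolded rel_def, simplified] rel_def\<close>)
  next
    case g
    then have e: "bend K s v = next_arm K (s\<lparr>cnd := arm s, cbst := ?e\<rparr>)" by (simp add: bend_def Let_def)
    show ?thesis unfolding e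
      by (intro run(22-27) run(34) run(36-38) seg_next) (use g in \<open>simp_all add: r[unfolded rel_def, simplified] rel_def\<close>)
  next
    case g'
    then have e: "bend K s v = next_arm K s" by (simp add: bend_def Let_def)
    show ?thesis unfolding e
      by (intro run(22-27) run(34-35) seg_next) (use g' in \<open>simp_all add: r[unfolded rel_def, simplified] rel_def\<close>)
  qed
qed

lemma seg_kstep:
  assumes r: "rel K s w" "md s \<noteq> 0" "w 17 = y" "w 18 = v"
  shows "fin 24 w (kstep K (s\<lparr>tau := tau s - 1\<rparr>) y v)"
proof (cases "1 < cnt s")
  case True
  then have e: "kstep K (s\<lparr>tau := tau s - 1\<rparr>) y v = s\<lparr>tau := tau s - 1, acc := acc s + y, cnt := cnt s - 1\<rparr>"
    by (simp add: kstep_def Let_def)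
  show ?thesis unfolding e
    by (intro run(16-18) run(20-21) seg_clean) (use True in \<open>simp_all add: r[unfolded rel_def, simplified] rel_def\<close>)
next
  case False
  then have e: "kstep K (s\<lparr>tau := tau s - 1\<rparr>) y v = bend K (s\<lparr>tau := tau s - 1, acc := acc s + y\<rparr>) v"
    by (simp add: kstep_def Let_def)
  show ?thesis unfolding e
    by (intro run(16-19) seg_bend) (use False in \<open>simp_all add: r[unfolded rel_def, simplified] rel_def\<close>)
qed

lemma seg_nxt:
  assumes r: "rel K s w" "w 17 = y" "w 18 = v"
  shows "fin 9 w (nxt K s y v)"
proof -
  let ?d = "s\<lparr>lm := 2 * lm s, hor := hor s * hor s\<rparr>"
  consider (a) "md s \<noteq> 0" "1 < tau s" | (b) "md s \<noteq> 0" "\<not> 1 < tau s"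
    | (c) "md s = 0" "hor s < arm s + 2" "Suc (arm s) < K" | (d) "md s = 0" "hor s < arm s + 2" "\<not> Suc (arm s) < K"
    | (e) "md s = 0" "\<not> hor s < arm s + 2" "Suc (arm s) < K" | (f) "md s = 0" "\<not> hor s < arm s + 2" "\<not> Suc (arm s) < K"
    by blast
  then show ?thesis
  proof cases
    case a
    then have e: "nxt K s y v = kstep K (s\<lparr>tau := tau s - 1\<rparr>) y v" by (simp add: nxt_def)
    show ?thesis unfolding e
      by (intro run(1) run(12) seg_kstep) (use a in \<open>simp_all add: r[unfolded rel_def, simplified] rel_def\<close>)
  next
    case b
    then have e: "nxt K s y v = start_epoch ?d" by (simp add: nxt_def)
    show ?thesis unfolding e
      by (intro run(1) run(12-15) seg_epoch) (use b in \<open>simp_all add: r[unfolded rel_def, simplified] rel_def\<close>)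
  next
    case c
    then have e: "nxt K s y v = ?d\<lparr>arm := Suc (arm s)\<rparr>" by (simp add: nxt_def Let_def)
    show ?thesis unfolding e
      by (intro run(1-3) run(5-8) run(10-11) seg_clean) (use c in \<open>simp_all add: r[unfolded rel_def, simplified] rel_def\<close>)
  next
    case d
    then have e: "nxt K s y v = start_epoch ?d" by (simp add: nxt_def Let_def)
    show ?thesis unfolding e
      by (intro run(1-3) run(5-9) seg_epoch) (use d in \<open>simp_all add: r[unfolded rel_def, simplified] rel_def\<close>)
  next
    case e
    then have e': "nxt K s y v = s\<lparr>arm := Suc (arm s)\<rparr>" by (simp add: nxt_def Let_def)
    show ?thesis unfolding e'
      by (intro run(1-4) run(7-8) run(10-11) seg_clean) (use e in \<open>simp_all add: r[unfolded rel_def, simplified] rel_def\<close>)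
  next
    case f
    then have e: "nxt K s y v = start_epoch s" by (simp add: nxt_def Let_def)
    show ?thesis unfolding e
      by (intro run(1-4) run(7-9) seg_epoch) (use f in \<open>simp_all add: r[unfolded rel_def, simplified] rel_def\<close>)
  qed
qed

section \<open>Iterations of the loop and the clock\<close>

definition head :: "nat \<Rightarrow> config \<Rightarrow> bool" where
  "head t c \<longleftrightarrow> pc c = 7 \<and> rel K (sq K x u t) (mem c) \<and> clean (mem c) \<and> time c = t \<and> draws c = t"

lemma main_loop:
  assumes "head t c"
  shows "\<exists>k. 1 \<le> k \<and> k \<le> 100 \<and> head (Suc t) ((stp ^^ k) c) \<and>
    (\<forall>i. 1 \<le> i \<and> i \<le> k \<longrightarrow> time ((stp ^^ i) c) = Suc t \<and> last_arm ((stp ^^ i) c) = arm (sq K x u t))"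
proof -
  let ?s = "sq K x u t"
  let ?y = "nat \<lfloor>x (arm ?s, Suc t) * real (prec ?s)\<rfloor>" and ?v = "nat \<lfloor>u t * real (lm ?s)\<rfloor>"
  have c: "pc c = 7" "rel K ?s (mem c)" "time c = t" "draws c = t"
    using assms by (simp_all add: head_def)
  note w = c(2)[unfolded rel_def, simplified]
  define c1 where "c1 = stp c"
  define c2 where "c2 = stp c1"
  have "c1 = (assign 17 ?y c)\<lparr>time := Suc t, last_arm := arm ?s\<rparr>"
    unfolding c1_def using c(1,3) by (simp add: stp fetch w)
  then have c1: "pc c1 = 8" "mem c1 = (mem c)(17 := ?y)" "time c1 = Suc t" "last_arm c1 = arm ?s" "draws c1 = t"
    using c by (simp_all add: assign_def)
  have "c2 = (assign 18 ?v c1)\<lparr>draws := Suc t\<rparr>"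
    unfolding c2_def using c1 by (simp add: stp fetch w)
  then have c2: "pc c2 = 9" "mem c2 = (mem c)(17 := ?y, 18 := ?v)" "time c2 = Suc t" "last_arm c2 = arm ?s" "draws c2 = Suc t"
    using c1 by (simp_all add: assign_def)
  have "fin 9 (mem c2) (nxt K ?s ?y ?v)"
    by (rule seg_nxt) (use c(2) in \<open>simp_all add: c2 rel_def\<close>)
  then obtain k where k: "k \<le> 106 - 9" "pc ((stp ^^ k) c2) = 7" "rel K (nxt K ?s ?y ?v) (mem ((stp ^^ k) c2))"
    "clean (mem ((stp ^^ k) c2))" "draws ((stp ^^ k) c2) = draws c2"
    "\<forall>i\<le>k. time ((stp ^^ i) c2) = time c2 \<and> last_arm ((stp ^^ i) c2) = last_arm c2"
    using c2(1) unfolding fin_def by blast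
  have e: "(stp ^^ Suc (Suc i)) c = (stp ^^ i) c2" for i
    by (simp only: funpow_Suc_right comp_apply c1_def c2_def)
  have "time ((stp ^^ i) c) = Suc t \<and> last_arm ((stp ^^ i) c) = arm ?s" if "1 \<le> i" "i \<le> Suc (Suc k)" for i
  proof (cases "i = 1")
    case True
    then show ?thesis using c1 by (simp add: c1_def)
  next
    case False
    then have i: "i = Suc (Suc (i - 2))" "i - 2 \<le> k" using that by auto
    have "(stp ^^ i) c = (stp ^^ (i - 2)) c2" by (subst i(1)) (rule e)
    then show ?thesis using k(6) i(2) c2 by simp
  qed
  moreover have "head (Suc t) ((stp ^^ Suc (Suc k)) c)"
    unfolding e head_def using k c2 by (simp add: Let_def)
  \<comment> \<open>Two steps for pull and seed and at most 97 from instruction 9 on stay below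
    100.\<close>
  ultimately show ?thesis using k(1) by (intro exI[of _ "Suc (Suc k)"]) auto
qed

lemma head_0: "head 0 (run prog K x u 7)"
proof -
  have s: "stp c = assign a k c" if "pc c = p" "p < 106" "prog ! p = Const a k" for c p a k
    using that by (simp add: stp)
  define c0 where "c0 = init K"
  define c1 where "c1 = assign 21 1 c0"
  define c2 where "c2 = assign 22 2 c1"
  define c3 where "c3 = assign 23 4 c2"
  define c4 where "c4 = assign 24 16 c3"
  define c5 where "c5 = assign 14 1 c4"
  define c6 where "c6 = assign 16 16 c5"
  define c7 where "c7 = assign 25 128 c6"
  have p0: "pc c0 = 0" by (simp add: c0_def init_def)
  have p1: "pc c1 = 1" using p0 by (simp add: c1_def)
  have p2: "pc c2 = 2" using p1 by (simp add: c2_def)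
  have p3: "pc c3 = 3" using p2 by (simp add: c3_def)
  have p4: "pc c4 = 4" using p3 by (simp add: c4_def)
  have p5: "pc c5 = 5" using p4 by (simp add: c5_def)
  have p6: "pc c6 = 6" using p5 by (simp add: c6_def)
  have p7: "pc c7 = 7" using p6 by (simp add: c7_def)
  have s0: "stp c0 = c1" unfolding c1_def by (rule s[OF p0 _ fetch(1)]) simp
  have s1: "stp c1 = c2" unfolding c2_def by (rule s[OF p1 _ fetch(2)]) simp
  have s2: "stp c2 = c3" unfolding c3_def by (rule s[OF p2 _ fetch(3)]) simp
  have s3: "stp c3 = c4" unfolding c4_def by (rule s[OF p3 _ fetch(4)]) simp
  have s4: "stp c4 = c5" unfolding c5_def by (rule s[OF p4 _ fetch(5)]) simp
  have s5: "stp c5 = c6" unfolding c6_def by (rule s[OF p5 _ fetch(6)]) simp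
  have s6: "stp c6 = c7" unfolding c7_def by (rule s[OF p6 _ fetch(7)]) simp
  have n7: "7 = Suc (Suc (Suc (Suc (Suc (Suc (Suc 0))))))" by simp
  have "run prog K x u 7 = c7"
    unfolding run_def c0_def[symmetric] n7 by (simp only: funpow.simps comp_apply id_apply s0 s1 s2 s3 s4 s5 s6)
  then show ?thesis unfolding head_def
    using p7 by (simp add: rel_def clean_def s0_def c7_def c6_def c5_def c4_def c3_def c2_def c1_def c0_def init_def)
qed

lemma run_add: "run prog K x u (m + n) = (stp ^^ n) (run prog K x u m)"
  by (simp add: run_def funpow_add[of n m, unfolded comp_def] add.commute[of m n])

text \<open>\<open>f t\<close> counts the machine steps until the head of the loop is reached with
  \<open>t\<close> pulls made.\<close>

lemma heads:
  "\<exists>f. f 0 = 7 \<and> (\<forall>t. f t < f (Suc t) \<and> f (Suc t) \<le> f t + 100 \<and> head t (run prog K x u (f t)) \<and>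
     (\<forall>n. f t < n \<and> n \<le> f (Suc t) \<longrightarrow> time (run prog K x u n) = Suc t \<and>
        last_arm (run prog K x u n) = arm (sq K x u t)))"
proof -
  have "\<exists>f. \<forall>t. (head t (run prog K x u (f t)) \<and> (t = 0 \<longrightarrow> f t = 7)) \<and>
     (f t < f (Suc t) \<and> f (Suc t) \<le> f t + 100 \<and> (\<forall>n. f t < n \<and> n \<le> f (Suc t) \<longrightarrow> time (run prog K x u n) = Suc t \<and>
        last_arm (run prog K x u n) = arm (sq K x u t)))"
  proof (rule dependent_nat_choice)
    show "\<exists>n. head 0 (run prog K x u n) \<and> (0 = 0 \<longrightarrow> n = 7)" using head_0 by blast
  next
    fix n t assume "head t (run prog K x u n) \<and> (t = 0 \<longrightarrow> n = 7)"
    then obtain k where k: "1 \<le> k" "k \<le> 100" "head (Suc t) ((stp ^^ k) (run prog K x u n))"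
      "\<forall>i. 1 \<le> i \<and> i \<le> k \<longrightarrow> time ((stp ^^ i) (run prog K x u n)) = Suc t \<and>
        last_arm ((stp ^^ i) (run prog K x u n)) = arm (sq K x u t)"
      using main_loop by blast
    have "time (run prog K x u j) = Suc t \<and> last_arm (run prog K x u j) = arm (sq K x u t)" if "n < j" "j \<le> n + k" for j
    proof -
      have "j = n + (j - n)" "1 \<le> j - n" "j - n \<le> k" using that by auto
      moreover have "run prog K x u j = (stp ^^ (j - n)) (run prog K x u n)"
        using run_add[of n "j - n"] that by simp
      ultimately show ?thesis using k(4) by simp
    qed
    then show "\<exists>n'. (head (Suc t) (run prog K x u n') \<and> (Suc t = 0 \<longrightarrow> n' = 7)) \<and> n < n' \<and> n' \<le> n + 100 \<and>
      (\<forall>j. n < j \<and> j \<le> n' \<longrightarrow> time (run prog K x u j) = Suc t \<and> last_arm (run prog K x u j) = arm (sq K x u t))"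
      using k by (intro exI[of _ "n + k"]) (auto simp: run_add)
  qed
  then obtain f where "\<forall>t. (head t (run prog K x u (f t)) \<and> (t = 0 \<longrightarrow> f t = 7)) \<and>
     (f t < f (Suc t) \<and> f (Suc t) \<le> f t + 100 \<and> (\<forall>n. f t < n \<and> n \<le> f (Suc t) \<longrightarrow> time (run prog K x u n) = Suc t \<and>
        last_arm (run prog K x u n) = arm (sq K x u t)))" ..
  then show ?thesis by (intro exI[of _ f]) blast
qed

lemma time_le: "time c \<le> time (Defs.step P x u c)"
  by (cases "P ! pc c") (simp_all add: Defs.step_def)

lemma time_mono: "m \<le> n \<Longrightarrow> time (run P K x u m) \<le> time (run P K x u n)"
  by (rule lift_Suc_mono_le[of "\<lambda>n. time (run P K x u n)"]) (simp_all add: run_def time_le)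

text \<open>The pull is the first instruction of an iteration, so the clock first shows
  \<open>Suc t\<close> one step after \<open>f t\<close>.\<close>

lemma chosen: "chosen_arm prog K x u (Suc t) = arm (sq K x u t)" "\<exists>n. time (run prog K x u n) = t"
proof -
  obtain f where f: "\<And>t. f t < f (Suc t)" "\<And>t. head t (run prog K x u (f t))"
    "\<And>t n. f t < n \<Longrightarrow> n \<le> f (Suc t) \<Longrightarrow> time (run prog K x u n) = Suc t \<and>
        last_arm (run prog K x u n) = arm (sq K x u t)"
    using heads by blast
  have 1: "time (run prog K x u (Suc (f t))) = Suc t \<and> last_arm (run prog K x u (Suc (f t))) = arm (sq K x u t)"
    by (rule f(3)) (use f(1)[of t] in auto)
  have "(LEAST n. time (run prog K x u n) = Suc t) = Suc (f t)"
  proof (rule Least_equality)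
    fix n assume n: "time (run prog K x u n) = Suc t"
    show "Suc (f t) \<le> n"
    proof (rule ccontr)
      assume "\<not> Suc (f t) \<le> n"
      then have "time (run prog K x u n) \<le> time (run prog K x u (f t))" by (intro time_mono) simp
      then show False using n f(2)[of t] by (simp add: head_def)
    qed
  qed (use 1 in simp)
  then show "chosen_arm prog K x u (Suc t) = arm (sq K x u t)" using 1 by (simp add: chosen_arm_def)
  show "\<exists>n. time (run prog K x u n) = t" using f(2)[of t] by (auto simp: head_def)
qed

end

subsection \<open>Space\<close>

text \<open>The invariant of an epoch that has lasted for \<open>e\<close> pulls. The precision and the scales are
  polynomial in \<open>e\<close> because entering the next pass or scale takes long enough.\<close>

definition body :: "nat \<Rightarrow> st \<Rightarrow> bool" where
  "body e s \<longleftrightarrow> 256 \<le> prec s \<and> prec s \<le> 2 * e + 256 \<and> (md s = 1 \<longrightarrow> prec s \<le> e + cnt s) \<and>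
     (md s \<noteq> 1 \<longrightarrow> prec s \<le> e \<and> bj s \<le> e + cnt s) \<and> lev s \<le> e \<and> gl s \<le> e \<and> 1 \<le> bj s \<and> bj s \<le> 4 * e + 4096 \<and>
     1 \<le> cnt s \<and> cnt s \<le> len s \<and>
     len s \<le> prec s * prec s * lm s + bj s * Suc (gl s + lev s) + bj s * lm s \<and>
     acc s + cnt s * prec s \<le> len s * prec s \<and> bm s \<le> prec s \<and> cbst s \<le> prec s \<and> thr s \<le> prec s"

text \<open>The part of \<open>body\<close> that is needed before the next test is set up.\<close>

definition pre :: "nat \<Rightarrow> st \<Rightarrow> bool" where
  "pre e s \<longleftrightarrow> 1 \<le> lm s \<and> 256 \<le> prec s \<and> prec s \<le> 2 * e + 256 \<and> (md s \<noteq> 1 \<longrightarrow> prec s \<le> e) \<and>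
     gl s \<le> e \<and> bm s \<le> prec s \<and> cbst s \<le> prec s"

text \<open>A new test has at least \<open>prec\<close> pulls for a leader and at least
  \<open>bj\<close> otherwise. When it is over, the elapsed time therefore covers this value, which
  justifies doubling \<open>prec\<close> or quadrupling \<open>bj\<close>.\<close>

lemma body_setlen:
  assumes "pre e s" "lev s \<le> e" "1 \<le> bj s" "bj s \<le> 4 * e + 4096" "thr s \<le> prec s"
  shows "body e (setlen s)"
proof -
  have w: "1 \<le> wt (gl s) (lev s)" "wt (gl s) (lev s) \<le> Suc (gl s + lev s)" by (auto simp: wt_def)
  have 1: "bj s * 1 \<le> bj s * wt (gl s) (lev s)" "bj s * wt (gl s) (lev s) \<le> bj s * Suc (gl s + lev s)"
    using w by (intro mult_le_mono; simp)+
  have 2: "bj s * 1 \<le> bj s * lm s" using assms by (intro mult_le_mono) (auto simp: pre_def)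
  have "256 * prec s \<le> prec s * prec s" using assms by (intro mult_le_mono) (auto simp: pre_def)
  then have "prec s * 16 \<le> prec s * prec s" by linarith
  then have 3: "prec s \<le> prec s * prec s div 16" using div_le_mono[of "prec s * 16" _ 16] by simp
  then have 4: "prec s * 1 \<le> prec s * prec s div 16 * lm s" using assms by (intro mult_le_mono) (auto simp: pre_def)
  have 5: "prec s * prec s div 16 * lm s \<le> prec s * prec s * lm s" by (intro mult_le_mono) auto
  have 6: "256 \<le> prec s" using assms by (simp add: pre_def)
  define n where "n = len (setlen s)"
  have r: "setlen s = s\<lparr>acc := 0, len := n, cnt := n\<rparr>" by (simp add: n_def setlen_def Let_def)
  have n: "n = (if md s = 1 then prec s * prec s div 16 * lm s
      else if md s = 2 then bj s * wt (gl s) (lev s) else bj s * lm s)" by (simp add: n_def setlen_def Let_def)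
  have "n \<le> prec s * prec s * lm s + bj s * Suc (gl s + lev s) + bj s * lm s"
    unfolding n using 1 5 by (simp only: split: if_split) linarith
  moreover have "1 \<le> n" unfolding n using 1 2 4 6 assms(3) by (simp only: split: if_split) linarith
  moreover have "md s = 1 \<Longrightarrow> prec s \<le> n" "md s \<noteq> 1 \<Longrightarrow> bj s \<le> n"
    unfolding n using 1 2 4 by simp_all
  ultimately show ?thesis
    using assms 6 unfolding r body_def pre_def by (auto simp del: mult_Suc_right)
qed

lemma body_reset: "pre e s \<Longrightarrow> body e (reset s)"
  unfolding reset_def by (rule body_setlen) (auto simp: pre_def)

lemma body_adv:
  assumes "pre e s" "Suc (lev s) \<le> e" "1 \<le> bj s" "bj s \<le> e" "thr s \<le> prec s"
  shows "body e (adv s)"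
  unfolding adv_def by (rule body_setlen) (use assms in \<open>auto simp: pre_def\<close>)

lemma body_next_arm:
  assumes "pre e s" "prec s \<le> e"
  shows "body e (next_arm K s)"
  unfolding next_arm_def using assms by (auto simp: pre_def intro!: body_reset)

lemma body_bend:
  assumes "pre e s" "prec s \<le> e" "Suc (lev s) \<le> e" "1 \<le> bj s" "md s \<noteq> 1 \<Longrightarrow> bj s \<le> e" "thr s \<le> prec s"
    and "acc s \<le> len s * prec s"
  shows "body e (bend K s v)"
proof -
  have e: "acc s div len s \<le> prec s"
    using div_le_mono[OF assms(7), of "len s"] by (cases "len s = 0") auto
  have p: "pre e (s\<lparr>md := 3\<rparr>)" "pre e (s\<lparr>gl := max (gl s) (lev s)\<rparr>)"
    "pre e (s\<lparr>md := 2, arm := 0, bm := acc s div len s, cnd := arm s, cbst := acc s div len s\<rparr>)"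
    "pre e (s\<lparr>cnd := arm s, cbst := acc s div len s\<rparr>)"
    using assms e by (auto simp: pre_def)
  show ?thesis
    unfolding bend_def Let_def
    using p assms by (auto simp only: split: if_split intro!: body_reset body_adv body_next_arm) (simp_all add: st.simps)
qed

text \<open>Quadratic bounds for \<open>hor\<close> are possible since it is squared only when the
  epoch of that length has been played, or, in the warm-up, while it is at most
  \<open>K + 1\<close>.\<close>

definition Inv :: "nat \<Rightarrow> nat \<Rightarrow> st \<Rightarrow> bool" where
  "Inv K t s \<longleftrightarrow> arm s < K \<and> cnd s < K \<and> 1 \<le> lm s \<and> lm s \<le> hor s \<and> 16 \<le> hor s \<and> md s \<le> 3 \<and>
     (md s = 0 \<longrightarrow> t = arm s \<and> hor s \<le> 16 * (K + 1)\<^sup>2 \<and> s = s0\<lparr>arm := arm s, lm := lm s, hor := hor s\<rparr>) \<and>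
     (md s \<noteq> 0 \<longrightarrow> 1 \<le> t \<and> hor s \<le> 16 * (K * t + 1)\<^sup>2 \<and> 1 \<le> tau s \<and> tau s \<le> hor s \<and> hor s \<le> t + tau s \<and>
        body (hor s - tau s) s)"

text \<open>Gives access to the facts of the locale that concern single transitions and hold for any
  distributions.\<close>

lemma trivial_bandit: "0 < K \<Longrightarrow> bandit K (\<lambda>_. return borel 0)"
  by (simp add: bandit_def bandit_instance_def prob_space_return)

lemma md_bend: "md s \<le> 3 \<Longrightarrow> md (bend K s v) \<le> 3"
  by (simp add: bend_def Let_def next_arm_def reset_def setlen_def adv_def)

lemma Inv_start:
  assumes "1 \<le> lm s" "lm s \<le> hor s" "16 \<le> hor s" "1 \<le> t" "hor s \<le> 16 * (K * t + 1)\<^sup>2" "0 < K"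
  shows "Inv K t (start_epoch s)"
proof -
  have "body 0 (start_epoch s)"
    unfolding start_epoch_def using assms by (intro body_reset) (simp add: pre_def)
  then show ?thesis using assms
    by (simp add: Inv_def start_epoch_def reset_def setlen_def Let_def)
qed

lemma Inv_kstep:
  assumes "Inv K t s" "md s \<noteq> 0" "1 < tau s" "y \<le> prec s" "0 < K"
  shows "Inv K (Suc t) (kstep K (s\<lparr>tau := tau s - 1\<rparr>) y v)"
proof -
  interpret bandit K "\<lambda>_. return borel 0" by (rule trivial_bandit) fact
  let ?s = "s\<lparr>tau := tau s - 1\<rparr>"
  let ?r = "kstep K ?s y v"
  note I = assms(1)[unfolded Inv_def]
  have ok: "ok ?r" by (rule ok_kstep) (use I in \<open>simp add: ok_def\<close>)
  have f: "lm ?r = lm s" "hor ?r = hor s" "tau ?r = tau s - 1" "md ?r \<noteq> 0"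
    using kstep_fields[of ?s y v] assms(2) by simp_all
  have md: "md ?r \<le> 3" using I md_bend by (simp add: kstep_def Let_def)
  define e where "e = hor s - tau s"
  have "tau s \<le> hor s" using I assms(2) by simp
  then have e: "hor s - (tau s - 1) = Suc e" using assms(3) unfolding e_def by linarith
  have b: "body e s" using I assms(2) by (simp add: e_def)
  have "body (Suc e) ?r"
  proof (cases "1 < cnt s")
    case True
    then obtain n where n: "cnt s = Suc n" "1 \<le> n" by (cases "cnt s") auto
    have r: "?r = s\<lparr>tau := tau s - 1, acc := acc s + y, cnt := n\<rparr>" using True n by (simp add: kstep_def Let_def)
    have "acc s + y + n * prec s \<le> len s * prec s" using b n assms(4) by (simp add: body_def)
    then show ?thesis unfolding r using b n by (auto simp: body_def)
  next
    case False
    then have n: "cnt s = 1" using b by (simp add: body_def)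
    have r: "?r = bend K (s\<lparr>tau := tau s - 1, acc := acc s + y\<rparr>) v" using False by (simp add: kstep_def Let_def)
    show ?thesis unfolding r
      by (rule body_bend) (use b n assms(4) I in \<open>auto simp: body_def pre_def\<close>)
  qed
  then have b': "body (hor ?r - tau ?r) ?r" using f e by simp
  have "(K * t + 1)\<^sup>2 \<le> (K * Suc t + 1)\<^sup>2" by (intro power_mono) auto
  moreover have "hor s \<le> 16 * (K * t + 1)\<^sup>2" using I assms(2) by blast
  ultimately have h: "hor ?r \<le> 16 * (K * Suc t + 1)\<^sup>2" using f by linarith
  have "tau s \<le> hor s" "hor s \<le> t + tau s" using I assms(2) by simp_all
  then have "1 \<le> tau ?r" "tau ?r \<le> hor ?r" "hor ?r \<le> Suc t + tau ?r" using f assms(3) by simp_all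
  moreover have "arm ?r < K" "cnd ?r < K" using ok by (simp_all add: ok_def)
  moreover have "1 \<le> lm ?r" "lm ?r \<le> hor ?r" "16 \<le> hor ?r" using I f by simp_all
  ultimately show ?thesis
    using f(4) md b' h unfolding Inv_def by simp
qed

lemma Inv_nxt:
  assumes "Inv K t s" "y \<le> prec s" "0 < K"
  shows "Inv K (Suc t) (nxt K s y v)"
proof -
  note I = assms(1)[unfolded Inv_def]
  have dbl: "2 * lm s \<le> hor s * hor s" using I by (intro mult_le_mono) auto
  have big: "16 \<le> hor s * hor s" using I mult_le_mono[of 16 "hor s" 1 "hor s"] by simp
  show ?thesis
  proof (cases "md s = 0")
    case True
    define s' where "s' = (if hor s < arm s + 2 then s\<lparr>lm := 2 * lm s, hor := hor s * hor s\<rparr> else s)"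
    have "hor s * hor s \<le> 16 * (K + 1)\<^sup>2" if "hor s < arm s + 2"
    proof -
      have "hor s \<le> K + 1" using that I by simp
      then have "hor s * hor s \<le> (K + 1) * (K + 1)" by (intro mult_le_mono)
      then show ?thesis by (simp add: power2_eq_square)
    qed
    then have s': "1 \<le> lm s'" "lm s' \<le> hor s'" "16 \<le> hor s'" "hor s' \<le> 16 * (K + 1)\<^sup>2"
      using I True dbl big unfolding s'_def by (auto split: if_splits)
    have c: "s = s0\<lparr>arm := arm s, lm := lm s, hor := hor s\<rparr>" using I True by blast
    have "s\<lparr>lm := a, hor := b\<rparr> = s0\<lparr>arm := arm s, lm := a, hor := b\<rparr>" for a b
      using c by (cases s) (simp add: s0_def)
    then have c': "s' = s0\<lparr>arm := arm s, lm := lm s', hor := hor s'\<rparr>"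
      using c unfolding s'_def by auto
    show ?thesis
    proof (cases "Suc (arm s) < K")
      case arm: True
      have "nxt K s y v = s'\<lparr>arm := Suc (arm s)\<rparr>" using True arm by (simp add: nxt_def s'_def Let_def)
      also have "\<dots> = s0\<lparr>arm := Suc (arm s), lm := lm s', hor := hor s'\<rparr>" by (subst c') simp
      finally show ?thesis using s'(1-4) arm I True by (simp add: Inv_def s0_def)
    next
      case False
      then have K: "Suc t = K" using I True by simp
      have "nxt K s y v = start_epoch s'" using True False by (simp add: nxt_def s'_def Let_def)
      moreover have "(K + 1)\<^sup>2 \<le> (K * K + 1)\<^sup>2" using assms(3) by (intro power_mono) auto
      then have "hor s' \<le> 16 * (K * Suc t + 1)\<^sup>2" using s'(4) unfolding K by linarith
      ultimately show ?thesis using s'(1-3) assms(3) Inv_start by simp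
    qed
  next
    case False
    show ?thesis
    proof (cases "1 < tau s")
      case True
      then show ?thesis using Inv_kstep[OF assms(1) False True assms(2,3)] False by (simp add: nxt_def)
    next
      case tau: False
      have "hor s \<le> K * Suc t + 1" using I False tau assms(3) mult_le_mono[of 1 K "Suc t" "Suc t"] by simp
      then have "hor s * hor s \<le> (K * Suc t + 1) * (K * Suc t + 1)" by (intro mult_le_mono)
      then have "hor s * hor s \<le> 16 * (K * Suc t + 1)\<^sup>2" by (simp add: power2_eq_square)
      moreover have "nxt K s y v = start_epoch (s\<lparr>lm := 2 * lm s, hor := hor s * hor s\<rparr>)"
        using False tau by (simp add: nxt_def)
      ultimately show ?thesis using dbl big I assms(3) by (auto intro!: Inv_start)
    qed
  qed
qed

lemma Inv_sq:
  assumes "0 < K" "x \<in> reward_tables K"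
  shows "Inv K t (sq K x u t)"
proof (induction t)
  case 0
  then show ?case using assms(1) by (simp add: Inv_def s0_def)
next
  case (Suc t)
  let ?s = "sq K x u t"
  have "arm ?s < K" using Suc by (simp add: Inv_def)
  then have "x (arm ?s, Suc t) \<le> 1" "0 \<le> x (arm ?s, Suc t)"
    using assms(2) by (auto simp: reward_tables_def Pi_def)
  then have "x (arm ?s, Suc t) * real (prec ?s) \<le> 1 * real (prec ?s)" by (intro mult_right_mono) auto
  then have "\<lfloor>x (arm ?s, Suc t) * real (prec ?s)\<rfloor> \<le> int (prec ?s)" by (simp add: floor_le_iff)
  then have "nat \<lfloor>x (arm ?s, Suc t) * real (prec ?s)\<rfloor> \<le> prec ?s" by linarith
  from Inv_nxt[OF Suc this assms(1)] show ?case by (simp add: Let_def)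
qed

text \<open>As \<open>X\<close> is at least 2, a constant factor \<open>2 ^ a\<close> is at most
  \<open>X ^ a\<close>; so all constants turn into exponents, and 60 is large enough for every
  field.\<close>

lemma Inv_bound:
  assumes "Inv K t s" and X: "K < X" "K * t < X" "0 < K"
  shows "list_all (\<lambda>f. f \<le> X ^ 60) [md s, arm s, cnt s, len s, acc s, lev s, gl s, prec s, bm s, cnd s, cbst s,
    bj s, thr s, lm s, tau s, hor s]"
proof -
  note I = assms(1)[unfolded Inv_def]
  have X2: "2 \<le> X" using X by simp
  have p: "X ^ a \<le> X ^ b" if "a \<le> b" for a b using X2 that by (intro power_increasing) auto
  have le60: "n \<le> X ^ a \<Longrightarrow> a \<le> 60 \<Longrightarrow> n \<le> X ^ 60" for n a using p[of a 60] by linarith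
  have two: "2 ^ a \<le> X ^ a" for a using X2 by (intro power_mono) auto
  have K: "K \<le> X ^ 60" using X p[of 1 60] by simp
  have pm: "X ^ a * X ^ b = X ^ (a + b)" for a b by (simp add: power_add)
  have t: "t \<le> X"
  proof -
    have "t \<le> K * t" using X by simp
    then show ?thesis using X by linarith
  qed
  have hor: "hor s \<le> X ^ 6"
  proof -
    have "hor s \<le> 16 * X\<^sup>2"
    proof (cases "md s = 0")
      case True
      have "(K + 1)\<^sup>2 \<le> X\<^sup>2" using X by (intro power_mono) auto
      moreover have "hor s \<le> 16 * (K + 1)\<^sup>2" using I True by blast
      ultimately show ?thesis by linarith
    next
      case False
      have "(K * t + 1)\<^sup>2 \<le> X\<^sup>2" using X by (intro power_mono) auto
      moreover have "hor s \<le> 16 * (K * t + 1)\<^sup>2" using I False by blast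
      ultimately show ?thesis by linarith
    qed
    also have "\<dots> \<le> X ^ 4 * X ^ 2" using two[of 4] by (intro mult_le_mono) auto
    finally show ?thesis by (simp only: pm) simp
  qed
  have "lm s \<le> hor s" "md s \<le> 3" using I by blast+
  then have lm: "lm s \<le> X ^ 6" and md: "md s \<le> X ^ 60" using hor le60[of 4 2] two[of 2] by simp_all
  show ?thesis
  proof (cases "md s = 0")
    case True
    then obtain A L H where "s = s0\<lparr>arm := A, lm := L, hor := H\<rparr>" using I by blast
    then have z: "cnt s = 0" "len s = 0" "acc s = 0" "lev s = 0" "gl s = 0" "prec s = 0" "bm s = 0" "cnd s = 0"
      "cbst s = 0" "bj s = 0" "thr s = 0" "tau s = 0"
      by (simp_all add: s0_def)
    have "arm s < K" using I by blast
    then have "arm s \<le> X ^ 60" using K by linarith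
    then show ?thesis using le60[OF lm] le60[OF hor] True z by simp
  next
    case False
    define e where "e = hor s - tau s"
    have b: "body e s" and e: "e \<le> X" using I False t by (auto simp: e_def)
    have Xle: "X \<le> X ^ 13" using p[of 1 13] by simp
    have prec: "prec s \<le> X ^ 13"
    proof -
      have "prec s \<le> 2 * X + 256" using b e by (simp add: body_def)
      also have "\<dots> \<le> 2 ^ 12 * X" using X2 by simp
      also have "\<dots> \<le> X ^ 12 * X ^ 1" using two[of 12] by (intro mult_le_mono) auto
      finally show ?thesis by (simp only: pm) simp
    qed
    have bj: "bj s \<le> X ^ 14"
    proof -
      have "bj s \<le> 4 * X + 4096" using b e by (simp add: body_def)
      also have "\<dots> \<le> 2 ^ 13 * X" using X2 by simp
      also have "\<dots> \<le> X ^ 13 * X ^ 1" using two[of 13] by (intro mult_le_mono) auto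
      finally show ?thesis by (simp only: pm) simp
    qed
    have g: "gl s \<le> X" "lev s \<le> X" using b e by (auto simp: body_def)
    have len: "len s \<le> X ^ 34"
    proof -
      have "Suc (gl s + lev s) \<le> 2 ^ 2 * X" using g X2 by simp
      also have "\<dots> \<le> X ^ 2 * X ^ 1" using two[of 2] by (intro mult_le_mono) auto
      also have "\<dots> = X ^ 3" by (simp only: pm) simp
      finally have s: "Suc (gl s + lev s) \<le> X ^ 3" .
      have "len s \<le> prec s * prec s * lm s + bj s * Suc (gl s + lev s) + bj s * lm s"
        using b by (simp add: body_def)
      also have "\<dots> \<le> X ^ 13 * X ^ 13 * X ^ 6 + X ^ 14 * X ^ 3 + X ^ 14 * X ^ 6"
        using prec bj lm s by (intro add_le_mono mult_le_mono)
      also have "\<dots> = X ^ 32 + X ^ 17 + X ^ 20" by (simp only: pm) simp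
      also have "\<dots> \<le> 2 ^ 2 * X ^ 32" using p[of 17 32] p[of 20 32] by simp
      also have "\<dots> \<le> X ^ 2 * X ^ 32" using two[of 2] by (intro mult_le_mono) auto
      finally show ?thesis by (simp only: pm) simp
    qed
    have acc: "acc s \<le> X ^ 47"
    proof -
      have "acc s \<le> len s * prec s" using b by (simp add: body_def)
      also have "\<dots> \<le> X ^ 34 * X ^ 13" using len prec by (intro mult_le_mono)
      finally show ?thesis by (simp only: pm) simp
    qed
    have P: "prec s \<le> X ^ 60" by (rule le60[OF prec]) simp
    have "cnt s \<le> X ^ 60" "len s \<le> X ^ 60" using le60[OF len] b by (auto simp: body_def)
    moreover have "bm s \<le> X ^ 60" "cbst s \<le> X ^ 60" "thr s \<le> X ^ 60" using P b by (auto simp: body_def)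
    moreover have "lev s \<le> X ^ 60" "gl s \<le> X ^ 60" using g le60[OF Xle] by auto
    moreover have "tau s \<le> X ^ 60" using I False le60[OF hor] by simp
    moreover have "arm s \<le> X ^ 60" "cnd s \<le> X ^ 60" using I K by auto
    ultimately show ?thesis using le60[OF lm] le60[OF hor] le60[OF bj] le60[OF acc] P md by simp
  qed
qed

text \<open>Indirect addressing is excluded, so the words that can be written to are visible in the
  program text.\<close>

definition ok_instr :: "instr \<Rightarrow> bool" where
  "ok_instr i \<longleftrightarrow> (case i of Const a k \<Rightarrow> a < 28 \<and> k \<le> 4096 | Add a _ _ \<Rightarrow> a < 28 | Sub a _ _ \<Rightarrow> a < 28
     | Mult a _ _ \<Rightarrow> a < 28 | Div a _ _ \<Rightarrow> a < 28 | Rand a _ \<Rightarrow> a < 28 | Pull a _ d \<Rightarrow> a = 2 \<and> d < 28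
     | Jump _ \<Rightarrow> True | Jump_Less _ _ _ \<Rightarrow> True | _ \<Rightarrow> False)"

lemma ok_prog: "list_all ok_instr prog"
  by (simp add: prog_def prog0_def prog1_def prog2_def prog3_def prog4_def prog5_def prog6_def prog7_def
      prog8_def prog9_def prog10_def ok_instr_def)

definition small :: "nat \<Rightarrow> (nat \<Rightarrow> nat) \<Rightarrow> bool" where
  "small W w \<longleftrightarrow> (\<forall>a. w a \<le> W \<and> (28 \<le> a \<longrightarrow> w a = 0))"

lemma small_mono: "small W w \<Longrightarrow> W \<le> W' \<Longrightarrow> small W' w"
  unfolding small_def by (meson order_trans)

lemma small_upd: "small W w \<Longrightarrow> v \<le> W \<Longrightarrow> a < 28 \<Longrightarrow> small W (w(a := v))"
  by (simp add: small_def)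

lemma floor_mult_le: "0 \<le> (z::real) \<Longrightarrow> z \<le> 1 \<Longrightarrow> n \<le> W \<Longrightarrow> nat \<lfloor>z * real n\<rfloor> \<le> W"
proof -
  assume z: "0 \<le> z" "z \<le> 1" "n \<le> W"
  have "z * real n \<le> 1 * real n" using z by (intro mult_right_mono) auto
  then have "\<lfloor>z * real n\<rfloor> \<le> int n" by (simp add: floor_le_iff)
  then show ?thesis using z by linarith
qed

text \<open>An instruction at most squares the largest word, and an iteration of the loop has at most 100 of them, so
  it is enough to bound the states at the head of the loop.\<close>

lemma small_step:
  assumes c: "small W (mem c)" and W: "4096 \<le> W" and x: "x \<in> reward_tables K" and u: "u \<in> seeds"
    and pull: "time (Defs.step prog x u c) = time c \<or> mem c 2 < K"
  shows "small (W * W) (mem (Defs.step prog x u c))"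
proof (cases "pc c < length prog")
  case True
  have w: "mem c a \<le> W" for a using c by (simp add: small_def)
  have "W \<le> W * W" using W by simp
  then have WW: "W \<le> W * W" "4096 \<le> W * W" using W by linarith+
  have c': "small (W * W) (mem c)" by (rule small_mono[OF c WW(1)])
  have add: "mem c a + mem c b \<le> W * W" for a b
  proof -
    have "mem c a + mem c b \<le> 2 * W" using w[of a] w[of b] by simp
    also have "\<dots> \<le> W * W" using W by (intro mult_le_mono) auto
    finally show ?thesis .
  qed
  have mult: "mem c a * mem c b \<le> W * W" for a b using w by (intro mult_le_mono)
  have le: "mem c a \<le> W * W" for a using w[of a] WW by linarith
  have sub: "mem c a - mem c b \<le> W * W" "mem c a div mem c b \<le> W * W" for a b
    using le[of a] div_le_dividend[of "mem c a" "mem c b"] by linarith+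
  have rand: "nat \<lfloor>u n * real (mem c b)\<rfloor> \<le> W * W" for n b
    using u le by (intro floor_mult_le) (auto simp: seeds_def Pi_def less_imp_le)
  have ok: "ok_instr (prog ! pc c)" using ok_prog True by (simp add: list_all_length)
  have s: "Defs.step prog x u c = exec x u (prog ! pc c) c" using True by (simp add: Defs.step_def)
  show ?thesis
  proof (cases "prog ! pc c")
    case (Pull a b d)
    then have "mem c 2 < K" using pull by (simp add: s)
    then have "0 \<le> x (mem c 2, Suc (time c))" "x (mem c 2, Suc (time c)) \<le> 1"
      using x by (auto simp: reward_tables_def Pi_def)
    then have "nat \<lfloor>x (mem c 2, Suc (time c)) * real (mem c b)\<rfloor> \<le> W * W"
      using le by (intro floor_mult_le)
    then show ?thesis using ok c' by (simp add: s Pull ok_instr_def small_upd)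
  qed (use ok c' add mult sub rand WW in \<open>simp_all add: s ok_instr_def small_upd\<close>)
next
  case False
  have "W \<le> W * W" using W mult_le_mono[of 1 W W W] by auto
  then show ?thesis using False c small_mono by (simp add: Defs.step_def)
qed

lemma small_steps:
  assumes c: "small W (mem c)" and W: "4096 \<le> W" and x: "x \<in> reward_tables K" and u: "u \<in> seeds"
    and "\<And>i. i < n \<Longrightarrow> time ((Defs.step prog x u ^^ Suc i) c) = time ((Defs.step prog x u ^^ i) c) \<or>
      mem ((Defs.step prog x u ^^ i) c) 2 < K"
  shows "small (W ^ 2 ^ n) (mem ((Defs.step prog x u ^^ n) c))"
  using assms(5)
proof (induction n)
  case 0
  then show ?case using c by simp
next
  case (Suc n)
  have "W ^ 1 \<le> W ^ 2 ^ n" using W by (intro power_increasing) auto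
  then have "small (W ^ 2 ^ n * W ^ 2 ^ n) (mem (Defs.step prog x u ((Defs.step prog x u ^^ n) c)))"
    using Suc.IH Suc.prems W by (intro small_step[OF _ _ x u]) auto
  then show ?case by (simp add: power_add[symmetric] mult_2)
qed

lemma upt28: "[0..<28] = [0, 1, 2, 3, 4, 5, 6, 7, 8, 9, 10, 11, 12, 13, 14, 15, 16, 17, 18, 19, 20, 21,
    22, 23, 24, 25, 26, 27]"
  by (simp add: upt_rec)

lemma small_head:
  assumes "rel K s w" "clean w" "\<And>a. 28 \<le> a \<Longrightarrow> w a = 0" "K \<le> W" "128 \<le> W"
    and "list_all (\<lambda>f. f \<le> W) [md s, arm s, cnt s, len s, acc s, lev s, gl s, prec s, bm s, cnd s, cbst s,
    bj s, thr s, lm s, tau s, hor s]"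
  shows "small W w"
proof -
  have "list_all (\<lambda>a. w a \<le> W) [0..<28]"
    unfolding upt28 using assms(2,4-6) by (simp add: assms(1)[unfolded rel_def, simplified] clean_def)
  then have "w a \<le> W" if "a < 28" for a using that by (simp add: list_all_iff)
  then show ?thesis using assms(3) unfolding small_def by (metis le0 not_less)
qed

text \<open>At the head of the loop the words are at most \<open>X ^ 60\<close>, and until the next
  head they are squared at most 100 times. The final summand 1 of the exponent makes the inequality
  strict.\<close>

lemma space: "0 < K \<Longrightarrow> uses_space prog K 28 (60 * 2 ^ 100 + 1)"
  unfolding uses_space_def
proof (intro ballI allI impI)
  fix x u T n a
  assume K: "0 < K" and x: "x \<in> reward_tables K" and u: "u \<in> seeds" and T: "0 < T"
    and n: "time (run prog K x u n) \<le> T" and a: "mem (run prog K x u n) a \<noteq> 0"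
  define X where "X = K * T + 1"
  have "K \<le> K * T" using T by simp
  then have X: "K < X" "2 \<le> X" using K unfolding X_def by linarith+
  define W where "W = X ^ 60"
  have two: "2 ^ 60 \<le> W" unfolding W_def using X by (intro power_mono) auto
  then have W: "4096 \<le> W" "128 \<le> W" by simp_all
  have KW: "K \<le> W" using X power_increasing[of 1 60 X] by (simp add: W_def)
  obtain f where f0: "f 0 = 7" and f: "\<And>t. f t < f (Suc t)" "\<And>t. f (Suc t) \<le> f t + 100"
    "\<And>t. head K x u t (run prog K x u (f t))"
    "\<And>t n. f t < n \<Longrightarrow> n \<le> f (Suc t) \<Longrightarrow> time (run prog K x u n) = Suc t"
    using heads[of K x u] by blast
  have start: "small W (mem (run prog K x u 0))" using KW by (simp add: run_def init_def small_def)
  have tf: "time (run prog K x u (f t)) = t" for t using f(3)[of t] by (simp add: head_def)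
  have early: "time (run prog K x u i) = 0" if "i \<le> f 0" for i
    using time_mono[OF that, of prog K x u] tf[of 0] by simp
  have early': "time ((Defs.step prog x u ^^ i) (run prog K x u 0)) = 0" if "i \<le> 7" for i
    using early[of i] that f0 by (simp add: run_def)
  have e: "(Defs.step prog x u ^^ i) (run prog K x u (f t)) = run prog K x u (f t + i)" for i t
    using run_add[of K x u "f t" i] by simp
  have pull: "time ((Defs.step prog x u ^^ Suc i) (run prog K x u (f t))) = time ((Defs.step prog x u ^^ i) (run prog K x u (f t))) \<or>
    mem ((Defs.step prog x u ^^ i) (run prog K x u (f t))) 2 < K" if i: "i < f (Suc t) - f t" for i t
  proof (cases i)
    case 0
    have "arm (sq K x u t) < K" using Inv_sq[OF K x, of t u] by (simp add: Inv_def)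
    then show ?thesis using f(3)[of t] 0 by (simp add: head_def rel_def)
  next
    case (Suc j)
    have "time (run prog K x u (f t + i)) = Suc t" "time (run prog K x u (f t + Suc i)) = Suc t"
      by (rule f(4); use i Suc in simp)+
    then show ?thesis unfolding e by simp
  qed
  \<comment> \<open>The size of \<open>V\<close> is irrelevant here: this only shows that the words
    from address 28 on stay zero.\<close>
  have hz: "\<exists>V. small V (mem (run prog K x u (f t)))" for t
  proof (induction t)
    case 0
    have "small (W ^ 2 ^ 7) (mem ((Defs.step prog x u ^^ 7) (run prog K x u 0)))"
      by (rule small_steps[OF start W(1) x u]) (simp add: early' del: funpow.simps)
    then show ?case using f0 by (auto simp: run_def)
  next
    case (Suc t)
    then obtain V where V: "small V (mem (run prog K x u (f t)))" by blast
    let ?k = "f (Suc t) - f t"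
    have "small (max V 4096 ^ 2 ^ ?k) (mem ((Defs.step prog x u ^^ ?k) (run prog K x u (f t))))"
    proof (rule small_steps[OF _ _ x u])
      show "small (max V 4096) (mem (run prog K x u (f t)))" by (rule small_mono[OF V]) simp
      fix i assume i: "i < ?k"
      then show "time ((Defs.step prog x u ^^ Suc i) (run prog K x u (f t))) = time ((Defs.step prog x u ^^ i) (run prog K x u (f t))) \<or>
        mem ((Defs.step prog x u ^^ i) (run prog K x u (f t))) 2 < K" by (rule pull)
    qed simp
    then show ?case unfolding e using f(1)[of t] by (auto simp: less_imp_le)
  qed
  have small_f: "small W (mem (run prog K x u (f t)))" if "t \<le> T" for t
  proof (rule small_head)
    show "rel K (sq K x u t) (mem (run prog K x u (f t)))" "clean (mem (run prog K x u (f t)))"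
      using f(3)[of t] by (simp_all add: head_def)
    show "mem (run prog K x u (f t)) a = 0" if "28 \<le> a" for a
      using hz[of t] that by (auto simp: small_def)
    have "K * t < X" using mult_le_mono2[OF \<open>t \<le> T\<close>, of K] unfolding X_def by linarith
    then show "list_all (\<lambda>f. f \<le> W) [md (sq K x u t), arm (sq K x u t), cnt (sq K x u t), len (sq K x u t),
      acc (sq K x u t), lev (sq K x u t), gl (sq K x u t), prec (sq K x u t), bm (sq K x u t), cnd (sq K x u t),
      cbst (sq K x u t), bj (sq K x u t), thr (sq K x u t), lm (sq K x u t), tau (sq K x u t), hor (sq K x u t)]"
      unfolding W_def using Inv_bound[OF Inv_sq[OF K x] X(1) _ K] by blast
  qed (use W KW in auto)
  have main: "small (W ^ 2 ^ 100) (mem (run prog K x u n))"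
  proof (cases "n \<le> f 0")
    case True
    have "small (W ^ 2 ^ n) (mem ((Defs.step prog x u ^^ n) (run prog K x u 0)))"
      by (rule small_steps[OF start W(1) x u]) (use True f0 in \<open>simp add: early' del: funpow.simps\<close>)
    moreover have "(2::nat) ^ n \<le> 2 ^ 100" using True f0 by (intro power_increasing) auto
    then have "W ^ 2 ^ n \<le> W ^ 2 ^ 100" by (rule power_increasing) (use W in simp)
    ultimately show ?thesis by (simp only: small_mono run_def funpow_0)
  next
    case False
    have sm: "strict_mono f" by (rule strict_monoI_Suc) (rule f(1))
    define t where "t = (LEAST t. n \<le> f (Suc t))"
    have ex: "n \<le> f (Suc n)" using strict_mono_imp_increasing[OF sm, of "Suc n"] by simp
    have t1: "n \<le> f (Suc t)" unfolding t_def by (rule LeastI[of "\<lambda>t. n \<le> f (Suc t)", OF ex])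
    have t2: "f t < n"
    proof (cases t)
      case 0
      then show ?thesis using False by simp
    next
      case (Suc t')
      then have "\<not> n \<le> f (Suc t')" using not_less_Least[of t' "\<lambda>t. n \<le> f (Suc t)"] by (simp add: t_def)
      then show ?thesis using Suc by simp
    qed
    \<comment> \<open>Step \<open>n\<close> lies after the pull of its iteration, so the clock
      already shows \<open>Suc t\<close>.\<close>
    have tT: "Suc t \<le> T" using n f(4)[OF t2 t1] by simp
    let ?k = "n - f t"
    have "small (W ^ 2 ^ ?k) (mem ((Defs.step prog x u ^^ ?k) (run prog K x u (f t))))"
    proof (rule small_steps[OF _ W(1) x u])
      show "small W (mem (run prog K x u (f t)))" using small_f tT by simp
      fix i assume i: "i < ?k"
      then have "i < f (Suc t) - f t" using t1 by linarith
      then show "time ((Defs.step prog x u ^^ Suc i) (run prog K x u (f t))) = time ((Defs.step prog x u ^^ i) (run prog K x u (f t))) \<or>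
        mem ((Defs.step prog x u ^^ i) (run prog K x u (f t))) 2 < K" by (rule pull)
    qed
    moreover have "(2::nat) ^ ?k \<le> 2 ^ 100" using t1 f(2)[of t] by (intro power_increasing) auto
    then have "W ^ 2 ^ ?k \<le> W ^ 2 ^ 100" by (rule power_increasing) (use W in simp)
    moreover have "f t + ?k = n" using t2 by simp
    ultimately show ?thesis unfolding e by (simp only: small_mono)
  qed
  have "mem (run prog K x u n) a \<le> W ^ 2 ^ 100" using main by (simp add: small_def)
  also have "\<dots> = X ^ (60 * 2 ^ 100)" unfolding W_def by (rule power_mult[symmetric])
  also have "\<dots> < X ^ (60 * 2 ^ 100 + 1)" using X by (intro power_strict_increasing) auto
  finally show "a < 28 \<and> mem (run prog K x u n) a < (K * T + 1) ^ (60 * 2 ^ 100 + 1)"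
    using main a unfolding X_def small_def by (metis not_less)
qed

subsection \<open>The regret\<close>

lemma dyadic_scale:
  assumes "0 < g" "g \<le> 1"
  obtains m where "dl m \<le> g" "g < 2 * dl m"
proof -
  obtain n where "(1 / 2) ^ n < g" using real_arch_pow_inv[OF assms(1), of "1 / 2"] by auto
  then have ex: "dl n \<le> g" by (simp add: dl_def power_one_over)
  define m where "m = (LEAST m. dl m \<le> g)"
  have m: "dl m \<le> g" unfolding m_def by (rule LeastI[of "\<lambda>m. dl m \<le> g", OF ex])
  have "g < 2 * dl m"
  proof (cases m)
    case 0
    then show ?thesis using assms(2) by (simp add: dl_def)
  next
    case (Suc m')
    then have "\<not> dl m' \<le> g" using not_less_Least[of m' "\<lambda>m. dl m \<le> g"] by (simp add: m_def)
    then show ?thesis using Suc by (simp add: dl_Suc)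
  qed
  with m show ?thesis by (rule that)
qed

text \<open>Rounding both gaps to powers of 2 changes the logarithm of their ratio by a constant,
  which a multiple of \<open>log1\<close> absorbs as it is at least 1.\<close>

lemma scale_bound:
  assumes g: "dl m \<le> g" "g < 2 * dl m" and g': "dl m0 \<le> g'" "g' < 2 * dl m0" and le: "g' \<le> g"
  shows "m \<le> m0" "4 ^ m \<le> 4 / g\<^sup>2" "1 + real (m0 - m) \<le> 4 * log1 (g / g')"
proof -
  have pos: "0 < g" "0 < g'" using g(1) g'(1) dl_pos[of m] dl_pos[of m0] by linarith+
  show mm: "m \<le> m0"
  proof (rule ccontr)
    assume "\<not> m \<le> m0"
    then have "dl m \<le> dl (Suc m0)" by (intro dl_mono) simp
    then show False using g g' le by (simp add: dl_Suc)
  qed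
  have "g\<^sup>2 \<le> (2 * dl m)\<^sup>2" using g pos by (intro power_mono) auto
  also have "\<dots> = 4 / 4 ^ m" by (simp add: dl_def power_mult_distrib power_divide power2_eq_square flip: power_mult_distrib)
  finally show "4 ^ m \<le> 4 / g\<^sup>2" using pos by (simp add: field_simps)
  have "2 ^ (m0 - m) = dl m / dl m0" using mm by (simp add: dl_def power_diff)
  also have "\<dots> \<le> g / (g' / 2)" using g g' pos by (intro frac_le) auto
  also have "\<dots> = 2 * (g / g')" by simp
  finally have "ln (2 ^ (m0 - m)) \<le> ln (2 * (g / g'))" using pos by (subst ln_le_cancel_iff) auto
  also have "\<dots> = ln 2 + ln (g / g')" using pos by (intro ln_mult_pos) auto
  finally have *: "real (m0 - m) * ln 2 \<le> ln 2 + ln (g / g')" by (simp add: ln_realpow)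
  have ln2: "1 / 2 \<le> ln (2::real)" using ln2_ge_two_thirds by simp
  have l: "ln (g / g') \<le> log1 (g / g')" "1 \<le> log1 (g / g')" by (simp_all add: log1_def)
  show "1 + real (m0 - m) \<le> 4 * log1 (g / g')"
  proof (cases "m0 = m")
    case True
    then show ?thesis using l by simp
  next
    case False
    then have "(real (m0 - m) - 1) * (1 / 2) \<le> (real (m0 - m) - 1) * ln 2"
      using mm ln2 by (intro mult_left_mono) auto
    then show ?thesis using * l by (simp add: algebra_simps)
  qed
qed

context bandit
begin

lemma mean_bounds:
  assumes "a < K"
  shows "0 \<le> mean D a" "mean D a \<le> 1"
proof -
  interpret prob_space "D a" using D assms by simp
  have "integrable (D a) (\<lambda>r. r)"
  proof (rule integrable_const_bound[where B = 1])
    show "AE r in D a. norm r \<le> 1" using AE_D[OF assms] by eventually_elim simp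
  qed (use measurable_ident_sets[OF D(2)[OF assms]] in simp)
  moreover have "AE r in D a. r \<le> 1" "AE r in D a. 0 \<le> r"
    using AE_D[OF assms] by (eventually_elim, simp)+
  ultimately show "0 \<le> mean D a" "mean D a \<le> 1"
    unfolding mean_def by (blast intro: integral_ge_const integral_le_const)+
qed

lemma regret_bound:
  assumes T: "0 < T"
  shows "pseudo_regret prog K D T \<le> 10 * (30000 * 4096 * 16 + 1) *
    (\<Sum>i | i < K \<and> gap K D i > 0. 1 / gap K D i * log1 (gap K D i / min_gap K D) * log1 (real T))"
proof -
  have "Max (mean D ` {..<K}) \<in> mean D ` {..<K}" using K by (intro Max_in) auto
  then obtain istar where istar: "istar < K" "Max (mean D ` {..<K}) = mean D istar" by auto
  have star: "mean D i \<le> mean D istar" if "i < K" for i unfolding istar(2)[symmetric] using that by (intro Max_ge) auto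
  have gap: "gap K D i = mean D istar - mean D i" for i by (simp add: gap_def istar(2))
  define G where "G = {i. i < K \<and> gap K D i > 0}"
  have finG: "finite G" by (simp add: G_def)
  have pulls: "gap K D q * (\<Sum>t<T. pull_prob q t) \<le> 10 * (30000 * 4096 * 16 + 1) *
      (1 / gap K D q * log1 (gap K D q / min_gap K D) * log1 (real T))" if q: "q \<in> G" for q
  proof -
    define g where "g = gap K D q"
    define g' where "g' = min_gap K D"
    have g'_le: "g' \<le> gap K D i" if "i \<in> G" for i
      unfolding g'_def min_gap_def using that finG by (intro Min_le) (auto simp: G_def)
    have "g' \<in> gap K D ` G"
      unfolding g'_def min_gap_def using finG q by (fold G_def, intro Min_in) auto
    then have g'0: "0 < g'" by (auto simp: G_def)
    have g1: "g \<le> 1" using mean_bounds istar(1) q by (force simp: g_def gap G_def)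
    have gg: "g' \<le> g" "0 < g" using g'_le[OF q] q by (simp_all add: g_def G_def)
    obtain m where m: "dl m \<le> g" "g < 2 * dl m" using dyadic_scale[OF gg(2) g1] .
    obtain m0 where m0: "dl m0 \<le> g'" "g' < 2 * dl m0"
      using dyadic_scale[OF g'0 order_trans[OF gg(1) g1]] .
    note sc = scale_bound[OF m m0 gg(1)]
    define l where "l = log1 (g / g')"
    have l: "1 \<le> l" by (simp add: l_def log1_def)
    have lT: "1 \<le> log1 (real T)" by (simp add: log1_def)
    have "dl m0 \<le> mean D istar - mean D i" if "i < K" "mean D i < mean D istar" for i
      using g'_le[of i] m0(1) that by (simp add: G_def gap)
    then have "(\<Sum>t<T. pull_prob q t) \<le> 10 * (30000 * c0 * 4 ^ m * (1 + real (m0 - m)) + 1) * log1 (real T)"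
      unfolding pulls_ec using q m istar(1) star sc(1) T
      by (intro pulls_bound) (auto simp: G_def g_def gap)
    \<comment> \<open>Both factors 4 are the loss from rounding gaps to powers of 2; their product
      is the 16 of the final constant.\<close>
    also have "\<dots> \<le> 10 * (30000 * c0 * ((4 / g\<^sup>2) * (4 * l)) + 1) * log1 (real T)"
    proof -
      have "4 ^ m * (1 + real (m0 - m)) \<le> (4 / g\<^sup>2) * (4 * l)"
        using sc by (intro mult_mono) (auto simp: l_def)
      then show ?thesis using lT by (intro mult_right_mono) (auto simp: c0_def)
    qed
    finally have "g * (\<Sum>t<T. pull_prob q t) \<le> g * (10 * (30000 * c0 * ((4 / g\<^sup>2) * (4 * l)) + 1) * log1 (real T))"
      using gg by (intro mult_left_mono) auto
    also have "\<dots> = 10 * (30000 * 4096 * 16 * (1 / g * l) + g) * log1 (real T)"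
      using gg(2) by (simp add: c0_def field_simps power2_eq_square)
    \<comment> \<open>The additive 1 in the number of pulls costs regret \<open>g\<close>, which is
      at most \<open>1 / g * l\<close> because \<open>g \<le> 1\<close> and
      \<open>1 \<le> l\<close>.\<close>
    also have "\<dots> \<le> 10 * (30000 * 4096 * 16 * (1 / g * l) + 1 / g * l) * log1 (real T)"
    proof -
      have "g \<le> 1 / g * 1" using g1 gg mult_mono[of g 1 g 1] by (simp add: field_simps)
      also have "\<dots> \<le> 1 / g * l" using l gg by (intro mult_left_mono) auto
      finally show ?thesis using lT by (intro mult_right_mono) auto
    qed
    also have "\<dots> = 10 * (30000 * 4096 * 16 + 1) * (1 / g * l * log1 (real T))" by (simp add: algebra_simps)
    finally show ?thesis by (simp only: g_def l_def g'_def)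
  qed
  have shift: "(\<Sum>t=1..T. h t) = (\<Sum>t<T. h (Suc t))" for h :: "nat \<Rightarrow> real"
    by (simp add: sum.atLeast1_atMost_eq)
  have reward: "(\<integral>\<omega>. (\<Sum>t=1..T. fst \<omega> (chosen_arm prog K (fst \<omega>) (snd \<omega>) t, t)) \<partial>bandit_space K D)
      = (\<Sum>t<T. \<Sum>a<K. mean D a * pull_prob a t)"
    unfolding shift chosen BS
    by (subst Bochner_Integration.integral_sum, rule S_coord_integrable) (simp only: expected_reward)
  have arm: "(\<integral>\<omega>. (\<Sum>t=1..T. fst \<omega> (i, t)) \<partial>bandit_space K D) = (\<Sum>t<T. mean D i)" if "i < K" for i
    unfolding shift BS using that
    by (subst Bochner_Integration.integral_sum, intro coord_integrable) (simp_all only: expected_coord)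
  have pp: "0 \<le> pull_prob a t" for a t unfolding pull_prob_def by (rule integral_nonneg_AE) simp
  have "(\<integral>\<omega>. (\<Sum>t=1..T. fst \<omega> (i, t)) \<partial>bandit_space K D)
      - (\<integral>\<omega>. (\<Sum>t=1..T. fst \<omega> (chosen_arm prog K (fst \<omega>) (snd \<omega>) t, t)) \<partial>bandit_space K D)
      \<le> (\<Sum>q\<in>G. gap K D q * (\<Sum>t<T. pull_prob q t))" if i: "i < K" for i
  proof -
    have "(\<Sum>t<T. mean D i) - (\<Sum>t<T. \<Sum>a<K. mean D a * pull_prob a t)
        \<le> (\<Sum>t<T. mean D istar) - (\<Sum>t<T. \<Sum>a<K. mean D a * pull_prob a t)"
      using star[OF i] by (intro diff_right_mono sum_mono)
    also have "\<dots> = (\<Sum>t<T. \<Sum>a<K. gap K D a * pull_prob a t)"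
      unfolding sum_subtractf[symmetric]
    proof (rule sum.cong[OF refl])
      fix t
      have "(\<Sum>a<K. gap K D a * pull_prob a t)
          = mean D istar * (\<Sum>a<K. pull_prob a t) - (\<Sum>a<K. mean D a * pull_prob a t)"
        by (simp add: gap sum_subtractf sum_distrib_left algebra_simps)
      then show "mean D istar - (\<Sum>a<K. mean D a * pull_prob a t) = (\<Sum>a<K. gap K D a * pull_prob a t)"
        by (simp add: pull_prob_total)
    qed
    also have "\<dots> = (\<Sum>a<K. gap K D a * (\<Sum>t<T. pull_prob a t))"
      by (subst sum.swap) (simp add: sum_distrib_left)
    also have "\<dots> \<le> (\<Sum>a\<in>G. gap K D a * (\<Sum>t<T. pull_prob a t))"
    proof -
      have "(\<Sum>a\<in>G. gap K D a * (\<Sum>t<T. pull_prob a t)) = (\<Sum>a<K. gap K D a * (\<Sum>t<T. pull_prob a t))"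
        by (rule sum.mono_neutral_left) (use star in \<open>force simp: G_def gap\<close>)+
      then show ?thesis by simp
    qed
    finally show ?thesis unfolding reward arm[OF i] .
  qed
  then have "pseudo_regret prog K D T \<le> (\<Sum>q\<in>G. gap K D q * (\<Sum>t<T. pull_prob q t))"
    unfolding pseudo_regret_def using K by (subst Max_le_iff) auto
  also have "\<dots> \<le> (\<Sum>q\<in>G. 10 * (30000 * 4096 * 16 + 1) *
      (1 / gap K D q * log1 (gap K D q / min_gap K D) * log1 (real T)))"
    by (intro sum_mono pulls)
  finally show ?thesis unfolding sum_distrib_left G_def .
qed

end

theorem theorem1:
  shows "\<exists>(P :: program) (c :: nat) (d :: nat) (C :: real).
    \<forall>K :: nat. K > 0 \<longrightarrow>
      plays_forever P K \<and> uses_space P K c d \<and>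
      (\<forall>(D :: nat \<Rightarrow> real measure) (T :: nat). bandit_instance K D \<longrightarrow> T > 0 \<longrightarrow>
        pseudo_regret P K D T \<le>
          C * (\<Sum>i | i < K \<and> gap K D i > 0.
                 1 / gap K D i * log1 (gap K D i / min_gap K D) * log1 (real T)))"
proof (intro exI allI impI conjI)
  fix K :: nat
  assume K: "0 < K"
  show "plays_forever prog K"
    unfolding plays_forever_def
  proof (intro ballI allI impI conjI)
    fix x u t
    assume x: "x \<in> reward_tables K" and t: "1 \<le> (t::nat)"
    show "\<exists>n. time (run prog K x u n) = t" by (rule chosen(2))
    obtain t' where t': "t = Suc t'" using t by (cases t) auto
    show "chosen_arm prog K x u t < K"
      unfolding t' chosen(1) using Inv_sq[OF K x] by (simp add: Inv_def)
  qed
  show "uses_space prog K 28 (60 * 2 ^ 100 + 1)" by (rule space[OF K])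
  fix D T
  assume "bandit_instance K D" "0 < (T::nat)"
  then show "pseudo_regret prog K D T \<le> 10 * (30000 * 4096 * 16 + 1) * (\<Sum>i | i < K \<and> gap K D i > 0.
      1 / gap K D i * log1 (gap K D i / min_gap K D) * log1 (real T))"
    using bandit.regret_bound[OF bandit.intro[OF K]] by blast
qed

end
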